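(* Let $\mathbf{M}$ be a compact smooth $m$-dimensional submanifold without boundary of $\mathbf{R}^s$, with cutlocus $\mathbf{C}$ and nearest-point map $\pi$. Let $t\in\mathbf{R}^s$ with $t\notin\mathbf{C}$, put $\mu=\pi(t)$ and $G=\mathrm{I}_s-A_{t-\mu}\tan_\mu$. Let $\tilde t_n$ be random vectors in $\mathbf{R}^s$, $a_n\to\infty$ positive numbers and $V$ a positive definite $s\times s$ matrix such that $$Z_n=a_nV^{-1/2}(\tilde t_n-t)\xrightarrow{\mathcal D}Z$$ for some random vector $Z$ in $\mathbf{R}^s$; put $\tilde\mu_n=\pi(\tilde t_n)$. Then: 1. $\|\tilde\mu_n-\mu\|\to0$ in probability. If moreover $Z$ is spherical, then: 2. $a_n(\mathrm{nor}_\mu+\tan_\mu V\tan_\mu)^{-1/2}G(\tilde\mu_n-\mu)=\big((\mathrm{nor}_\mu+\tan_\mu V\tan_\mu)^{-1/2}\tan_\mu V^{1/2}\big)Z_n+o_P(1)\xrightarrow{\mathcal D}\tan_\mu Z$; 3. $a_n^2(\tilde\mu_n-\mu)^TG(\mathrm{nor}_\mu+\tan_\mu V\tan_\mu)^{-1}G(\tilde\mu_n-\mu)\xrightarrow{\mathcal D}\zeta_m^2$, where $\zeta_m^2$ does not depend on $\mu$.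
   Context: Cutlocus $\mathbf{C}$: set of $x\in\mathbf{R}^s$ for which the minimizer of $\mu\mapsto\|\mu-x\|^2$ over $\mathbf{M}$ is non-unique or has degenerate Hessian; $\pi(x)=\arg\min_{\mu\in\mathbf{M}}\|\mu-x\|$ for $x\notin\mathbf{C}$. $\tan_\mu$, $\mathrm{nor}_\mu=\mathrm{I}_s-\tan_\mu$: orthogonal projections onto tangent space $T_\mu\mathbf{M}$ and normal space $N_\mu\mathbf{M}$ (as subspaces of $\mathbf{R}^s$). For $v\in N_\mu\mathbf{M}$, the Weingarten map is $A_v(w)=-\tan_\mu(D_w\nu)$, $w\in T_\mu\mathbf{M}$, where $\nu$ is any smooth normal vector field along $\mathbf{M}$ with $\nu(\mu)=v$. Matrix square roots are symmetric positive definite ones. $Z$ spherical: $HZ\overset{\mathcal D}{=}Z$ for all orthogonal $H$; $\zeta_m^2$ is the distribution of $\sum_{i=1}^mZ_i^2$ where $Z=(Z_1,\dots,Z_s)$. $o_P(1)$: term tending to $0$ in probability. *)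

theory Defs
  imports "HOL-Analysis.Analysis" "HOL-Probability.Probability"
begin

fun iter_dderiv :: "('a::real_normed_vector \<Rightarrow> 'b::real_normed_vector) \<Rightarrow> 'a list \<Rightarrow> 'a \<Rightarrow> 'b" where
  "iter_dderiv f [] = f"
| "iter_dderiv f (v # vs) = (\<lambda>x. frechet_derivative (iter_dderiv f vs) (at x) v)"

definition smooth_on :: "'a::real_normed_vector set \<Rightarrow> ('a \<Rightarrow> 'b::real_normed_vector) \<Rightarrow> bool" where
  "smooth_on U f \<longleftrightarrow> open U \<and> (\<forall>vs. iter_dderiv f vs differentiable_on U)"

definition smooth_submanifold :: "'a::euclidean_space set \<Rightarrow> nat \<Rightarrow> bool" where
  "smooth_submanifold M m \<longleftrightarrow> m \<le> DIM('a) \<and>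
     (\<forall>p\<in>M. \<exists>U (F::'a \<Rightarrow> 'a). p \<in> U \<and> smooth_on U F \<and> M \<inter> U = {x\<in>U. F x = 0} \<and>
        (\<forall>x\<in>U. dim (range (frechet_derivative F (at x))) = DIM('a) - m))"

definition curve_in :: "'a::euclidean_space set \<Rightarrow> 'a \<Rightarrow> (real \<Rightarrow> 'a) \<Rightarrow> bool" where
  "curve_in M \<mu> \<gamma> \<longleftrightarrow> smooth_on UNIV \<gamma> \<and> \<gamma> 0 = \<mu> \<and> (\<exists>e>0. \<forall>t. \<bar>t\<bar> < e \<longrightarrow> \<gamma> t \<in> M)"

definition tangent_space :: "'a::euclidean_space set \<Rightarrow> 'a \<Rightarrow> 'a set" where
  "tangent_space M \<mu> = {v. \<exists>\<gamma>. curve_in M \<mu> \<gamma> \<and> (\<gamma> has_vector_derivative v) (at 0)}"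

definition normal_space :: "'a::euclidean_space set \<Rightarrow> 'a \<Rightarrow> 'a set" where
  "normal_space M \<mu> = {v. \<forall>w\<in>tangent_space M \<mu>. v \<bullet> w = 0}"

definition orth_proj :: "'a::euclidean_space set \<Rightarrow> 'a \<Rightarrow> 'a" where
  "orth_proj S x = (THE y. y \<in> S \<and> (\<forall>z\<in>S. (x - y) \<bullet> z = 0))"

definition tan_mat :: "(real^'s) set \<Rightarrow> real^'s \<Rightarrow> real^'s^'s" where
  "tan_mat M \<mu> = matrix (orth_proj (tangent_space M \<mu>))"

definition nor_mat :: "(real^'s) set \<Rightarrow> real^'s \<Rightarrow> real^'s^'s" where
  "nor_mat M \<mu> = mat 1 - tan_mat M \<mu>"

definition normal_field :: "'a::euclidean_space set \<Rightarrow> 'a \<Rightarrow> 'a \<Rightarrow> ('a \<Rightarrow> 'a) \<Rightarrow> bool" where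
  "normal_field M \<mu> v \<nu> \<longleftrightarrow> (\<exists>U. \<mu> \<in> U \<and> smooth_on U \<nu> \<and> (\<forall>x\<in>M \<inter> U. \<nu> x \<in> normal_space M x)) \<and> \<nu> \<mu> = v"

definition weingarten :: "(real^'s) set \<Rightarrow> real^'s \<Rightarrow> real^'s \<Rightarrow> real^'s \<Rightarrow> real^'s" where
  "weingarten M \<mu> v w =
     (let \<nu> = (SOME \<nu>. normal_field M \<mu> v \<nu>) in - (tan_mat M \<mu> *v frechet_derivative \<nu> (at \<mu>) w))"

text \<open>Second derivative of f restricted to M along a curve with velocity w (the Hessian
  quadratic form at a critical point mu).\<close>
definition hess_form :: "'a::euclidean_space set \<Rightarrow> ('a \<Rightarrow> real) \<Rightarrow> 'a \<Rightarrow> 'a \<Rightarrow> real" where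
  "hess_form M f \<mu> w =
     (let \<gamma> = (SOME \<gamma>. curve_in M \<mu> \<gamma> \<and> (\<gamma> has_vector_derivative w) (at 0))
      in deriv (deriv (\<lambda>t. f (\<gamma> t))) 0)"

definition degenerate_hessian :: "'a::euclidean_space set \<Rightarrow> ('a \<Rightarrow> real) \<Rightarrow> 'a \<Rightarrow> bool" where
  "degenerate_hessian M f \<mu> \<longleftrightarrow>
     (\<exists>w\<in>tangent_space M \<mu>. w \<noteq> 0 \<and> (\<forall>w'\<in>tangent_space M \<mu>.
        hess_form M f \<mu> (w + w') - hess_form M f \<mu> (w - w') = 0))"

definition is_nearest :: "'a::euclidean_space set \<Rightarrow> 'a \<Rightarrow> 'a \<Rightarrow> bool" where
  "is_nearest M x \<mu> \<longleftrightarrow> \<mu> \<in> M \<and> (\<forall>\<nu>\<in>M. norm (\<mu> - x) \<le> norm (\<nu> - x))"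

definition cutlocus :: "'a::euclidean_space set \<Rightarrow> 'a set" where
  "cutlocus M = {x. (\<exists>\<mu>1 \<mu>2. \<mu>1 \<noteq> \<mu>2 \<and> is_nearest M x \<mu>1 \<and> is_nearest M x \<mu>2) \<or>
                    (\<exists>\<mu>. is_nearest M x \<mu> \<and> degenerate_hessian M (\<lambda>y. norm (y - x) ^ 2) \<mu>)}"

definition nearest_point :: "'a::euclidean_space set \<Rightarrow> 'a \<Rightarrow> 'a" where
  "nearest_point M x = (THE \<mu>. is_nearest M x \<mu>)"

definition pos_def :: "real^'n^'n \<Rightarrow> bool" where
  "pos_def A \<longleftrightarrow> transpose A = A \<and> (\<forall>x. x \<noteq> 0 \<longrightarrow> x \<bullet> (A *v x) > 0)"

definition msqrt :: "real^'n^'n \<Rightarrow> real^'n^'n" where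
  "msqrt A = (THE R. pos_def R \<and> R ** R = A)"

definition conv_distr ::
  "'w measure \<Rightarrow> (nat \<Rightarrow> 'w \<Rightarrow> 'b::metric_space) \<Rightarrow> 'v measure \<Rightarrow> ('v \<Rightarrow> 'b) \<Rightarrow> bool" where
  "conv_distr P X Q Y \<longleftrightarrow>
     (\<forall>f::'b \<Rightarrow> real. continuous_on UNIV f \<and> bounded (range f) \<longrightarrow>
        (\<lambda>n. \<integral>\<omega>. f (X n \<omega>) \<partial>P) \<longlonglongrightarrow> (\<integral>\<omega>. f (Y \<omega>) \<partial>Q))"

definition conv_prob_zero :: "'w measure \<Rightarrow> (nat \<Rightarrow> 'w \<Rightarrow> 'b::real_normed_vector) \<Rightarrow> bool" where
  "conv_prob_zero P X \<longleftrightarrow>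
     (\<forall>e>0. (\<lambda>n. measure P {\<omega>\<in>space P. norm (X n \<omega>) > e}) \<longlonglongrightarrow> 0)"

definition spherical :: "'v measure \<Rightarrow> ('v \<Rightarrow> real^'s) \<Rightarrow> bool" where
  "spherical Q Z \<longleftrightarrow>
     (\<forall>H::real^'s^'s. orthogonal_matrix H \<longrightarrow> distr Q borel (\<lambda>\<omega>. H *v Z \<omega>) = distr Q borel Z)"

definition first_coords :: "nat \<Rightarrow> 's::{finite,linorder} set" where
  "first_coords m = {i. card {j. j < i} < m}"

end

theory Submission
  imports Defs
begin

text \<open>Near \<open>\<mu>\<close> a tangent vector extends to a Lipschitz field of vectors tangent to \<open>M\<close>, and \<open>t - \<mu>\<close> extends
  to a smooth normal field \<open>\<nu>\<close>. If \<open>y\<close> is nearest to \<open>x\<close>, then \<open>x - y - \<nu> y\<close> is orthogonal to the tangent field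
  at \<open>y\<close>; subtracting two such relations gives
  \<open>G (y\<^sub>1 - y\<^sub>2) = tan (x\<^sub>1 - x\<^sub>2) + o(\<parallel>x\<^sub>1 - x\<^sub>2\<parallel> + \<parallel>y\<^sub>1 - y\<^sub>2\<parallel>)\<close> near \<open>(t, \<mu>)\<close>. The Hessian of the squared
  distance is \<open>2 G\<close> on the tangent space, so \<open>G\<close> is invertible outside the cut locus. Hence nearest
  points are unique near \<open>t\<close> and \<open>\<pi>\<close> is differentiable at \<open>t\<close> with \<open>G \<circ> D\<pi> = tan\<close>. The rest is the delta
  method: the matrix \<open>B = W\<^sup>-\<^sup>1\<^sup>/\<^sup>2 tan V\<^sup>1\<^sup>/\<^sup>2\<close>, where \<open>W = nor + tan V tan\<close>, satisfies \<open>B B\<^sup>T = tan\<close>, so \<open>B = tan H\<close> with \<open>H\<close>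
  orthogonal, and sphericity removes \<open>H\<close>.\<close>

section \<open>Smooth functions and curves\<close>

text \<open>Two features of the definitions shape the proof. The equation \<open>F\<close> that cuts
  out M takes values in the ambient space, and its derivative has constant rank without having to be
  onto, so the implicit function theorem does not apply to \<open>F\<close> itself; \<open>F\<close>
  is combined with a projection onto the kernel of its derivative, and constancy of the rank keeps
  the zero set under control. Moreover \<open>tangent_space\<close>, \<open>hess_form\<close> and
  \<open>weingarten\<close> rest on curves and fields that merely exist or are picked by
  \<open>SOME\<close>: it has to be proved that tangent vectors form a subspace of dimension m and
  that the choices do not influence the relevant values. Curves must be smooth on the whole real
  line, while the inverse function theorem supplies a differentiable inverse on a small set; a sine
  reparametrisation and Cramer's rule close this gap. Nearest points are compared in pairs through
  their first-order conditions, so one inequality serves for uniqueness and for the derivative, and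
  no smooth tubular neighbourhood is constructed.\<close>

lemma has_derivative_transform_open:
  assumes "open U" "x \<in> U" "\<And>y. y \<in> U \<Longrightarrow> f y = g y"
  shows "(f has_derivative D) (at x) \<longleftrightarrow> (g has_derivative D) (at x)"
  using assms by (metis has_derivative_transform_within_open)

lemma frechet_derivative_cong_open:
  assumes "open U" "x \<in> U" "\<And>y. y \<in> U \<Longrightarrow> f y = g y"
  shows "frechet_derivative f (at x) = frechet_derivative g (at x)"
  unfolding frechet_derivative_def using has_derivative_transform_open[OF assms] by simp

lemma differentiable_on_cong_open:
  assumes "open U" "\<And>y. y \<in> U \<Longrightarrow> f y = g y" "g differentiable_on U"
  shows "f differentiable_on U"
  using assms(3) has_derivative_transform_open[OF assms(1) _ assms(2)]
  by (auto simp: differentiable_on_eq_differentiable_at[OF assms(1)] differentiable_def)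

lemma iter_dderiv_append: "iter_dderiv (iter_dderiv f vs) us = iter_dderiv f (us @ vs)"
  by (induction us) auto

lemma smooth_on_iter_dderiv:
  assumes "smooth_on U f"
  shows "smooth_on U (iter_dderiv f vs)"
  using assms unfolding smooth_on_def by (simp add: iter_dderiv_append)

lemma smooth_on_open: "smooth_on U f \<Longrightarrow> open U"
  by (simp add: smooth_on_def)

lemma smooth_on_has_derivative:
  assumes "smooth_on U f" "x \<in> U"
  shows "(f has_derivative frechet_derivative f (at x)) (at x)"
proof -
  have "iter_dderiv f [] differentiable_on U" "open U"
    using assms unfolding smooth_on_def by blast+
  then show ?thesis
    using assms(2) by (simp add: differentiable_on_eq_differentiable_at frechet_derivative_works)
qed

lemma smooth_on_iter_dderiv_continuous:
  assumes "smooth_on U f" "x \<in> U"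
  shows "isCont (iter_dderiv f vs) x"
  using smooth_on_has_derivative[OF smooth_on_iter_dderiv[OF assms(1)] assms(2)]
    has_derivative_continuous by blast

text \<open>The induction hypothesis is an equality on \<open>U\<close> only; as \<open>U\<close> is
  open, this still determines the next derivative at each point of \<open>U\<close>.\<close>

lemma iter_dderiv_linear:
  assumes "bounded_linear L" "smooth_on U f" "x \<in> U"
  shows "iter_dderiv (\<lambda>y. L (f y)) vs x = L (iter_dderiv f vs x)"
  using assms(3)
proof (induction vs arbitrary: x)
  case Nil
  then show ?case by simp
next
  case (Cons v vs)
  have U: "open U" using assms(2) by (rule smooth_on_open)
  have "((\<lambda>y. L (iter_dderiv f vs y)) has_derivative
      (\<lambda>h. L (frechet_derivative (iter_dderiv f vs) (at x) h))) (at x)"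
    by (rule bounded_linear.has_derivative[OF assms(1)
        smooth_on_has_derivative[OF smooth_on_iter_dderiv[OF assms(2)] Cons.prems]])
  then have "frechet_derivative (\<lambda>y. L (iter_dderiv f vs y)) (at x)
      = (\<lambda>h. L (frechet_derivative (iter_dderiv f vs) (at x) h))"
    by (rule frechet_derivative_at[symmetric])
  moreover have "frechet_derivative (iter_dderiv (\<lambda>y. L (f y)) vs) (at x)
      = frechet_derivative (\<lambda>y. L (iter_dderiv f vs y)) (at x)"
    by (rule frechet_derivative_cong_open[OF U Cons.prems Cons.IH])
  ultimately show ?case by simp
qed

lemma smooth_on_linear:
  assumes "bounded_linear L" "smooth_on U f"
  shows "smooth_on U (\<lambda>y. L (f y))"
  unfolding smooth_on_def
proof (intro conjI allI)
  show U: "open U" using assms(2) by (rule smooth_on_open)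
  fix vs
  have "(\<lambda>y. L (iter_dderiv f vs y)) differentiable_on U"
    using assms smooth_on_has_derivative[OF smooth_on_iter_dderiv[OF assms(2)]] U
    by (auto simp: differentiable_on_eq_differentiable_at differentiable_def
        intro!: bounded_linear.has_derivative[OF assms(1)])
  from differentiable_on_cong_open[OF U _ this]
  show "iter_dderiv (\<lambda>y. L (f y)) vs differentiable_on U"
    by (simp add: iter_dderiv_linear[OF assms])
qed

lemma iter_dderiv_add:
  assumes "smooth_on U f" "smooth_on U g" "x \<in> U"
  shows "iter_dderiv (\<lambda>y. f y + g y) vs x = iter_dderiv f vs x + iter_dderiv g vs x"
  using assms(3)
proof (induction vs arbitrary: x)
  case Nil
  then show ?case by simp
next
  case (Cons v vs)
  have U: "open U" using assms(1) by (rule smooth_on_open)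
  have "((\<lambda>y. iter_dderiv f vs y + iter_dderiv g vs y) has_derivative
      (\<lambda>h. frechet_derivative (iter_dderiv f vs) (at x) h + frechet_derivative (iter_dderiv g vs) (at x) h)) (at x)"
    using assms(1,2) Cons.prems
    by (intro has_derivative_add smooth_on_has_derivative[where U = U] smooth_on_iter_dderiv)
  then have "frechet_derivative (\<lambda>y. iter_dderiv f vs y + iter_dderiv g vs y) (at x)
      = (\<lambda>h. frechet_derivative (iter_dderiv f vs) (at x) h + frechet_derivative (iter_dderiv g vs) (at x) h)"
    by (rule frechet_derivative_at[symmetric])
  moreover have "frechet_derivative (iter_dderiv (\<lambda>y. f y + g y) vs) (at x)
      = frechet_derivative (\<lambda>y. iter_dderiv f vs y + iter_dderiv g vs y) (at x)"
    by (rule frechet_derivative_cong_open[OF U Cons.prems Cons.IH])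
  ultimately show ?case by simp
qed

lemma smooth_on_add:
  assumes "smooth_on U f" "smooth_on U g"
  shows "smooth_on U (\<lambda>y. f y + g y)"
  unfolding smooth_on_def
proof (intro conjI allI)
  show U: "open U" using assms(2) by (rule smooth_on_open)
  fix vs
  have "(\<lambda>y. iter_dderiv f vs y + iter_dderiv g vs y) differentiable_on U"
    using assms unfolding smooth_on_def by (simp add: differentiable_on_add)
  from differentiable_on_cong_open[OF U _ this]
  show "iter_dderiv (\<lambda>y. f y + g y) vs differentiable_on U"
    by (simp add: iter_dderiv_add[OF assms])
qed

lemma smooth_on_zero:
  assumes "open U"
  shows "smooth_on U (\<lambda>x::'a::real_normed_vector. 0::'b::real_normed_vector)"
proof -
  have "iter_dderiv (\<lambda>x::'a. 0::'b) vs = (\<lambda>x. 0)" for vs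
    by (induction vs) auto
  with assms show ?thesis
    unfolding smooth_on_def by simp
qed

lemma smooth_on_sum:
  assumes "open U" "\<And>i. i \<in> I \<Longrightarrow> smooth_on U (f i)"
  shows "smooth_on U (\<lambda>y. \<Sum>i\<in>I. f i y)"
  using assms(2) by (induction I rule: infinite_finite_induct) (auto simp: assms smooth_on_zero smooth_on_add)

section \<open>Quantitative differentiability near a point\<close>

text \<open>Smoothness is phrased through derivatives in fixed directions, so closeness of two
  derivatives is first known on basis vectors only. This bound passes from there to all
  directions.\<close>

lemma linear_norm_le_Basis:
  fixes L :: "'a::euclidean_space \<Rightarrow> 'b::real_normed_vector"
  assumes "linear L"
  shows "norm (L v) \<le> (\<Sum>b\<in>Basis. norm (L b)) * norm v"
proof -
  have "L (\<Sum>b\<in>Basis. (v \<bullet> b) *\<^sub>R b) = (\<Sum>b\<in>Basis. (v \<bullet> b) *\<^sub>R L b)"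
    by (simp only: linear_sum[OF assms] linear_scale[OF assms])
  then have "L v = (\<Sum>b\<in>Basis. (v \<bullet> b) *\<^sub>R L b)"
    by (simp only: euclidean_representation)
  then have "norm (L v) \<le> (\<Sum>b\<in>Basis. \<bar>v \<bullet> b\<bar> * norm (L b))"
    using norm_sum[of "\<lambda>b. (v \<bullet> b) *\<^sub>R L b" Basis] by simp
  also have "\<dots> \<le> (\<Sum>b\<in>Basis. norm v * norm (L b))"
    by (intro sum_mono mult_right_mono) (auto simp: Basis_le_norm)
  finally show ?thesis by (simp add: sum_distrib_left mult.commute)
qed

text \<open>The derivative is continuous, so near \<open>p\<close> it differs from the one at
  \<open>p\<close> by at most \<open>e\<close>; the mean value inequality for \<open>f\<close> minus
  its linear part at \<open>p\<close> does the rest. Both points may vary, which is what comparing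
  two nearest points requires.\<close>

lemma smooth_on_strict_derivative:
  fixes f :: "'a::euclidean_space \<Rightarrow> 'b::real_normed_vector"
  assumes "smooth_on U f" "p \<in> U" "e > 0"
  obtains r where "r > 0" "ball p r \<subseteq> U"
    "\<And>x y. x \<in> ball p r \<Longrightarrow> y \<in> ball p r \<Longrightarrow>
       norm (f x - f y - frechet_derivative f (at p) (x - y)) \<le> e * norm (x - y)"
proof -
  let ?D = "\<lambda>x. frechet_derivative f (at x)"
  have lin: "bounded_linear (?D x)" if "x \<in> U" for x
    using smooth_on_has_derivative[OF assms(1) that] has_derivative_bounded_linear by blast
  \<comment> \<open>The bound \<open>e / DIM('a)\<close> per basis vector adds up to
    \<open>e\<close> in \<open>linear_norm_le_Basis\<close>.\<close>
  have "\<forall>b\<in>Basis. \<forall>\<^sub>F x in nhds p. dist (?D x b) (?D p b) < e / DIM('a)"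
  proof
    fix b :: 'a assume "b \<in> Basis"
    have "isCont (iter_dderiv f [b]) p" by (rule smooth_on_iter_dderiv_continuous[OF assms(1,2)])
    then have "((\<lambda>x. ?D x b) \<longlongrightarrow> ?D p b) (nhds p)"
      by (simp add: continuous_at tendsto_nhds_iff)
    then show "\<forall>\<^sub>F x in nhds p. dist (?D x b) (?D p b) < e / DIM('a)"
      by (rule tendstoD) (use assms(3) in simp)
  qed
  then have "\<forall>\<^sub>F x in nhds p. (\<forall>b\<in>Basis. dist (?D x b) (?D p b) < e / DIM('a)) \<and> x \<in> U"
    using eventually_nhds_in_open[OF smooth_on_open[OF assms(1)] assms(2)]
    by (auto intro!: eventually_conj simp: eventually_ball_finite_distrib)
  then obtain r where r: "r > 0"
      "\<And>x. x \<in> ball p r \<Longrightarrow> (\<forall>b\<in>Basis. dist (?D x b) (?D p b) < e / DIM('a)) \<and> x \<in> U"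
    by (auto simp: eventually_nhds_metric dist_commute)
  have on: "norm (?D x h - ?D p h) \<le> e * norm h" if "x \<in> ball p r" for x h
  proof -
    have l: "linear (\<lambda>h. ?D x h - ?D p h)"
      using lin r(2)[OF that] assms(2) by (intro linear_compose_sub) (auto simp: bounded_linear.linear)
    have "(\<Sum>b\<in>Basis. norm (?D x b - ?D p b)) \<le> (\<Sum>b::'a\<in>Basis. e / DIM('a))"
      using r(2)[OF that] by (intro sum_mono) (auto simp: dist_norm less_imp_le)
    then have "(\<Sum>b\<in>Basis. norm (?D x b - ?D p b)) \<le> e" by simp
    then show ?thesis
      using linear_norm_le_Basis[OF l, of h] by (meson mult_right_mono norm_ge_zero order_trans)
  qed
  show thesis
  proof (rule that[OF r(1)])
    show "ball p r \<subseteq> U" using r(2) by blast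
    fix x y assume xy: "x \<in> ball p r" "y \<in> ball p r"
    have "norm ((\<lambda>z. f z - ?D p z) x - (\<lambda>z. f z - ?D p z) y) \<le> e * norm (x - y)"
    proof (rule differentiable_bound[OF convex_ball, of p r _ "\<lambda>z h. ?D z h - ?D p h"])
      fix z assume z: "z \<in> ball p r"
      show "((\<lambda>z. f z - ?D p z) has_derivative (\<lambda>h. ?D z h - ?D p h)) (at z within ball p r)"
        by (rule has_derivative_at_withinI[OF has_derivative_diff[OF
              smooth_on_has_derivative[OF assms(1)] bounded_linear_imp_has_derivative[OF lin[OF assms(2)]]]])
          (use r(2)[OF z] in blast)
      show "onorm (\<lambda>h. ?D z h - ?D p h) \<le> e"
        by (rule onorm_bound) (use assms(3) on[OF z] in auto)
    qed (use xy in auto)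
    then show "norm (f x - f y - ?D p (x - y)) \<le> e * norm (x - y)"
      by (simp add: linear_diff[OF bounded_linear.linear[OF lin[OF assms(2)]]] algebra_simps)
  qed
qed

lemma smooth_on_lipschitz_at:
  fixes f :: "'a::euclidean_space \<Rightarrow> 'b::real_normed_vector"
  assumes "smooth_on U f" "p \<in> U"
  obtains r C where "r > 0" "C \<ge> 0" "ball p r \<subseteq> U"
    "\<And>x y. x \<in> ball p r \<Longrightarrow> y \<in> ball p r \<Longrightarrow> norm (f x - f y) \<le> C * norm (x - y)"
proof -
  obtain r where r: "r > 0" "ball p r \<subseteq> U"
    "\<And>x y. x \<in> ball p r \<Longrightarrow> y \<in> ball p r \<Longrightarrow>
       norm (f x - f y - frechet_derivative f (at p) (x - y)) \<le> 1 * norm (x - y)"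
    using smooth_on_strict_derivative[OF assms, of 1] by auto
  have bl: "bounded_linear (frechet_derivative f (at p))"
    using smooth_on_has_derivative[OF assms] has_derivative_bounded_linear by blast
  show thesis
  proof (rule that[OF r(1) _ r(2), of "1 + onorm (frechet_derivative f (at p))"])
    show "1 + onorm (frechet_derivative f (at p)) \<ge> 0" using onorm_pos_le[OF bl] by linarith
    fix x y assume "x \<in> ball p r" "y \<in> ball p r"
    then have "norm (f x - f y - frechet_derivative f (at p) (x - y)) \<le> norm (x - y)"
      using r(3) by simp
    then have "norm (f x - f y) \<le> norm (frechet_derivative f (at p) (x - y)) + norm (x - y)"
      by norm
    then show "norm (f x - f y) \<le> (1 + onorm (frechet_derivative f (at p))) * norm (x - y)"
      using onorm[OF bl, of "x - y"] by (simp add: distrib_right)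
  qed
qed

lemma smooth_on_derivative_lipschitz:
  fixes f :: "'a::euclidean_space \<Rightarrow> 'b::real_normed_vector"
  assumes "smooth_on U f" "p \<in> U"
  obtains r C where "r > 0" "C \<ge> 0" "ball p r \<subseteq> U"
    "\<And>x y v. x \<in> ball p r \<Longrightarrow> y \<in> ball p r \<Longrightarrow>
       norm (frechet_derivative f (at x) v - frechet_derivative f (at y) v) \<le> C * norm (x - y) * norm v"
proof -
  let ?D = "\<lambda>x. frechet_derivative f (at x)"
  have "\<forall>b\<in>(Basis::'a set). \<exists>rC. fst rC > 0 \<and> snd rC \<ge> 0 \<and> ball p (fst rC) \<subseteq> U \<and>
      (\<forall>x y. x \<in> ball p (fst rC) \<longrightarrow> y \<in> ball p (fst rC) \<longrightarrow> norm (?D x b - ?D y b) \<le> snd rC * norm (x - y))"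
  proof
    fix b :: 'a
    obtain r C where "r > 0" "C \<ge> 0" "ball p r \<subseteq> U"
      "\<And>x y. x \<in> ball p r \<Longrightarrow> y \<in> ball p r \<Longrightarrow> norm (iter_dderiv f [b] x - iter_dderiv f [b] y) \<le> C * norm (x - y)"
      using smooth_on_lipschitz_at[OF smooth_on_iter_dderiv[OF assms(1), of "[b]"] assms(2)] by metis
    then show "\<exists>rC. fst rC > 0 \<and> snd rC \<ge> 0 \<and> ball p (fst rC) \<subseteq> U \<and>
      (\<forall>x y. x \<in> ball p (fst rC) \<longrightarrow> y \<in> ball p (fst rC) \<longrightarrow> norm (?D x b - ?D y b) \<le> snd rC * norm (x - y))"
      by (intro exI[of _ "(r, C)"]) simp
  qed
  then obtain rC where rC: "\<And>b. b \<in> (Basis::'a set) \<Longrightarrow> fst (rC b) > 0" "\<And>b. b \<in> (Basis::'a set) \<Longrightarrow> snd (rC b) \<ge> 0"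
    "\<And>b. b \<in> (Basis::'a set) \<Longrightarrow> ball p (fst (rC b)) \<subseteq> U"
    "\<And>b x y. b \<in> (Basis::'a set) \<Longrightarrow> x \<in> ball p (fst (rC b)) \<Longrightarrow> y \<in> ball p (fst (rC b))
       \<Longrightarrow> norm (?D x b - ?D y b) \<le> snd (rC b) * norm (x - y)"
    by (subst (asm) bchoice_iff) blast
  define r where "r = Min ((\<lambda>b. fst (rC b)) ` (Basis::'a set))"
  define C where "C = (\<Sum>b\<in>(Basis::'a set). snd (rC b))"
  have r: "r > 0" using rC(1) by (simp add: r_def)
  have sub: "ball p r \<subseteq> ball p (fst (rC b))" if "b \<in> (Basis::'a set)" for b
    using that by (intro subset_ball) (simp add: r_def)
  obtain b0 :: 'a where b0: "b0 \<in> Basis" using SOME_Basis by blast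
  show thesis
  proof (rule that[OF r])
    show "C \<ge> 0" unfolding C_def using rC(2) by (simp add: sum_nonneg)
    show rU: "ball p r \<subseteq> U" using sub[OF b0] rC(3)[OF b0] by blast
    fix x y v assume xy: "x \<in> ball p r" "y \<in> ball p r"
    have "linear (\<lambda>v. ?D x v - ?D y v)"
      using xy rU smooth_on_has_derivative[OF assms(1)] has_derivative_linear
      by (intro linear_compose_sub) blast+
    then have "norm (?D x v - ?D y v) \<le> (\<Sum>b\<in>Basis. norm (?D x b - ?D y b)) * norm v"
      by (rule linear_norm_le_Basis)
    also have "\<dots> \<le> (\<Sum>b\<in>(Basis::'a set). snd (rC b) * norm (x - y)) * norm v"
      using xy by (intro mult_right_mono sum_mono rC(4) subsetD[OF sub]) auto
    finally show "norm (?D x v - ?D y v) \<le> C * norm (x - y) * norm v"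
      by (simp add: C_def sum_distrib_right)
  qed
qed

text \<open>The second difference \<open>f (x + s u + s v) - f (x + s u) - f (x + s v) + f x\<close> is symmetric in
  \<open>u, v\<close>, and divided by \<open>s\<^sup>2\<close> it tends to the iterated derivative.\<close>

lemma second_difference_tendsto:
  fixes f :: "'a::euclidean_space \<Rightarrow> real"
  assumes "smooth_on U f" "p \<in> U"
  shows "((\<lambda>s. (f (p + s *\<^sub>R u + s *\<^sub>R v) - f (p + s *\<^sub>R u) - f (p + s *\<^sub>R v) + f p) / s\<^sup>2)
           \<longlongrightarrow> iter_dderiv f [v, u] p) (at_right 0)"
proof -
  define g where "g = iter_dderiv f [u]"
  define G where "G = frechet_derivative g (at p) v"
  let ?\<Delta> = "\<lambda>s. f (p + s *\<^sub>R u + s *\<^sub>R v) - f (p + s *\<^sub>R u) - f (p + s *\<^sub>R v) + f p"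
  let ?K = "norm u + norm v + 1"
  have K: "?K > 0" by (simp add: add_nonneg_pos)
  have g: "smooth_on U g" unfolding g_def by (rule smooth_on_iter_dderiv[OF assms(1)])
  have "((\<lambda>s. ?\<Delta> s / s\<^sup>2) \<longlongrightarrow> G) (at_right 0)"
  proof (rule tendstoI)
    fix e :: real assume e: "e > 0"
    obtain r where r: "r > 0" "ball p r \<subseteq> U"
      "\<And>x y. x \<in> ball p r \<Longrightarrow> y \<in> ball p r \<Longrightarrow>
         norm (g x - g y - frechet_derivative g (at p) (x - y)) \<le> (e / (2 * ?K)) * norm (x - y)"
      using smooth_on_strict_derivative[OF g assms(2), of "e / (2 * ?K)"] e K by auto
    have lin: "linear (frechet_derivative g (at p))"
      by (rule has_derivative_linear[OF smooth_on_has_derivative[OF g assms(2)]])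
    have main: "dist (?\<Delta> s / s\<^sup>2) G < e" if s: "0 < s" "s < r / ?K" for s
    proof -
      have sK: "s * ?K < r" using s K by (simp add: pos_less_divide_eq)
      have in_ball: "p + \<tau> *\<^sub>R u + \<sigma> *\<^sub>R v \<in> ball p r" if "0 \<le> \<tau>" "\<tau> \<le> s" "0 \<le> \<sigma>" "\<sigma> \<le> s" for \<tau> \<sigma>
      proof -
        have "norm (\<tau> *\<^sub>R u + \<sigma> *\<^sub>R v) \<le> \<tau> * norm u + \<sigma> * norm v"
          using norm_triangle_ineq[of "\<tau> *\<^sub>R u" "\<sigma> *\<^sub>R v"] that by simp
        also have "\<dots> \<le> s * norm u + s * norm v"
          using that by (intro add_mono mult_right_mono) auto
        also have "\<dots> < r" using sK s by (simp add: algebra_simps)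
        finally have "norm (- (\<tau> *\<^sub>R u + \<sigma> *\<^sub>R v)) < r" by (simp only: norm_minus_cancel)
        then show ?thesis by (simp add: dist_norm)
      qed
      \<comment> \<open>The increment along \<open>v\<close> is frozen and the mean value theorem is
        used along \<open>u\<close> only. It leaves one increment of the first derivative
        \<open>g\<close> along \<open>v\<close>, to which the strict derivative of \<open>g\<close>
        at \<open>p\<close> applies.\<close>
      define \<phi> where "\<phi> = (\<lambda>\<tau>. f (p + \<tau> *\<^sub>R u + s *\<^sub>R v) - f (p + \<tau> *\<^sub>R u))"
      have der: "(\<phi> has_real_derivative (g (p + \<tau> *\<^sub>R u + s *\<^sub>R v) - g (p + \<tau> *\<^sub>R u))) (at \<tau>)"
        if "0 \<le> \<tau>" "\<tau> \<le> s" for \<tau>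
      proof -
        have 1: "((\<lambda>\<tau>. f (p + \<tau> *\<^sub>R u + \<sigma> *\<^sub>R v)) has_real_derivative g (p + \<tau> *\<^sub>R u + \<sigma> *\<^sub>R v)) (at \<tau>)"
          if "0 \<le> \<sigma>" "\<sigma> \<le> s" for \<sigma>
        proof -
          let ?y = "p + \<tau> *\<^sub>R u + \<sigma> *\<^sub>R v"
          have fd: "(f has_derivative frechet_derivative f (at ?y)) (at ?y)"
            using smooth_on_has_derivative[OF assms(1)] r(2) in_ball that \<open>0 \<le> \<tau>\<close> \<open>\<tau> \<le> s\<close> by blast
          have "((\<lambda>\<tau>. f (p + \<tau> *\<^sub>R u + \<sigma> *\<^sub>R v)) has_derivative
              (\<lambda>h. frechet_derivative f (at ?y) (h *\<^sub>R u))) (at \<tau>)"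
            by (rule has_derivative_compose[where f = "\<lambda>\<tau>. p + \<tau> *\<^sub>R u + \<sigma> *\<^sub>R v" and g = f])
              (auto intro!: derivative_eq_intros fd)
          moreover have "frechet_derivative f (at ?y) (h *\<^sub>R u) = g ?y * h" for h
            using linear_scale[OF has_derivative_linear[OF fd], of h u] by (simp add: g_def)
          ultimately show ?thesis by (simp add: has_field_derivative_def)
        qed
        show ?thesis unfolding \<phi>_def
          using DERIV_diff[OF 1[of s] 1[of 0]] s by simp
      qed
      have "\<exists>z>0. z < s \<and>
          \<phi> s - \<phi> 0 = (s - 0) * (g (p + z *\<^sub>R u + s *\<^sub>R v) - g (p + z *\<^sub>R u))"
        by (rule MVT2[OF s(1)]) (rule der)
      then obtain z where z: "0 < z" "z < s"
        "\<phi> s - \<phi> 0 = s * (g (p + z *\<^sub>R u + s *\<^sub>R v) - g (p + z *\<^sub>R u))"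
        by auto
      have "norm (g (p + z *\<^sub>R u + s *\<^sub>R v) - g (p + z *\<^sub>R u)
            - frechet_derivative g (at p) (p + z *\<^sub>R u + s *\<^sub>R v - (p + z *\<^sub>R u)))
          \<le> e / (2 * ?K) * norm (p + z *\<^sub>R u + s *\<^sub>R v - (p + z *\<^sub>R u))"
        using in_ball[of z s] in_ball[of z 0] z(1,2) s(1) by (intro r(3)) auto
      also have "p + z *\<^sub>R u + s *\<^sub>R v - (p + z *\<^sub>R u) = s *\<^sub>R v" by simp
      finally have *: "\<bar>g (p + z *\<^sub>R u + s *\<^sub>R v) - g (p + z *\<^sub>R u) - s * G\<bar>
          \<le> e / (2 * ?K) * (s * norm v)"
        using s by (simp add: linear_scale[OF lin] G_def)
      have cancel: "e / (2 * k) * (s * k) = s * e / 2" if "k > 0" for k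
        using that by simp
      have "e / (2 * ?K) * (s * norm v) \<le> e / (2 * ?K) * (s * ?K)"
        using s e K by (intro mult_left_mono) auto
      also have "\<dots> = s * e / 2" by (rule cancel[OF K])
      also have "\<dots> < s * e" using s e by simp
      finally have **: "\<bar>g (p + z *\<^sub>R u + s *\<^sub>R v) - g (p + z *\<^sub>R u) - s * G\<bar> < s * e"
        using * by linarith
      have "?\<Delta> s = s * (g (p + z *\<^sub>R u + s *\<^sub>R v) - g (p + z *\<^sub>R u))"
        using z(3) by (simp add: \<phi>_def)
      then have "?\<Delta> s / s\<^sup>2 - G = (g (p + z *\<^sub>R u + s *\<^sub>R v) - g (p + z *\<^sub>R u) - s * G) / s"
        using s by (simp only:) (simp add: field_simps power2_eq_square)
      then show ?thesis
        using ** s by (simp add: dist_real_def pos_divide_less_eq mult.commute)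
    qed
    show "\<forall>\<^sub>F s in at_right 0. dist (?\<Delta> s / s\<^sup>2) G < e"
      unfolding eventually_at_right_field
      by (rule exI[of _ "r / ?K"]) (use main r(1) K in auto)
  qed
  then show ?thesis by (simp add: G_def g_def)
qed

lemma iter_dderiv_swap:
  fixes f :: "'a::euclidean_space \<Rightarrow> real"
  assumes "smooth_on U f" "p \<in> U"
  shows "iter_dderiv f [v, u] p = iter_dderiv f [u, v] p"
proof (rule tendsto_unique[OF _ second_difference_tendsto[OF assms]])
  have "(\<lambda>s. (f (p + s *\<^sub>R v + s *\<^sub>R u) - f (p + s *\<^sub>R v) - f (p + s *\<^sub>R u) + f p) / s\<^sup>2)
     = (\<lambda>s. (f (p + s *\<^sub>R u + s *\<^sub>R v) - f (p + s *\<^sub>R u) - f (p + s *\<^sub>R v) + f p) / s\<^sup>2)"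
    by (auto simp: fun_eq_iff algebra_simps)
  then show "((\<lambda>s. (f (p + s *\<^sub>R u + s *\<^sub>R v) - f (p + s *\<^sub>R u) - f (p + s *\<^sub>R v) + f p) / s\<^sup>2)
           \<longlongrightarrow> iter_dderiv f [u, v] p) (at_right 0)"
    using second_difference_tendsto[OF assms, of v u] by simp
qed simp

section \<open>Regularity of curves, order by order\<close>

text \<open>Everywhere k times differentiable, with the derivative as an explicit witness. A finite
  order is what a bootstrap needs: a curve solving a differential relation gains one order at a
  time, and \<open>ndiff_imp_smooth_on\<close> collects all orders at the end.\<close>

fun ndiff :: "nat \<Rightarrow> (real \<Rightarrow> 'a::real_normed_vector) \<Rightarrow> bool" where
  "ndiff 0 f = True"
| "ndiff (Suc k) f = (\<exists>f'. (\<forall>s. (f has_vector_derivative f' s) (at s)) \<and> ndiff k f')"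

lemma ndiff_Suc: "ndiff (Suc k) f \<Longrightarrow> ndiff k f"
proof (induction k arbitrary: f)
  case (Suc k)
  then obtain f' where "\<forall>s. (f has_vector_derivative f' s) (at s)" "ndiff (Suc k) f'" by auto
  with Suc.IH show ?case by auto
qed simp

lemma ndiff_linear: "bounded_linear L \<Longrightarrow> ndiff k f \<Longrightarrow> ndiff k (\<lambda>s. L (f s))"
proof (induction k arbitrary: f)
  case (Suc k)
  then obtain f' where "\<forall>s. (f has_vector_derivative f' s) (at s)" "ndiff k f'" by auto
  with Suc bounded_linear.has_vector_derivative[OF Suc.prems(1)] show ?case
    by (auto intro!: exI[of _ "\<lambda>s. L (f' s)"])
qed simp

lemma ndiff_const: "ndiff k (\<lambda>s. c)"
  by (induction k arbitrary: c) (auto intro!: exI[of _ "\<lambda>s. 0"])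

lemma ndiff_add: "ndiff k f \<Longrightarrow> ndiff k g \<Longrightarrow> ndiff k (\<lambda>s. f s + g s)"
proof (induction k arbitrary: f g)
  case (Suc k)
  then obtain f' g' where "\<forall>s. (f has_vector_derivative f' s) (at s)" "ndiff k f'"
    "\<forall>s. (g has_vector_derivative g' s) (at s)" "ndiff k g'" by auto
  with Suc show ?case
    by (auto intro!: exI[of _ "\<lambda>s. f' s + g' s"] has_vector_derivative_add)
qed simp

lemma ndiff_sum: "(\<And>i. i \<in> I \<Longrightarrow> ndiff k (f i)) \<Longrightarrow> ndiff k (\<lambda>s. \<Sum>i\<in>I. f i s)"
  by (induction I rule: infinite_finite_induct) (auto simp: ndiff_const intro: ndiff_add)

lemma ndiff_scaleR:
  fixes f :: "real \<Rightarrow> real" and g :: "real \<Rightarrow> 'a::real_normed_vector"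
  shows "ndiff k f \<Longrightarrow> ndiff k g \<Longrightarrow> ndiff k (\<lambda>s. f s *\<^sub>R g s)"
proof (induction k arbitrary: f g)
  case (Suc k)
  then obtain f' g' where *: "\<forall>s. (f has_vector_derivative f' s) (at s)" "ndiff k f'"
    "\<forall>s. (g has_vector_derivative g' s) (at s)" "ndiff k g'" by auto
  have "((\<lambda>s. f s *\<^sub>R g s) has_vector_derivative f s *\<^sub>R g' s + f' s *\<^sub>R g s) (at s)" for s
    using *(1,3) by (intro has_vector_derivative_scaleR) (auto simp: has_real_derivative_iff_has_vector_derivative)
  moreover have "ndiff k (\<lambda>s. f s *\<^sub>R g' s + f' s *\<^sub>R g s)"
    by (intro ndiff_add Suc.IH *(2,4) Suc.prems[THEN ndiff_Suc])
  ultimately show ?case by (auto intro!: exI)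
qed simp

lemma ndiff_mult:
  fixes f g :: "real \<Rightarrow> real"
  shows "ndiff k f \<Longrightarrow> ndiff k g \<Longrightarrow> ndiff k (\<lambda>s. f s * g s)"
  using ndiff_scaleR[of k f g] by simp

lemma ndiff_prod:
  fixes f :: "'i \<Rightarrow> real \<Rightarrow> real"
  shows "(\<And>i. i \<in> I \<Longrightarrow> ndiff k (f i)) \<Longrightarrow> ndiff k (\<lambda>s. \<Prod>i\<in>I. f i s)"
  by (induction I rule: infinite_finite_induct) (auto simp: ndiff_const intro: ndiff_mult)

lemma ndiff_inverse:
  fixes f :: "real \<Rightarrow> real"
  shows "ndiff k f \<Longrightarrow> (\<And>s. f s \<noteq> 0) \<Longrightarrow> ndiff k (\<lambda>s. inverse (f s))"
proof (induction k arbitrary: f)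
  case (Suc k)
  then obtain f' where *: "\<forall>s. (f has_vector_derivative f' s) (at s)" "ndiff k f'" by auto
  have "((\<lambda>s. inverse (f s)) has_vector_derivative - (inverse (f s) * f' s * inverse (f s))) (at s)" for s
    using DERIV_inverse'[of f "f' s" s UNIV] * Suc.prems(2)
    unfolding has_real_derivative_iff_has_vector_derivative[symmetric] by simp
  moreover have "ndiff k (\<lambda>s. - (inverse (f s) * f' s * inverse (f s)))"
    using Suc.prems ndiff_Suc[OF Suc.prems(1)] *
    by (intro ndiff_linear[of "\<lambda>x. - x"] bounded_linear_minus bounded_linear_ident ndiff_mult Suc.IH) auto
  ultimately show ?case by (auto intro!: exI)
qed simp

text \<open>The chain rule writes the derivative as a sum of coordinates of the velocity times
  directional derivatives of \<open>\<Phi>\<close> along the curve. These are again smooth, so the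
  induction runs over all \<open>\<Phi>\<close> with the curve fixed.\<close>

lemma ndiff_compose:
  fixes \<Phi> :: "'a::euclidean_space \<Rightarrow> 'b::real_normed_vector"
  shows "smooth_on U \<Phi> \<Longrightarrow> ndiff k \<gamma> \<Longrightarrow> (\<And>s. \<gamma> s \<in> U) \<Longrightarrow> ndiff k (\<lambda>s. \<Phi> (\<gamma> s))"
proof (induction k arbitrary: \<Phi>)
  case (Suc k)
  then obtain \<gamma>' where *: "\<forall>s. (\<gamma> has_vector_derivative \<gamma>' s) (at s)" "ndiff k \<gamma>'" by auto
  have "((\<lambda>s. \<Phi> (\<gamma> s)) has_vector_derivative (\<Sum>b\<in>Basis. (\<gamma>' s \<bullet> b) *\<^sub>R iter_dderiv \<Phi> [b] (\<gamma> s))) (at s)" for s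
  proof -
    let ?D = "frechet_derivative \<Phi> (at (\<gamma> s))"
    have D: "(\<Phi> has_derivative ?D) (at (\<gamma> s))"
      using smooth_on_has_derivative[OF Suc.prems(1)] Suc.prems(3) by blast
    have lin: "linear ?D" using D by (rule has_derivative_linear)
    have "?D (\<Sum>b\<in>Basis. (\<gamma>' s \<bullet> b) *\<^sub>R b) = (\<Sum>b\<in>Basis. (\<gamma>' s \<bullet> b) *\<^sub>R ?D b)"
      by (simp only: linear_sum[OF lin] linear_scale[OF lin])
    then have "?D (\<gamma>' s) = (\<Sum>b\<in>Basis. (\<gamma>' s \<bullet> b) *\<^sub>R ?D b)"
      by (simp only: euclidean_representation)
    moreover have "((\<lambda>s. \<Phi> (\<gamma> s)) has_derivative (\<lambda>h. ?D (h *\<^sub>R \<gamma>' s))) (at s)"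
      by (rule has_derivative_compose[where f = \<gamma> and g = \<Phi>])
        (use *(1) D in \<open>auto simp: has_vector_derivative_def\<close>)
    ultimately show ?thesis
      unfolding has_vector_derivative_def by (simp add: linear_scale[OF lin])
  qed
  moreover have "ndiff k (\<lambda>s. \<Sum>b\<in>Basis. (\<gamma>' s \<bullet> b) *\<^sub>R iter_dderiv \<Phi> [b] (\<gamma> s))"
    by (intro ndiff_sum ndiff_scaleR ndiff_linear[OF bounded_linear_inner_left] *(2)
        Suc.IH smooth_on_iter_dderiv Suc.prems(1,3) Suc.prems(2)[THEN ndiff_Suc])
  ultimately show ?case by (auto intro!: exI)
qed simp

lemma ndiff_imp_smooth_on:
  fixes f :: "real \<Rightarrow> 'a::real_normed_vector"
  assumes "\<And>k. ndiff k f"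
  shows "smooth_on UNIV f"
proof -
  have *: "\<forall>k. ndiff k (iter_dderiv f vs)" for vs
  proof (induction vs)
    case Nil
    then show ?case using assms by simp
  next
    case (Cons v vs)
    show ?case
    proof
      fix k
      obtain g' where g': "\<forall>s. (iter_dderiv f vs has_vector_derivative g' s) (at s)" "ndiff k g'"
        using Cons.IH[rule_format, of "Suc k"] by auto
      then have "frechet_derivative (iter_dderiv f vs) (at s) = (\<lambda>h. h *\<^sub>R g' s)" for s
        using frechet_derivative_at[symmetric] unfolding has_vector_derivative_def by blast
      then show "ndiff k (iter_dderiv f (v # vs))"
        using ndiff_linear[OF bounded_linear_scaleR_right[of v] g'(2)] by simp
    qed
  qed
  show ?thesis
    unfolding smooth_on_def
  proof (intro conjI allI)
    fix vs
    have "ndiff (Suc 0) (iter_dderiv f vs)" using * by blast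
    then show "iter_dderiv f vs differentiable_on UNIV"
      by (auto simp: differentiable_on_eq_differentiable_at differentiable_def has_vector_derivative_def)
  qed simp
qed

lemma smooth_curve_vector_derivative:
  fixes \<gamma> :: "real \<Rightarrow> 'a::real_normed_vector"
  assumes "smooth_on UNIV \<gamma>"
  shows "(iter_dderiv \<gamma> vs has_vector_derivative iter_dderiv \<gamma> (1 # vs) s) (at s)"
proof -
  have D: "(iter_dderiv \<gamma> vs has_derivative frechet_derivative (iter_dderiv \<gamma> vs) (at s)) (at s)"
    by (rule smooth_on_has_derivative[OF smooth_on_iter_dderiv[OF assms]]) simp
  have "frechet_derivative (iter_dderiv \<gamma> vs) (at s) = (\<lambda>h. h *\<^sub>R iter_dderiv \<gamma> (1 # vs) s)"
  proof
    fix h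
    show "frechet_derivative (iter_dderiv \<gamma> vs) (at s) h = h *\<^sub>R iter_dderiv \<gamma> (1 # vs) s"
      unfolding iter_dderiv.simps
      by (rule linear_scale[OF has_derivative_linear[OF D], of h 1, unfolded real_scaleR_def mult_1_right])
  qed
  with D show ?thesis unfolding has_vector_derivative_def by metis
qed

text \<open>The family over all \<open>a\<close> and \<open>b\<close> is closed under
  differentiation, hence the general coefficients. The case of a pure cosine is the speed of the
  curve built in \<open>local_curve_exists\<close>.\<close>

lemma ndiff_sin_cos:
  fixes a b e :: real
  assumes "e \<noteq> 0"
  shows "ndiff k (\<lambda>s. a * sin (s / e) + b * cos (s / e))"
proof (induction k arbitrary: a b)
  case (Suc k)
  have "\<forall>s. ((\<lambda>s. a * sin (s / e) + b * cos (s / e)) has_vector_derivative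
      (- b / e) * sin (s / e) + (a / e) * cos (s / e)) (at s)"
    unfolding has_real_derivative_iff_has_vector_derivative[symmetric]
    using assms by (auto intro!: derivative_eq_intros simp: mult.commute)
  then show ?case
    unfolding ndiff.simps
    by (rule exI[of _ "\<lambda>s. (- b / e) * sin (s / e) + (a / e) * cos (s / e)", OF conjI]) (rule Suc.IH)
qed simp

lemma ndiff_vec:
  fixes f :: "real \<Rightarrow> real^'n"
  assumes "\<And>i. ndiff k (\<lambda>s. f s $ i)"
  shows "ndiff k f"
proof -
  have "f = (\<lambda>s. \<Sum>i\<in>UNIV. f s $ i *\<^sub>R axis i 1)"
    by (auto simp: fun_eq_iff vec_eq_iff axis_def if_distrib if_distribR cong: if_cong)
  moreover have "ndiff k (\<lambda>s. \<Sum>i\<in>UNIV. f s $ i *\<^sub>R (axis i 1 :: real^'n))"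
    by (intro ndiff_sum ndiff_scaleR assms ndiff_const)
  ultimately show ?thesis by simp
qed

lemma ndiff_det:
  fixes A :: "real \<Rightarrow> real^'n^'n"
  assumes "\<And>i j. ndiff k (\<lambda>s. A s $ i $ j)"
  shows "ndiff k (\<lambda>s. det (A s))"
  unfolding det_def by (intro ndiff_sum ndiff_mult ndiff_const ndiff_prod assms)

text \<open>By Cramer's rule each coordinate of the solution is a quotient of determinants, that is,
  of polynomials in the entries of \<open>A\<close> and \<open>b\<close>.\<close>

lemma ndiff_linear_system:
  fixes A :: "real \<Rightarrow> real^'n^'n"
  assumes "\<And>i j. ndiff k (\<lambda>s. A s $ i $ j)" "\<And>i. ndiff k (\<lambda>s. b s $ i)"
    and "\<And>s. det (A s) \<noteq> 0" "\<And>s. A s *v x s = b s"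
  shows "ndiff k x"
proof (rule ndiff_vec)
  fix i
  have "x s $ i = det (\<chi> r c. if c = i then b s $ r else A s $ r $ c) * inverse (det (A s))" for s
    using cramer[OF assms(3), of s "x s" "b s"] assms(4) by (simp add: divide_inverse)
  moreover have "ndiff k (\<lambda>s. (\<chi> r c. if c = i then b s $ r else A s $ r $ c) $ p $ q)" for p q
    using assms by (cases "q = i") auto
  then have "ndiff k (\<lambda>s. det (\<chi> r c. if c = i then b s $ r else A s $ r $ c) * inverse (det (A s)))"
    by (intro ndiff_mult ndiff_inverse ndiff_det assms)
  ultimately show "ndiff k (\<lambda>s. x s $ i)" by simp
qed

section \<open>Square roots of matrices and partial isometries\<close>

lemma inner_transpose:
  fixes A :: "real^'n^'m"
  shows "(transpose A *v x) \<bullet> y = x \<bullet> (A *v y)"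
  by (simp add: dot_lmul_matrix)

lemma matrix_inv_mult:
  fixes A :: "real^'n^'n"
  assumes "invertible A"
  shows "A ** matrix_inv A = mat 1" "matrix_inv A ** A = mat 1"
  using someI_ex[OF assms[unfolded invertible_def]] unfolding matrix_inv_def by auto

lemma matrix_inv_eqI:
  fixes A :: "real^'n^'n"
  assumes "A ** B = mat 1"
  shows "matrix_inv A = B"
proof -
  have "invertible A" using assms invertible_right_inverse by blast
  then show ?thesis
    using matrix_inv_mult[of A] assms by (metis matrix_mul_assoc matrix_mul_lid matrix_mul_rid)
qed

lemma pos_def_invertible:
  assumes "pos_def A"
  shows "invertible A"
proof -
  have "inj ((*v) A)"
  proof (rule injI)
    fix x y assume "A *v x = A *v y"
    then have "(x - y) \<bullet> (A *v (x - y)) = 0"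
      by (simp add: matrix_vector_mult_diff_distrib)
    then show "x = y" using assms unfolding pos_def_def by (metis eq_iff_diff_eq_0 less_irrefl)
  qed
  then show ?thesis by (simp add: invertible_left_inverse matrix_left_invertible_injective)
qed

text \<open>The constant is the minimum of the quadratic form on the unit sphere, attained by
  compactness; homogeneity extends the bound.\<close>

lemma pos_def_lower_bound:
  assumes "pos_def (A :: real^'n^'n)"
  obtains c where "c > 0" "\<And>x. c * (norm x)\<^sup>2 \<le> x \<bullet> (A *v x)"
proof -
  let ?q = "\<lambda>x. x \<bullet> (A *v x)"
  have "continuous_on (sphere 0 1) ?q"
    by (intro continuous_intros linear_continuous_on linear_linear[THEN iffD1] matrix_vector_mul_linear)
      (simp add: matrix_vector_mul_bounded_linear)
  then obtain u where u: "u \<in> sphere 0 1" "\<And>y. y \<in> sphere 0 1 \<Longrightarrow> ?q u \<le> ?q y"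
    using continuous_attains_inf[of "sphere 0 1" ?q] by auto
  show thesis
  proof
    have "u \<noteq> 0" using u(1) by auto
    then show "?q u > 0" using assms unfolding pos_def_def by blast
    fix x
    show "?q u * (norm x)\<^sup>2 \<le> ?q x"
    proof (cases "x = 0")
      case False
      have "?q u \<le> ?q (x /\<^sub>R norm x)" using False by (intro u(2)) simp
      also have "\<dots> = ?q x / (norm x)\<^sup>2"
        by (simp add: matrix_vector_mult_scaleR power2_eq_square field_simps)
      finally show ?thesis using False by (simp add: pos_le_divide_eq)
    qed simp
  qed
qed

text \<open>The fixed-point argument for the square root runs inside a set cut out by such
  conditions, and closedness makes that set complete.\<close>

lemma closed_commuting_selfadjoint:
  fixes R :: "'a::euclidean_space \<Rightarrow>\<^sub>L 'a" and x y :: 'a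
  shows "closed {Y. R o\<^sub>L Y = Y o\<^sub>L R}" "closed {Y. blinfun_apply Y x \<bullet> y = x \<bullet> blinfun_apply Y y}"
  by (rule closed_Collect_eq; intro continuous_intros)+

lemma blinfun_commute_iff:
  "R o\<^sub>L S = S o\<^sub>L R \<longleftrightarrow> (\<forall>x. blinfun_apply R (blinfun_apply S x) = blinfun_apply S (blinfun_apply R x))"
  by (metis blinfun_apply_blinfun_compose blinfun_eqI)

text \<open>Writing \<open>A = \<lambda> (1 - C)\<close> with \<open>\<parallel>C\<parallel> < 1\<close>, the square root is \<open>\<surd>\<lambda> (1 - Y)\<close> for the fixed point
  \<open>Y = (C + Y\<^sup>2) / 2\<close> of a contraction.\<close>

lemma selfadjoint_sqrt_exists:
  fixes A :: "'a::euclidean_space \<Rightarrow>\<^sub>L 'a"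
  assumes sym: "\<And>x y. A x \<bullet> y = x \<bullet> A y" and c: "c > 0" "\<And>x. c * (norm x)\<^sup>2 \<le> x \<bullet> A x"
  obtains S where "S o\<^sub>L S = A" "\<And>x y. blinfun_apply S x \<bullet> y = x \<bullet> S y"
    "\<And>x. x \<noteq> 0 \<Longrightarrow> x \<bullet> blinfun_apply S x > 0"
    "\<And>R. R o\<^sub>L A = A o\<^sub>L R \<Longrightarrow> R o\<^sub>L S = S o\<^sub>L R"
proof -
  define K where "K = norm A"
  \<comment> \<open>For a scale \<open>l\<close>, the squared norm of \<open>C x\<close> is at most
    \<open>1 - 2 * c / l + (K / l)^2\<close> times that of \<open>x\<close>. The choice
    \<open>K^2 / c\<close> minimises this factor, and the minimum is \<open>\<rho>^2\<close> with
    \<open>\<rho>\<close> as defined next.\<close>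
  define l where "l = K\<^sup>2 / c"
  define \<rho> where "\<rho> = sqrt (1 - (c / K)\<^sup>2)"
  define C where "C = id_blinfun - (1 / l) *\<^sub>R A"
  have A_le: "norm (A x) \<le> K * norm x" for x unfolding K_def by (rule norm_blinfun)
  have cK: "c \<le> K"
  proof -
    obtain b :: 'a where b: "b \<in> Basis" by (meson SOME_Basis)
    have "c \<le> b \<bullet> A b" using c(2)[of b] b by simp
    also have "\<dots> \<le> norm b * norm (A b)" by (rule norm_cauchy_schwarz)
    also have "\<dots> \<le> K" using A_le[of b] b by simp
    finally show ?thesis .
  qed
  then have K: "K > 0" using c by linarith
  have l: "l > 0" unfolding l_def using K c by simp
  have \<rho>2: "\<rho>\<^sup>2 = 1 - (c / K)\<^sup>2" and \<rho>: "0 \<le> \<rho>" "\<rho> < 1"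
  proof -
    have "(c / K)\<^sup>2 \<le> 1" using cK c K by (simp add: power_le_one)
    then show "\<rho>\<^sup>2 = 1 - (c / K)\<^sup>2" "0 \<le> \<rho>" unfolding \<rho>_def by simp_all
    show "\<rho> < 1" unfolding \<rho>_def using c K by simp
  qed
  have "norm C \<le> \<rho>"
  proof (rule norm_blinfun_bound[OF \<rho>(1)])
    fix x
    have "(norm (A x))\<^sup>2 \<le> (K * norm x)\<^sup>2" using A_le by (intro power_mono) auto
    then have 1: "(norm (A x))\<^sup>2 / l\<^sup>2 \<le> (c / K)\<^sup>2 * (norm x)\<^sup>2"
      using K c by (simp add: l_def field_simps power2_eq_square)
    have 2: "2 * (c / K)\<^sup>2 * (norm x)\<^sup>2 \<le> 2 / l * (x \<bullet> A x)"
      using mult_left_mono[OF c(2)[of x], of "2 / l"] K c l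
      by (simp add: l_def field_simps power2_eq_square)
    have "(norm (C x))\<^sup>2 = (norm x)\<^sup>2 - 2 / l * (x \<bullet> A x) + (norm (A x))\<^sup>2 / l\<^sup>2"
      unfolding C_def power2_norm_eq_inner
      by (simp add: blinfun.bilinear_simps inner_diff_left inner_diff_right inner_commute power2_eq_square)
    also have "\<dots> \<le> (1 - (c / K)\<^sup>2) * (norm x)\<^sup>2" using 1 2 by (simp add: algebra_simps)
    finally have "(norm (C x))\<^sup>2 \<le> (\<rho> * norm x)\<^sup>2" by (simp add: power_mult_distrib \<rho>2)
    then show "norm (C x) \<le> \<rho> * norm x" by (rule power2_le_imp_le) (simp add: \<rho>)
  qed
  have symC: "C x \<bullet> y = x \<bullet> C y" for x y
    unfolding C_def by (simp add: blinfun.bilinear_simps inner_diff_left inner_diff_right sym)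
  have commC: "R o\<^sub>L C = C o\<^sub>L R" if "R o\<^sub>L A = A o\<^sub>L R" for R
    using that unfolding C_def blinfun_commute_iff
    by (simp add: blinfun.bilinear_simps)
  \<comment> \<open>Selfadjointness and commutation with everything that commutes with
    \<open>A\<close> are built into the domain of the contraction, so the fixed point inherits them.
    Commutation is what later gives uniqueness of the root.\<close>
  define s where "s = {Y. norm Y \<le> \<rho>} \<inter> (\<Inter>x. \<Inter>y. {Y. blinfun_apply Y x \<bullet> y = x \<bullet> blinfun_apply Y y})
      \<inter> (\<Inter>R\<in>{R. R o\<^sub>L A = A o\<^sub>L R}. {Y. R o\<^sub>L Y = Y o\<^sub>L R})"
  have sD: "norm Y \<le> \<rho>" "blinfun_apply Y x \<bullet> y = x \<bullet> blinfun_apply Y y"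
    "R o\<^sub>L A = A o\<^sub>L R \<Longrightarrow> R o\<^sub>L Y = Y o\<^sub>L R" if "Y \<in> s" for Y x y R
    using that unfolding s_def by auto
  define F where "F = (\<lambda>Y. (1/2) *\<^sub>R (C + (Y o\<^sub>L Y)))"
  have "closed {Y :: 'a \<Rightarrow>\<^sub>L 'a. norm Y \<le> \<rho>}"
    by (intro closed_Collect_le continuous_intros)
  then have "closed s"
    unfolding s_def by (intro closed_Int closed_INT ballI closed_commuting_selfadjoint)
  have "\<exists>!Y. Y \<in> s \<and> F Y = Y"
  proof (rule Banach_fix[OF complete_eq_closed[THEN iffD2, OF \<open>closed s\<close>] _ \<rho>])
    have "0 \<in> s" unfolding s_def using \<rho> by simp
    then show "s \<noteq> {}" by blast
    show "F ` s \<subseteq> s"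
    proof safe
      fix Y assume Y: "Y \<in> s"
      have "norm (Y o\<^sub>L Y) \<le> \<rho> * \<rho>"
        using norm_blinfun_compose[of Y Y] sD(1)[OF Y] by (meson mult_mono norm_ge_zero order_trans \<rho>(1))
      also have "\<dots> \<le> \<rho>" using \<rho> by (simp add: mult_left_le)
      finally have "norm (C + (Y o\<^sub>L Y)) \<le> 2 * \<rho>"
        using norm_triangle_ineq[of C "Y o\<^sub>L Y"] \<open>norm C \<le> \<rho>\<close> by linarith
      moreover have "F Y x \<bullet> y = x \<bullet> F Y y" for x y
        unfolding F_def by (simp add: blinfun.bilinear_simps inner_add_left inner_add_right symC sD(2)[OF Y])
      moreover have "R o\<^sub>L F Y = F Y o\<^sub>L R" if R: "R o\<^sub>L A = A o\<^sub>L R" for R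
        using commC[OF R] sD(3)[OF Y R] unfolding F_def blinfun_commute_iff
        by (simp add: blinfun.bilinear_simps)
      ultimately show "F Y \<in> s" unfolding s_def by (simp add: F_def)
    qed
    fix Y Y' assume Y: "Y \<in> s" "Y' \<in> s"
    have "F Y - F Y' = (1/2) *\<^sub>R ((Y o\<^sub>L (Y - Y')) + ((Y - Y') o\<^sub>L Y'))"
      unfolding F_def by (rule blinfun_eqI) (simp add: blinfun.bilinear_simps algebra_simps)
    moreover have "norm (Y o\<^sub>L (Y - Y')) \<le> \<rho> * norm (Y - Y')" "norm ((Y - Y') o\<^sub>L Y') \<le> norm (Y - Y') * \<rho>"
      using norm_blinfun_compose[of Y "Y - Y'"] norm_blinfun_compose[of "Y - Y'" Y'] sD(1) Y
      by (meson mult_left_mono mult_right_mono norm_ge_zero order_trans)+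
    ultimately have "norm (F Y - F Y') \<le> \<rho> * norm (Y - Y')"
      using norm_triangle_ineq[of "Y o\<^sub>L (Y - Y')" "(Y - Y') o\<^sub>L Y'"] by (simp add: mult.commute)
    then show "dist (F Y) (F Y') \<le> \<rho> * dist Y Y'" by (simp add: dist_norm)
  qed
  then obtain Y where Y: "Y \<in> s" and FY: "F Y = Y" by blast
  have Y2: "Y (Y x) = 2 *\<^sub>R Y x - C x" for x
  proof -
    have "2 *\<^sub>R Y x = 2 *\<^sub>R F Y x" by (simp only: FY)
    also have "\<dots> = C x + Y (Y x)" by (simp add: F_def blinfun.bilinear_simps)
    finally have "2 *\<^sub>R Y x = C x + Y (Y x)" .
    then show ?thesis by simp
  qed
  define S where "S = sqrt l *\<^sub>R (id_blinfun - Y)"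
  show thesis
  proof
    show "S o\<^sub>L S = A"
    proof (rule blinfun_eqI)
      fix x
      have "(S o\<^sub>L S) x = (sqrt l * sqrt l) *\<^sub>R (x - 2 *\<^sub>R Y x + Y (Y x))"
        unfolding S_def by (simp add: blinfun.bilinear_simps algebra_simps scaleR_2)
      also have "\<dots> = l *\<^sub>R ((1 / l) *\<^sub>R A x)"
        using l by (simp add: Y2 C_def blinfun.bilinear_simps)
      also have "\<dots> = A x" using l by simp
      finally show "(S o\<^sub>L S) x = A x" .
    qed
    show "blinfun_apply S x \<bullet> y = x \<bullet> S y" for x y
      unfolding S_def by (simp add: blinfun.bilinear_simps inner_diff_left inner_diff_right sD(2)[OF Y])
    show "x \<bullet> blinfun_apply S x > 0" if "x \<noteq> 0" for x
    proof -
      have "x \<bullet> Y x \<le> norm x * norm (Y x)" by (rule norm_cauchy_schwarz)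
      also have "\<dots> \<le> norm x * (\<rho> * norm x)"
        using norm_blinfun[of Y x] sD(1)[OF Y] by (intro mult_left_mono) (meson mult_right_mono norm_ge_zero order_trans, simp)
      also have "\<dots> < norm x * norm x"
        using mult_strict_right_mono[of \<rho> 1 "norm x"] \<rho> that by (intro mult_strict_left_mono) auto
      finally have "x \<bullet> x - x \<bullet> Y x > 0" by (simp add: power2_norm_eq_inner[symmetric] power2_eq_square)
      then show ?thesis unfolding S_def using l by (simp add: blinfun.bilinear_simps inner_diff_right)
    qed
    show "R o\<^sub>L S = S o\<^sub>L R" if R: "R o\<^sub>L A = A o\<^sub>L R" for R
      using sD(3)[OF Y R] unfolding S_def blinfun_commute_iff
      by (simp add: blinfun.bilinear_simps)
  qed
qed

text \<open>The contraction argument relies on the operator norm and so lives in the space of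
  bounded linear maps; here its outcome is moved to matrices.\<close>

lemma pos_def_sqrt_exists:
  assumes "pos_def (A :: real^'n^'n)"
  obtains S where "pos_def S" "S ** S = A" "\<And>R. R ** A = A ** R \<Longrightarrow> R ** S = S ** R"
proof -
  let ?B = "\<lambda>A :: real^'n^'n. Blinfun ((*v) A)"
  have B: "blinfun_apply (?B A) = (*v) A" for A
    by (rule bounded_linear_Blinfun_apply) (rule matrix_vector_mul_bounded_linear)
  obtain c where c: "c > 0" "\<And>x. c * (norm x)\<^sup>2 \<le> x \<bullet> (A *v x)"
    using pos_def_lower_bound[OF assms] by blast
  have symA: "(A *v x) \<bullet> y = x \<bullet> (A *v y)" for x y
    using inner_transpose[of A x y] assms unfolding pos_def_def by metis
  obtain S where S: "S o\<^sub>L S = ?B A" "\<And>x y. blinfun_apply S x \<bullet> y = x \<bullet> S y"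
    "\<And>x. x \<noteq> 0 \<Longrightarrow> x \<bullet> blinfun_apply S x > 0"
    "\<And>R. R o\<^sub>L ?B A = ?B A o\<^sub>L R \<Longrightarrow> R o\<^sub>L S = S o\<^sub>L R"
    by (rule selfadjoint_sqrt_exists[of "?B A", unfolded B, OF symA c]) (rule that)
  let ?S = "matrix (blinfun_apply S)"
  have Sv: "?S *v x = S x" for x
    by (rule matrix_works) (simp add: linear_matrix_vector_mul_eq bounded_linear.linear[OF blinfun.bounded_linear_right])
  show thesis
  proof
    have "transpose ?S = ?S"
      unfolding matrix_eq
    proof
      fix x
      have "(transpose ?S *v x) \<bullet> y = (?S *v x) \<bullet> y" for y
        by (simp only: inner_transpose Sv S(2))
      then show "transpose ?S *v x = ?S *v x" using vector_eq_rdot by blast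
    qed
    then show "pos_def ?S" unfolding pos_def_def using S(3) by (simp add: Sv)
    show "?S ** ?S = A"
      unfolding matrix_eq
    proof
      fix x
      show "(?S ** ?S) *v x = A *v x"
        using arg_cong[OF S(1), of "\<lambda>Z. Z x"] by (simp add: matrix_vector_mul_assoc[symmetric] Sv B)
    qed
    fix R assume R: "R ** A = A ** R"
    have "?B R o\<^sub>L ?B A = ?B A o\<^sub>L ?B R"
      by (rule blinfun_eqI) (simp add: B matrix_vector_mul_assoc R)
    then have "?B R o\<^sub>L S = S o\<^sub>L ?B R" by (rule S(4))
    then have "R *v S x = S (R *v x)" for x
      by (metis B blinfun_apply_blinfun_compose)
    then show "R ** ?S = ?S ** R"
      by (simp add: matrix_eq matrix_vector_mul_assoc[symmetric] Sv)
  qed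
qed

text \<open>The definite description in \<open>msqrt\<close> needs uniqueness. A root R of A
  commutes with A, hence with the constructed root S, so R + S annihilates R x - S x; as R + S is
  positive definite, that difference is zero.\<close>

lemma msqrt_pos_def:
  assumes "pos_def A"
  shows "pos_def (msqrt A)" "msqrt A ** msqrt A = A" "R ** A = A ** R \<Longrightarrow> R ** msqrt A = msqrt A ** R"
proof -
  obtain S where S: "pos_def S" "S ** S = A" "\<And>R. R ** A = A ** R \<Longrightarrow> R ** S = S ** R"
    using pos_def_sqrt_exists[OF assms] by metis
  have "R = S" if R: "pos_def R" "R ** R = A" for R
  proof -
    have "R ** A = A ** R" by (simp add: R(2)[symmetric] matrix_mul_assoc)
    then have RS: "R *v (S *v x) = S *v (R *v x)" for x
      using S(3) by (simp add: matrix_vector_mul_assoc)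
    have RR: "R *v (R *v x) = S *v (S *v x)" for x
      by (simp add: matrix_vector_mul_assoc R S)
    show "R = S"
      unfolding matrix_eq
    proof
      fix x
      define y where "y = R *v x - S *v x"
      have "R *v y + S *v y = 0"
        unfolding y_def by (simp add: matrix_vector_mult_diff_distrib RS RR)
      then have "y \<bullet> (R *v y) + y \<bullet> (S *v y) = 0"
        by (simp add: inner_add_right[symmetric])
      then have "y = 0"
        using R(1) S(1) unfolding pos_def_def by (metis add_pos_pos less_irrefl)
      then show "R *v x = S *v x" by (simp add: y_def)
    qed
  qed
  then have eq: "msqrt A = S" unfolding msqrt_def using S(1,2) by blast
  show "pos_def (msqrt A)" unfolding eq by (rule S(1))
  show "msqrt A ** msqrt A = A" unfolding eq by (rule S(2))
  show "R ** A = A ** R \<Longrightarrow> R ** msqrt A = msqrt A ** R" unfolding eq by (rule S(3))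
qed

text \<open>W is block diagonal: the identity on the kernel of P and the compression of V on its
  range. Its quadratic form is the squared norm of x - P x plus the form of V at P x, and these
  cannot both vanish unless x does.\<close>

lemma pos_def_compress:
  fixes P V :: "real^'n^'n"
  assumes P: "transpose P = P" "P ** P = P" and V: "pos_def V"
  defines "W \<equiv> mat 1 - P + P ** V ** P"
  shows "pos_def W" "P ** W = W ** P" "P ** V ** P = P ** W"
proof -
  have Pv: "P *v (P *v x) = P *v x" for x by (simp add: matrix_vector_mul_assoc P)
  show "P ** W = W ** P" "P ** V ** P = P ** W"
    unfolding W_def matrix_eq
    by (simp_all add: matrix_vector_mul_assoc[symmetric] matrix_vector_mult_add_rdistrib
        matrix_vector_mult_diff_rdistrib matrix_vector_right_distrib matrix_vector_mult_diff_distrib Pv)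
  have PP: "(P *v x) \<bullet> y = x \<bullet> (P *v y)" for x y
    using inner_transpose[of P x y] by (simp only: P(1))
  have "transpose W = W"
  proof -
    have "transpose (P ** V ** P) = P ** V ** P"
      using V P(1) by (simp add: matrix_transpose_mul pos_def_def matrix_mul_assoc)
    moreover have "transpose (mat 1 - P + P ** V ** P) = mat 1 - transpose P + transpose (P ** V ** P)"
      by (simp add: transpose_def vec_eq_iff mat_def)
    ultimately show ?thesis by (simp add: W_def P)
  qed
  moreover have "x \<bullet> (W *v x) > 0" if "x \<noteq> 0" for x
  proof -
    have "x \<bullet> (P *v x) = (P *v x) \<bullet> (P *v x)"
      by (simp add: PP matrix_vector_mul_assoc P)
    then have "x \<bullet> (W *v x) = (x - P *v x) \<bullet> (x - P *v x) + (P *v x) \<bullet> (V *v (P *v x))"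
      unfolding W_def
      by (simp add: matrix_vector_mult_add_rdistrib matrix_vector_mult_diff_rdistrib inner_add_right
          inner_diff_right inner_diff_left PP matrix_vector_mul_assoc[symmetric] inner_commute)
    moreover have "(P *v x) \<bullet> (V *v (P *v x)) > 0 \<or> P *v x = 0"
      using V unfolding pos_def_def by blast
    ultimately show ?thesis
      using that by (auto simp: add_nonneg_pos)
  qed
  ultimately show "pos_def W" by (simp add: pos_def_def)
qed

text \<open>Let T be the inverse root of W. Since W commutes with P, so do its root and T. Hence B
  times its transpose is T P V P T = T P W T = P T W T = P.\<close>

lemma compress_whitening:
  fixes P V :: "real^'n^'n"
  assumes P: "transpose P = P" "P ** P = P" and V: "pos_def V"
  defines "W \<equiv> mat 1 - P + P ** V ** P"
  defines "B \<equiv> matrix_inv (msqrt W) ** P ** msqrt V"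
  shows "B ** transpose B = P" "matrix_inv W = matrix_inv (msqrt W) ** matrix_inv (msqrt W)"
    "transpose (matrix_inv (msqrt W)) = matrix_inv (msqrt W)"
proof -
  note W = pos_def_compress[OF assms(1-3), folded W_def]
  define S where "S = msqrt W"
  define T where "T = matrix_inv S"
  have S: "transpose S = S" "S ** S = W" "P ** S = S ** P" "invertible S"
    unfolding S_def using msqrt_pos_def[OF W(1)] W(2) pos_def_invertible unfolding pos_def_def by metis+
  have T: "S ** T = mat 1" "T ** S = mat 1" using matrix_inv_mult[OF S(4)] by (auto simp: T_def)
  have tT: "transpose T = T"
  proof -
    have "S ** transpose T = mat 1" using arg_cong[OF T(2), of transpose] S(1) by (simp add: matrix_transpose_mul)
    then show ?thesis unfolding T_def by (metis matrix_inv_eqI)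
  qed
  have "T ** P = T ** (P ** S) ** T"
    by (simp add: matrix_mul_assoc[symmetric] T)
  also have "\<dots> = P ** T"
    by (simp add: S(3) matrix_mul_assoc T)
  finally have TP: "T ** P = P ** T" .
  have Vs: "transpose (msqrt V) = msqrt V" "msqrt V ** msqrt V = V"
    using msqrt_pos_def(1,2)[OF V] unfolding pos_def_def by metis+
  have "B ** transpose B = T ** P ** (msqrt V ** msqrt V) ** P ** T"
    unfolding B_def S_def[symmetric] T_def[symmetric]
    by (simp add: matrix_transpose_mul tT P Vs(1) matrix_mul_assoc)
  also have "\<dots> = T ** (P ** V ** P) ** T" by (simp add: Vs matrix_mul_assoc)
  also have "\<dots> = (T ** P) ** (S ** S) ** T" by (simp add: W(3) S(2) matrix_mul_assoc)
  also have "\<dots> = P ** (T ** S) ** (S ** T)" unfolding TP by (simp add: matrix_mul_assoc)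
  also have "\<dots> = P" by (simp add: T)
  finally show "B ** transpose B = P" .
  show "matrix_inv W = matrix_inv (msqrt W) ** matrix_inv (msqrt W)"
    unfolding S_def[symmetric] T_def[symmetric]
  proof (rule matrix_inv_eqI)
    have "W ** (T ** T) = S ** (S ** T) ** T" by (simp add: S(2)[symmetric] matrix_mul_assoc)
    then show "W ** (T ** T) = mat 1" by (simp add: T)
  qed
  show "transpose (matrix_inv (msqrt W)) = matrix_inv (msqrt W)"
    using tT by (simp add: S_def T_def)
qed

section \<open>Orthogonal extensions and coordinate subspaces\<close>

lemma isometry_extends_orthogonal:
  fixes f :: "'a::euclidean_space \<Rightarrow> 'a"
  assumes T: "subspace T" and f: "linear f" "\<And>x. x \<in> T \<Longrightarrow> norm (f x) = norm x"
  obtains R where "orthogonal_transformation R" "\<And>x. x \<in> T \<Longrightarrow> R x = f x"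
proof -
  have sfT: "subspace (f ` T)" using f(1) T by (rule linear_subspace_image)
  have inj: "inj_on f T"
    using f T by (metis linear_injective_on_subspace_0 norm_eq_zero)
  have "dim (f ` T) = dim T"
    by (rule dim_image_eq[OF f(1)]) (simp add: span_eq_iff[THEN iffD2, OF T] inj)
  moreover have dim: "dim (S\<^sup>\<bottom>) + dim S = DIM('a)" if "subspace S" for S :: "'a set"
    using dim_subspace_orthogonal_to_vectors[OF that subspace_UNIV]
    by (simp add: orthogonal_comp_def)
  ultimately have "dim (T\<^sup>\<bottom>) = dim ((f ` T)\<^sup>\<bottom>)"
    using dim[OF T] dim[OF sfT] by linarith
  then obtain g where g: "linear g" "g ` (T\<^sup>\<bottom>) = (f ` T)\<^sup>\<bottom>" "\<And>x. x \<in> T\<^sup>\<bottom> \<Longrightarrow> norm (g x) = norm x"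
    using isometry_subspaces[OF subspace_orthogonal_comp subspace_orthogonal_comp] by metis
  have dec: "\<exists>y. y \<in> T \<and> x - y \<in> T\<^sup>\<bottom>" for x
  proof -
    obtain y z where "y \<in> span T" "\<And>w. w \<in> span T \<Longrightarrow> orthogonal z w" "x = y + z"
      using orthogonal_subspace_decomp_exists[of T x] by blast
    then show ?thesis
      by (intro exI[of _ y]) (auto simp: span_eq_iff[THEN iffD2, OF T] orthogonal_comp_def orthogonal_commute)
  qed
  have uniq: "y = z" if "y \<in> T" "x - y \<in> T\<^sup>\<bottom>" "z \<in> T" "x - z \<in> T\<^sup>\<bottom>" for x y z
  proof -
    have "y - z \<in> T" "y - z \<in> T\<^sup>\<bottom>"
      using that T subspace_diff subspace_diff[OF subspace_orthogonal_comp that(4,2)] by auto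
    then show ?thesis by (auto simp: orthogonal_comp_def orthogonal_def)
  qed
  define p where "p x = (SOME y. y \<in> T \<and> x - y \<in> T\<^sup>\<bottom>)" for x
  have p: "p x \<in> T" "x - p x \<in> T\<^sup>\<bottom>" for x
    using someI_ex[OF dec[of x]] by (auto simp: p_def)
  have lin_p: "linear p"
  proof (rule linearI)
    fix x y c
    show "p (x + y) = p x + p y"
      using p T subspace_add[OF T p(1) p(1)] subspace_add[OF subspace_orthogonal_comp p(2)[of x] p(2)[of y]]
      by (intro uniq[of _ "x + y"]) (auto simp: algebra_simps)
    show "p (c *\<^sub>R x) = c *\<^sub>R p x"
      using p T subspace_scale[OF T p(1)] subspace_scale[OF subspace_orthogonal_comp p(2)[of x], of c]
      by (intro uniq[of _ "c *\<^sub>R x"]) (auto simp: algebra_simps)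
  qed
  show thesis
  proof
    let ?R = "\<lambda>x. f (p x) + g (x - p x)"
    have "linear ?R"
      by (intro linear_compose_add linear_compose[OF lin_p f(1), unfolded o_def]
          linear_compose[OF linear_compose_sub[OF linear_id[unfolded id_def] lin_p] g(1), unfolded o_def])
    moreover have "norm (?R x) = norm x" for x
    proof -
      have "orthogonal (f (p x)) (g (x - p x))"
      proof -
        have "g (x - p x) \<in> (f ` T)\<^sup>\<bottom>" using p(2) g(2) by blast
        then show ?thesis using p(1) by (auto simp: orthogonal_comp_def)
      qed
      moreover have "orthogonal (p x) (x - p x)"
        using p by (auto simp: orthogonal_comp_def)
      ultimately have "(norm (?R x))\<^sup>2 = (norm (p x + (x - p x)))\<^sup>2"
        using f(2)[OF p(1)] g(3)[OF p(2)] by (simp only: norm_add_Pythagorean)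
      then show ?thesis by simp
    qed
    ultimately show "orthogonal_transformation ?R" by (simp add: orthogonal_transformation)
    fix x assume "x \<in> T"
    then have "p x = x" using p by (intro uniq[of _ x]) (auto simp: subspace_0[OF subspace_orthogonal_comp])
    then show "?R x = f x" by (simp add: linear_0[OF g(1)])
  qed
qed

text \<open>The hypothesis says that the transpose of B maps u to a vector of norm
  \<open>norm (P *v u)\<close>. So it is isometric on the range of P and vanishes on its kernel;
  extending it from the range to an orthogonal R gives R P, and transposing yields the
  factorization.\<close>

lemma partial_isometry_factor:
  fixes B P :: "real^'n^'n"
  assumes P: "transpose P = P" "P ** P = P" and B: "B ** transpose B = P"
  obtains H where "orthogonal_matrix H" "B = P ** H"
proof -
  let ?f = "(*v) (transpose B)"
  have nf: "norm (?f u) = norm (P *v u)" for u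
  proof -
    have "(?f u) \<bullet> (?f u) = u \<bullet> (P *v u)"
      unfolding inner_transpose by (simp only: matrix_vector_mul_assoc B)
    also have "\<dots> = (P *v u) \<bullet> (P *v u)"
      using inner_transpose[of P u "P *v u"] P by (simp add: matrix_vector_mul_assoc)
    finally show ?thesis by (simp add: norm_eq)
  qed
  have lin: "linear ?f" "linear ((*v) P)" by (rule matrix_vector_mul_linear)+
  have T: "subspace (range ((*v) P))" using lin(2) by (rule linear_subspace_image) simp
  have PP: "P *v (P *v x) = P *v x" for x by (simp add: matrix_vector_mul_assoc P)
  obtain R where R: "orthogonal_transformation R" "\<And>x. x \<in> range ((*v) P) \<Longrightarrow> R x = ?f x"
    by (rule isometry_extends_orthogonal[OF T lin(1)]) (auto simp: nf PP simp del: transpose_matrix_vector)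
  define H where "H = transpose (matrix R)"
  have o: "orthogonal_matrix (matrix R)" and Rl: "linear R"
    using R(1) orthogonal_transformation_matrix by blast+
  have Rv: "matrix R *v x = R x" for x
    by (rule matrix_works) (simp add: linear_matrix_vector_mul_eq Rl)
  show thesis
  proof
    show "orthogonal_matrix H" using o by (simp add: H_def orthogonal_matrix_transpose)
    have "transpose B = matrix R ** P"
      unfolding matrix_eq
    proof
      fix x
      have "norm (?f (x - P *v x)) = 0"
        by (simp only: nf) (simp add: matrix_vector_mult_diff_distrib PP)
      then have "?f x = ?f (P *v x)"
        by (simp add: matrix_vector_mult_diff_distrib del: transpose_matrix_vector)
      then show "?f x = (matrix R ** P) *v x"
        by (simp only: matrix_vector_mul_assoc[symmetric] Rv) (simp add: R(2) del: transpose_matrix_vector)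
    qed
    then show "B = P ** H"
      unfolding H_def by (metis P(1) matrix_transpose_mul transpose_transpose)
  qed
qed

text \<open>Counting predecessors is strictly increasing and so numbers the index type by 0 up to
  its cardinality minus 1; \<open>first_coords m\<close> consists of the indices with number below
  \<open>m\<close>.\<close>

lemma card_first_coords:
  assumes "m \<le> CARD('s::{finite,linorder})"
  shows "card (first_coords m :: 's set) = m"
proof -
  let ?r = "\<lambda>i::'s. card {j. j < i}"
  have less: "?r i < ?r j" if "i < j" for i j
    using that by (intro psubset_card_mono psubsetI) auto
  have inj: "inj ?r"
  proof (rule injI, rule ccontr)
    fix i j :: 's assume "?r i = ?r j" "i \<noteq> j"
    then show False using less[of i j] less[of j i] by (metis linorder_neqE less_irrefl)
  qed
  have "?r i < CARD('s)" for i
  proof (rule psubset_card_mono)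
    have "i \<notin> {j. j < i}" by simp
    then show "{j. j < i} \<subset> UNIV" by blast
  qed simp
  then have sub: "range ?r \<subseteq> {..<CARD('s)}" by blast
  have "card (range ?r) = CARD('s)" using inj by (rule card_image)
  then have rng: "range ?r = {..<CARD('s)}" using sub by (intro card_subset_eq) auto
  have "?r ` first_coords m = {k \<in> range ?r. k < m}"
    unfolding first_coords_def by blast
  also have "\<dots> = {..<m}" unfolding rng using assms by auto
  finally have "?r ` first_coords m = {..<m}" .
  moreover have "inj_on ?r (first_coords m)" using inj inj_on_subset by blast
  ultimately show ?thesis by (metis card_image card_lessThan)
qed

text \<open>An orthogonal map that takes the range of P onto a coordinate subspace turns P into the
  coordinate projection. This is how the norm of a projected spherical vector becomes a sum of
  coordinate squares in which the projection no longer appears.\<close>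

lemma projection_norm_coords:
  fixes P :: "real^'n^'n"
  assumes P: "transpose P = P" "P ** P = P" and I: "dim (range ((*v) P)) = card I"
  obtains H where "orthogonal_matrix H" "\<And>z. (norm (P *v z))\<^sup>2 = (\<Sum>i\<in>I. ((H *v z) $ i)\<^sup>2)"
proof -
  let ?T = "range ((*v) P)" and ?E = "{x::real^'n. \<forall>i. i \<notin> I \<longrightarrow> x $ i = 0}"
  have T: "subspace ?T" using matrix_vector_mul_linear by (rule linear_subspace_image) simp
  have E: "subspace ?E" by (auto simp: subspace_def)
  have "dim ?T = dim ?E" using I dim_substandard_cart[where 'a = real, of I] by (simp add: dim_vec_eq)
  then obtain f where f: "linear f" "f ` ?T = ?E" "\<And>x. x \<in> ?T \<Longrightarrow> norm (f x) = norm x"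
    by (rule isometry_subspaces[OF T E]) blast
  obtain R where R: "orthogonal_transformation R" "\<And>x. x \<in> ?T \<Longrightarrow> R x = f x"
    using isometry_extends_orthogonal[OF T f(1,3)] by metis
  have Rl: "linear R" using R(1) by (simp add: orthogonal_transformation_def)
  have Rv: "matrix R *v x = R x" for x
    by (rule matrix_works) (simp add: linear_matrix_vector_mul_eq Rl)
  show thesis
  proof
    show "orthogonal_matrix (matrix R)" using R(1) orthogonal_transformation_matrix by blast
    fix z
    have PE: "R (P *v x) \<in> ?E" for x using R(2) f(2) by blast
    \<comment> \<open>The residual of \<open>z\<close> is orthogonal to the range of P, hence its
      image under \<open>R\<close> is orthogonal to the coordinate subspace.\<close>
    have comp: "R (P *v z) $ i = R z $ i" if "i \<in> I" for i
    proof -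
      have "axis i 1 \<in> ?E" using that by (auto simp: axis_def)
      then obtain u where "axis i 1 = f (P *v u)" using f(2) by (metis (no_types, lifting) imageE)
      then have u: "axis i 1 = R (P *v u)" using R(2) by auto
      have "R (z - P *v z) \<bullet> axis i 1 = (z - P *v z) \<bullet> (P *v u)"
        unfolding u using R(1) by (simp add: orthogonal_transformation_def)
      also have "\<dots> = (P *v (z - P *v z)) \<bullet> u"
        using inner_transpose[of P "z - P *v z" u] P(1) by simp
      also have "\<dots> = 0" by (simp add: matrix_vector_mult_diff_distrib matrix_vector_mul_assoc P)
      finally show ?thesis by (simp add: linear_diff[OF Rl] inner_axis)
    qed
    have "(norm (P *v z))\<^sup>2 = (norm (R (P *v z)))\<^sup>2"
      using R(1) by (simp add: orthogonal_transformation)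
    also have "\<dots> = (\<Sum>i\<in>UNIV. (R (P *v z) $ i)\<^sup>2)"
      unfolding power2_norm_eq_inner by (simp add: inner_vec_def power2_eq_square)
    also have "\<dots> = (\<Sum>i\<in>I. (R (P *v z) $ i)\<^sup>2)"
      using PE[of z] by (intro sum.mono_neutral_right) auto
    finally show "(norm (P *v z))\<^sup>2 = (\<Sum>i\<in>I. ((matrix R *v z) $ i)\<^sup>2)"
      by (simp add: comp Rv)
  qed
qed

section \<open>Convergence in distribution\<close>

lemma bounded_continuous_integrable:
  fixes f :: "'b::euclidean_space \<Rightarrow> real"
  assumes "prob_space P" "X \<in> borel_measurable P" "continuous_on UNIV f" "\<And>x. \<bar>f x\<bar> \<le> B"
  shows "integrable P (\<lambda>\<omega>. f (X \<omega>))"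
proof -
  interpret prob_space P by fact
  have "f \<in> borel_measurable borel" using assms(3) by (rule borel_measurable_continuous_onI)
  then have "(\<lambda>\<omega>. f (X \<omega>)) \<in> borel_measurable P"
    using assms(2) by measurable
  then show ?thesis by (rule integrable_const_bound[rotated]) (use assms(4) in auto)
qed

text \<open>The ramp \<open>h R\<close> is 0 up to norm \<open>R\<close> and 1 from norm
  \<open>R + 1\<close> on, so it is an admissible test function above the indicator of a tail event.
  Its integral against the single limit variable is small for large \<open>R\<close> by dominated
  convergence, and convergence in distribution carries this over to all late indices.\<close>

lemma conv_distr_tight:
  fixes X :: "nat \<Rightarrow> 'w \<Rightarrow> 'b::euclidean_space"
  assumes P: "prob_space P" and X: "\<And>n. X n \<in> borel_measurable P"
    and Q: "prob_space Q" and Y: "Y \<in> borel_measurable Q"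
    and conv: "conv_distr P X Q Y" and e: "e > 0"
  obtains R where "R > 0" "\<forall>\<^sub>F n in sequentially. measure P {\<omega>\<in>space P. norm (X n \<omega>) > R} < e"
proof -
  interpret P: prob_space P by fact
  interpret Q: prob_space Q by fact
  define h where "h = (\<lambda>(R::real) (x::'b). min 1 (max 0 (norm x - R)))"
  have h: "0 \<le> h R x" "h R x \<le> 1" "\<bar>h R x\<bar> \<le> 1" for R x by (auto simp: h_def)
  have h_cont: "continuous_on UNIV (h R)" for R
    unfolding h_def by (intro continuous_intros)
  have "(\<lambda>k. \<integral>\<omega>. h (real k) (Y \<omega>) \<partial>Q) \<longlonglongrightarrow> (\<integral>\<omega>. 0 \<partial>Q)"
  proof (rule integral_dominated_convergence[where w = "\<lambda>_. 1"])
    show "AE \<omega> in Q. (\<lambda>k. h (real k) (Y \<omega>)) \<longlonglongrightarrow> 0"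
    proof (rule AE_I2)
      fix \<omega>
      obtain K where K: "norm (Y \<omega>) \<le> real K" using real_arch_simple by blast
      have "\<forall>\<^sub>F k in sequentially. h (real k) (Y \<omega>) = 0"
        using eventually_ge_at_top[of K]
      proof eventually_elim
        case (elim k)
        then have "norm (Y \<omega>) \<le> real k" using K by linarith
        then show ?case by (simp add: h_def)
      qed
      then show "(\<lambda>k. h (real k) (Y \<omega>)) \<longlonglongrightarrow> 0" by (rule tendsto_eventually)
    qed
    show "(\<lambda>\<omega>. h (real k) (Y \<omega>)) \<in> borel_measurable Q" for k
      using bounded_continuous_integrable[OF Q Y h_cont h(3)] by (rule borel_measurable_integrable)
  qed (use h in auto)
  then have "\<forall>\<^sub>F k in sequentially. (\<integral>\<omega>. h (real k) (Y \<omega>) \<partial>Q) < e"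
    using e by (intro order_tendstoD(2)) auto
  then obtain k where k: "(\<integral>\<omega>. h (real k) (Y \<omega>) \<partial>Q) < e"
    by (auto simp: eventually_sequentially)
  have "bounded (range (h (real k)))"
    using h(3) by (intro boundedI[of _ 1]) auto
  then have "(\<lambda>n. \<integral>\<omega>. h (real k) (X n \<omega>) \<partial>P) \<longlonglongrightarrow> (\<integral>\<omega>. h (real k) (Y \<omega>) \<partial>Q)"
    using conv h_cont unfolding conv_distr_def by blast
  then have ev: "\<forall>\<^sub>F n in sequentially. (\<integral>\<omega>. h (real k) (X n \<omega>) \<partial>P) < e"
    using k by (rule order_tendstoD(2))
  show thesis
  proof
    show "real k + 1 > 0" by simp
    show "\<forall>\<^sub>F n in sequentially. measure P {\<omega>\<in>space P. norm (X n \<omega>) > real k + 1} < e"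
      using ev
    proof eventually_elim
      case (elim n)
      let ?A = "{\<omega>\<in>space P. norm (X n \<omega>) > real k + 1}"
      have A: "?A \<in> sets P" using X by measurable
      have "measure P ?A = (\<integral>\<omega>. indicator ?A \<omega> \<partial>P)"
        using A by simp
      also have "\<dots> \<le> (\<integral>\<omega>. h (real k) (X n \<omega>) \<partial>P)"
      proof (rule integral_mono)
        show "integrable P (indicator ?A :: _ \<Rightarrow> real)" using A by (simp add: P.emeasure_eq_measure)
        show "integrable P (\<lambda>\<omega>. h (real k) (X n \<omega>))"
          by (rule bounded_continuous_integrable[OF P X h_cont h(3)])
        show "indicator ?A \<omega> \<le> h (real k) (X n \<omega>)" for \<omega>
          by (auto simp: indicator_def h_def)
      qed
      finally show ?case using elim by linarith
    qed
  qed
qed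

text \<open>Tightness supplies exceptional sets that are unrelated in form to the events in
  \<open>conv_prob_zero\<close>. The criterion accepts them, chosen separately for each pair of
  \<open>e\<close> and \<open>\<eta>\<close>.\<close>

lemma conv_prob_zeroI:
  assumes P: "prob_space P" and D: "\<And>n. D n \<in> borel_measurable P"
    and small: "\<And>e \<eta>. e > 0 \<Longrightarrow> \<eta> > 0 \<Longrightarrow> \<exists>A. \<forall>\<^sub>F n in sequentially. A n \<in> sets P \<and> measure P (A n) < \<eta>
        \<and> (\<forall>\<omega>\<in>space P. norm (D n \<omega>) > e \<longrightarrow> \<omega> \<in> A n)"
  shows "conv_prob_zero P D"
  unfolding conv_prob_zero_def
proof (intro allI impI)
  interpret prob_space P by fact
  fix e :: real assume e: "e > 0"
  show "(\<lambda>n. measure P {\<omega>\<in>space P. norm (D n \<omega>) > e}) \<longlonglongrightarrow> 0"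
  proof (rule tendstoI)
    fix \<eta> :: real assume "\<eta> > 0"
    with small[OF e] obtain A where "\<forall>\<^sub>F n in sequentially. A n \<in> sets P \<and> measure P (A n) < \<eta>
        \<and> (\<forall>\<omega>\<in>space P. norm (D n \<omega>) > e \<longrightarrow> \<omega> \<in> A n)"
      by blast
    then show "\<forall>\<^sub>F n in sequentially. dist (measure P {\<omega>\<in>space P. norm (D n \<omega>) > e}) 0 < \<eta>"
    proof eventually_elim
      case (elim n)
      then have "measure P {\<omega>\<in>space P. norm (D n \<omega>) > e} \<le> measure P (A n)"
        by (intro finite_measure_mono) auto
      then show ?case using elim by simp
    qed
  qed
qed

text \<open>Outside two events of small probability both variables lie in one compact ball and close
  together, and there a continuous test function is uniformly continuous. Boundedness of the test
  function handles the two events.\<close>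

lemma conv_distr_slutsky:
  fixes X Y :: "nat \<Rightarrow> 'w \<Rightarrow> 'b::euclidean_space"
  assumes P: "prob_space P" and X: "\<And>n. X n \<in> borel_measurable P" and Y: "\<And>n. Y n \<in> borel_measurable P"
    and Q: "prob_space Q" and Z: "Z \<in> borel_measurable Q"
    and conv: "conv_distr P X Q Z" and diff: "conv_prob_zero P (\<lambda>n \<omega>. Y n \<omega> - X n \<omega>)"
  shows "conv_distr P Y Q Z"
  unfolding conv_distr_def
proof (intro allI impI)
  fix f :: "'b \<Rightarrow> real" assume f: "continuous_on UNIV f \<and> bounded (range f)"
  interpret P: prob_space P by fact
  obtain B where B: "B > 0" "\<And>x. \<bar>f x\<bar> \<le> B"
    using f by (auto simp: bounded_pos)
  have intX: "integrable P (\<lambda>\<omega>. f (X n \<omega>))" and intY: "integrable P (\<lambda>\<omega>. f (Y n \<omega>))" for n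
    using bounded_continuous_integrable[OF P _ conjunct1[OF f] B(2)] X Y by auto
  have "(\<lambda>n. (\<integral>\<omega>. f (Y n \<omega>) \<partial>P) - (\<integral>\<omega>. f (X n \<omega>) \<partial>P)) \<longlonglongrightarrow> 0"
  proof (rule tendstoI)
    fix e :: real assume e: "e > 0"
    \<comment> \<open>Each of the two bad events costs at most \<open>2 * B * \<eta>\<close>, which
      is \<open>e / 4\<close>, and uniform continuity costs another \<open>e / 4\<close>.\<close>
    define \<eta> where "\<eta> = e / (8 * B)"
    have \<eta>: "\<eta> > 0" using e B by (simp add: \<eta>_def)
    obtain R where R: "R > 0" "\<forall>\<^sub>F n in sequentially. measure P {\<omega>\<in>space P. norm (X n \<omega>) > R} < \<eta>"
      by (rule conv_distr_tight[OF P X Q Z conv \<eta>])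
    have "uniformly_continuous_on (cball 0 (R + 1)) f"
      using f by (intro compact_uniformly_continuous) (auto intro: continuous_on_subset)
    then obtain d where d: "d > 0" "\<And>x y. x \<in> cball 0 (R + 1) \<Longrightarrow> y \<in> cball 0 (R + 1) \<Longrightarrow> dist y x < d \<Longrightarrow> dist (f y) (f x) < e / 4"
      by (rule uniformly_continuous_onE[of _ _ "e / 4"]) (use e in auto)
    \<comment> \<open>The cap 1 keeps \<open>Y n\<close> in the ball of radius \<open>R + 1\<close>
      whenever \<open>X n\<close> has norm at most \<open>R\<close>.\<close>
    define r where "r = min (d / 2) 1"
    have r: "r > 0" "r < d" "r \<le> 1" using d(1) by (auto simp: r_def)
    have "(\<lambda>n. measure P {\<omega>\<in>space P. norm (Y n \<omega> - X n \<omega>) > r}) \<longlonglongrightarrow> 0"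
      using diff r(1) unfolding conv_prob_zero_def by blast
    then have ev: "\<forall>\<^sub>F n in sequentially. measure P {\<omega>\<in>space P. norm (Y n \<omega> - X n \<omega>) > r} < \<eta>"
      using \<eta> by (rule order_tendstoD(2))
    show "\<forall>\<^sub>F n in sequentially. dist ((\<integral>\<omega>. f (Y n \<omega>) \<partial>P) - (\<integral>\<omega>. f (X n \<omega>) \<partial>P)) 0 < e"
      using ev R(2)
    proof eventually_elim
      case (elim n)
      let ?A = "{\<omega>\<in>space P. norm (X n \<omega>) > R}" and ?C = "{\<omega>\<in>space P. norm (Y n \<omega> - X n \<omega>) > r}"
      have sets: "?A \<in> sets P" "?C \<in> sets P" using X Y by measurable
      have le: "\<bar>f (Y n \<omega>) - f (X n \<omega>)\<bar> \<le> e / 4 + 2 * B * indicator ?A \<omega> + 2 * B * indicator ?C \<omega>"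
        if "\<omega> \<in> space P" for \<omega>
      proof (cases "\<omega> \<in> ?A \<or> \<omega> \<in> ?C")
        case True
        have "\<bar>f (Y n \<omega>) - f (X n \<omega>)\<bar> \<le> 2 * B" using B(2)[of "Y n \<omega>"] B(2)[of "X n \<omega>"] by linarith
        also have "\<dots> \<le> 2 * B * indicator ?A \<omega> + 2 * B * indicator ?C \<omega>"
          using True B(1) by (auto simp: indicator_def)
        finally show ?thesis using e by linarith
      next
        case False
        then have 1: "norm (X n \<omega>) \<le> R" "norm (Y n \<omega> - X n \<omega>) \<le> r" using that by auto
        then have "norm (Y n \<omega>) \<le> R + 1"
          using norm_triangle_ineq[of "X n \<omega>" "Y n \<omega> - X n \<omega>"] r by simp
        then have "dist (f (Y n \<omega>)) (f (X n \<omega>)) < e / 4"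
          using 1 r by (intro d(2)) (auto simp: dist_norm)
        then have "\<bar>f (Y n \<omega>) - f (X n \<omega>)\<bar> \<le> e / 4" by (simp add: dist_real_def)
        then show ?thesis using False by simp
      qed
      have ind: "integrable P (indicator ?A :: _ \<Rightarrow> real)" "integrable P (indicator ?C :: _ \<Rightarrow> real)"
        using sets by (simp_all add: P.emeasure_eq_measure)
      have "\<bar>(\<integral>\<omega>. f (Y n \<omega>) \<partial>P) - (\<integral>\<omega>. f (X n \<omega>) \<partial>P)\<bar> = \<bar>\<integral>\<omega>. f (Y n \<omega>) - f (X n \<omega>) \<partial>P\<bar>"
        using intX intY by simp
      also have "\<dots> \<le> (\<integral>\<omega>. \<bar>f (Y n \<omega>) - f (X n \<omega>)\<bar> \<partial>P)"
        by (rule integral_abs_bound)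
      also have "\<dots> \<le> (\<integral>\<omega>. e / 4 + 2 * B * indicator ?A \<omega> + 2 * B * indicator ?C \<omega> \<partial>P)"
        using intX intY ind le by (intro integral_mono) auto
      also have "\<dots> = e / 4 + 2 * B * measure P ?A + 2 * B * measure P ?C"
        using ind sets by (simp add: P.prob_space)
      also have "\<dots> \<le> e / 4 + 2 * B * \<eta> + 2 * B * \<eta>"
        using elim B(1) by (intro add_mono mult_left_mono) auto
      also have "\<dots> < e" using e B(1) by (simp add: \<eta>_def)
      finally show ?case by simp
    qed
  qed
  from tendsto_add[OF this] conv f
  show "(\<lambda>n. \<integral>\<omega>. f (Y n \<omega>) \<partial>P) \<longlonglongrightarrow> (\<integral>\<omega>. f (Z \<omega>) \<partial>Q)"
    unfolding conv_distr_def by fastforce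
qed

lemma conv_distr_continuous_map:
  fixes g :: "'a::metric_space \<Rightarrow> 'c::metric_space"
  assumes "conv_distr P X Q Z" "continuous_on UNIV g"
  shows "conv_distr P (\<lambda>n \<omega>. g (X n \<omega>)) Q (\<lambda>\<omega>. g (Z \<omega>))"
  unfolding conv_distr_def
proof (intro allI impI)
  fix f :: "'c \<Rightarrow> real" assume f: "continuous_on UNIV f \<and> bounded (range f)"
  have "continuous_on UNIV (f \<circ> g)"
    using f assms(2) by (intro continuous_on_compose) (auto intro: continuous_on_subset)
  moreover have "bounded (range (f \<circ> g))"
    using f by (metis bounded_subset image_comp image_mono subset_UNIV)
  ultimately show "(\<lambda>n. \<integral>\<omega>. f (g (X n \<omega>)) \<partial>P) \<longlonglongrightarrow> (\<integral>\<omega>. f (g (Z \<omega>)) \<partial>Q)"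
    using assms(1)[unfolded conv_distr_def, rule_format, of "f \<circ> g"] by simp
qed

lemma spherical_integral:
  fixes f :: "real^'s \<Rightarrow> real"
  assumes "spherical Q Z" "Z \<in> borel_measurable Q" "orthogonal_matrix H" "f \<in> borel_measurable borel"
  shows "(\<integral>\<omega>. f (H *v Z \<omega>) \<partial>Q) = (\<integral>\<omega>. f (Z \<omega>) \<partial>Q)"
proof -
  have H: "(*v) H \<in> borel_measurable borel"
    by (intro borel_measurable_continuous_onI linear_continuous_on matrix_vector_mul_bounded_linear)
  then have HZ: "(\<lambda>\<omega>. H *v Z \<omega>) \<in> borel_measurable Q"
    using assms(2) by measurable
  have "(\<integral>\<omega>. f (H *v Z \<omega>) \<partial>Q) = integral\<^sup>L (distr Q borel (\<lambda>\<omega>. H *v Z \<omega>)) f"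
    using integral_distr[OF HZ assms(4)] by simp
  also have "\<dots> = integral\<^sup>L (distr Q borel Z) f"
    using assms(1,3) unfolding spherical_def by simp
  also have "\<dots> = (\<integral>\<omega>. f (Z \<omega>) \<partial>Q)"
    using integral_distr[OF assms(2,4)] by simp
  finally show ?thesis .
qed

lemma conv_distr_spherical_rotate:
  fixes Z :: "'v \<Rightarrow> real^'s" and g :: "real^'s \<Rightarrow> 'b::metric_space"
  assumes "spherical Q Z" "Z \<in> borel_measurable Q" "orthogonal_matrix H" "continuous_on UNIV g"
    and "conv_distr P X Q (\<lambda>\<omega>. g (H *v Z \<omega>))"
  shows "conv_distr P X Q (\<lambda>\<omega>. g (Z \<omega>))"
  unfolding conv_distr_def
proof (intro allI impI)
  fix f :: "'b \<Rightarrow> real" assume f: "continuous_on UNIV f \<and> bounded (range f)"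
  have "continuous_on UNIV (\<lambda>x. f (g x))"
    using f assms(4) by (intro continuous_on_compose2[of UNIV f UNIV g]) auto
  then have "(\<integral>\<omega>. f (g (H *v Z \<omega>)) \<partial>Q) = (\<integral>\<omega>. f (g (Z \<omega>)) \<partial>Q)"
    using spherical_integral[OF assms(1-3), of "\<lambda>x. f (g x)"] borel_measurable_continuous_onI by blast
  then show "(\<lambda>n. \<integral>\<omega>. f (X n \<omega>) \<partial>P) \<longlonglongrightarrow> (\<integral>\<omega>. f (g (Z \<omega>)) \<partial>Q)"
    using assms(5) f unfolding conv_distr_def by metis
qed

section \<open>Local structure of a submanifold\<close>

lemma orth_proj_unique:
  assumes "subspace S" "y \<in> S" "\<And>z. z \<in> S \<Longrightarrow> (x - y) \<bullet> z = 0"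
  shows "orth_proj S x = y"
  unfolding orth_proj_def
proof (rule the_equality)
  show "y \<in> S \<and> (\<forall>z\<in>S. (x - y) \<bullet> z = 0)" using assms by blast
  fix u assume u: "u \<in> S \<and> (\<forall>z\<in>S. (x - u) \<bullet> z = 0)"
  have "y - u \<in> S" using u assms subspace_diff by blast
  then have "(x - u) \<bullet> (y - u) = 0" "(x - y) \<bullet> (y - u) = 0" using u assms(3) by blast+
  then have "(y - u) \<bullet> (y - u) = 0" by (simp add: inner_diff_left)
  then show "u = y" by simp
qed

lemma orth_proj:
  assumes "subspace S"
  shows "orth_proj S x \<in> S" "z \<in> S \<Longrightarrow> (x - orth_proj S x) \<bullet> z = 0"
proof -
  obtain y z where *: "y \<in> span S" "\<And>w. w \<in> span S \<Longrightarrow> orthogonal z w" "x = y + z"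
    using orthogonal_subspace_decomp_exists[of S x] by blast
  have "orth_proj S x = y"
    using * assms by (intro orth_proj_unique) (auto simp: span_eq_iff[THEN iffD2, OF assms] orthogonal_def)
  then show "orth_proj S x \<in> S" "z \<in> S \<Longrightarrow> (x - orth_proj S x) \<bullet> z = 0" for z
    using * by (auto simp: span_eq_iff[THEN iffD2, OF assms] orthogonal_def)
qed

lemma linear_orth_proj:
  assumes "subspace S"
  shows "linear (orth_proj S)"
proof (rule linearI)
  fix x y c
  show "orth_proj S (x + y) = orth_proj S x + orth_proj S y"
  proof (rule orth_proj_unique[OF assms])
    show "orth_proj S x + orth_proj S y \<in> S" by (intro subspace_add assms orth_proj)
    fix z assume "z \<in> S"
    then show "(x + y - (orth_proj S x + orth_proj S y)) \<bullet> z = 0"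
      using orth_proj(2)[OF assms, of z x] orth_proj(2)[OF assms, of z y]
      by (simp add: inner_diff_left inner_add_left)
  qed
  show "orth_proj S (c *\<^sub>R x) = c *\<^sub>R orth_proj S x"
  proof (rule orth_proj_unique[OF assms])
    show "c *\<^sub>R orth_proj S x \<in> S" by (intro subspace_scale assms orth_proj)
    fix z assume "z \<in> S"
    then show "(c *\<^sub>R x - c *\<^sub>R orth_proj S x) \<bullet> z = 0"
      using orth_proj(2)[OF assms, of z x] by (simp add: inner_diff_left)
  qed
qed

lemma orth_proj_id: "subspace S \<Longrightarrow> x \<in> S \<Longrightarrow> orth_proj S x = x"
  by (rule orth_proj_unique) auto

lemma orth_proj_inner:
  assumes "subspace S"
  shows "orth_proj S x \<bullet> y = x \<bullet> orth_proj S y"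
proof -
  have "(x - orth_proj S x) \<bullet> orth_proj S y = 0" "(y - orth_proj S y) \<bullet> orth_proj S x = 0"
    by (intro orth_proj assms)+
  then have "x \<bullet> orth_proj S y = orth_proj S x \<bullet> orth_proj S y" "y \<bullet> orth_proj S x = orth_proj S y \<bullet> orth_proj S x"
    by (simp_all add: inner_diff_left)
  then show ?thesis by (metis inner_commute)
qed

text \<open>Duality, tested at the projection itself. The first-order conditions for nearest points
  give information only through inner products with tangent vectors, and this converts it into a
  norm bound.\<close>

lemma norm_orth_proj_le:
  assumes "subspace S" "K \<ge> 0" "\<And>w. w \<in> S \<Longrightarrow> \<bar>x \<bullet> w\<bar> \<le> K * norm w"
  shows "norm (orth_proj S x) \<le> K"
proof (cases "orth_proj S x = 0")
  case False
  let ?w = "orth_proj S x"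
  have "?w \<bullet> ?w = x \<bullet> ?w"
    using orth_proj(2)[OF assms(1) orth_proj(1)[OF assms(1), of x], of x] by (simp add: inner_diff_left)
  then have "norm ?w * norm ?w \<le> K * norm ?w"
    using assms(3)[OF orth_proj(1)[OF assms(1), of x]]
    by (metis abs_le_D1 norm_eq_sqrt_inner power2_eq_square power2_norm_eq_inner)
  then show ?thesis using False by simp
qed (use assms in simp)

lemma norm_orth_proj_le_norm: "subspace S \<Longrightarrow> norm (orth_proj S x) \<le> norm x"
  by (rule norm_orth_proj_le) (auto simp: Cauchy_Schwarz_ineq2)

lemma dim_range_plus_kernel:
  fixes f :: "'a::euclidean_space \<Rightarrow> 'b::euclidean_space"
  assumes "linear f"
  shows "dim (range f) + dim {v. f v = 0} = DIM('a)"
proof -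
  let ?K = "{v. f v = 0}"
  let ?C = "{y \<in> UNIV. \<forall>x \<in> ?K. orthogonal x y}"
  have K: "subspace ?K" using assms by (rule linear_subspace_kernel)
  have C: "subspace ?C" by (auto simp: subspace_def orthogonal_clauses)
  have "f ` ?C = range f"
  proof safe
    fix x
    have "f x = f (x - orth_proj ?K x)"
      using orth_proj(1)[OF K, of x] by (simp add: linear_diff[OF assms])
    moreover have "x - orth_proj ?K x \<in> ?C"
      using orth_proj(2)[OF K] by (auto simp: orthogonal_def inner_commute)
    ultimately show "f x \<in> f ` ?C" by blast
  qed auto
  moreover have "inj_on f ?C"
    unfolding linear_injective_on_subspace_0[OF assms C] by (auto simp: orthogonal_def)
  then have "dim (f ` ?C) = dim ?C"
    by (intro dim_image_eq[OF assms]) (simp only: span_eq_iff[THEN iffD2, OF C])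
  ultimately show ?thesis
    using dim_subspace_orthogonal_to_vectors[OF K subspace_UNIV] by simp
qed

section \<open>Charts, curves and tangent frames from a constant-rank equation\<close>

text \<open>The point \<open>p\<close> is separated from \<open>U\<close> and \<open>F\<close>, so
  that the same equation can serve at all points of M inside \<open>U\<close>; see
  \<open>at_point\<close>.\<close>

locale local_equation =
  fixes M :: "(real^'n) set" and m :: nat and p :: "real^'n" and U and F :: "real^'n \<Rightarrow> real^'n"
  assumes pM: "p \<in> M" and pU: "p \<in> U" and smooth: "smooth_on U F"
    and zero: "M \<inter> U = {x \<in> U. F x = 0}"
    and rank: "\<And>x. x \<in> U \<Longrightarrow> dim (range (frechet_derivative F (at x))) = CARD('n) - m"
    and m: "m \<le> CARD('n)"
begin

abbreviation D where "D x \<equiv> frechet_derivative F (at x)"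

definition T where "T = {v. D p v = 0}"

text \<open>The adjoint maps values of the equation into the orthogonal complement of
  \<open>T\<close>. Hence \<open>J\<close> after \<open>F\<close> and the projection onto
  \<open>T\<close> have complementary ranges, and their sum is a map between spaces of equal
  dimension.\<close>

definition J where "J = adjoint (D p)"

text \<open>The derivative at \<open>y\<close> of the chart \<open>x \<mapsto> J (F x) + orth_proj T (x - p)\<close>, which straightens \<open>M\<close> to
  the linear space \<open>T\<close> near \<open>p\<close>.\<close>

definition B where "B y v = J (D y v) + orth_proj T v"

lemma D: "x \<in> U \<Longrightarrow> (F has_derivative D x) (at x)"
  by (rule smooth_on_has_derivative[OF smooth])

lemma linear_D: "x \<in> U \<Longrightarrow> linear (D x)"
  using D has_derivative_linear by blast

lemma subspace_T: "subspace T"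
  unfolding T_def by (rule linear_subspace_kernel[OF linear_D[OF pU]])

lemma linear_J: "linear J"
  unfolding J_def by (rule adjoint_linear[OF linear_D[OF pU]])

lemma J_inner: "J u \<bullet> v = u \<bullet> D p v"
  unfolding J_def by (rule adjoint_clauses(2)[OF linear_D[OF pU]])

lemma J_normal: "w \<in> T \<Longrightarrow> J u \<bullet> w = 0"
  by (simp add: J_inner T_def)

lemma J_in_T: "J u \<in> T \<Longrightarrow> J u = 0"
  using J_normal[of "J u" u] by simp

lemma linear_B: "y \<in> U \<Longrightarrow> linear (B y)"
  unfolding B_def
  by (intro linear_compose_add linear_orth_proj subspace_T linear_compose[OF linear_D linear_J, unfolded o_def])

lemma B_on_T: "w \<in> T \<Longrightarrow> B p w = w"
  unfolding B_def by (simp add: orth_proj_id[OF subspace_T] linear_0[OF linear_J]) (simp add: T_def linear_0[OF linear_J])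

lemma dim_kernel:
  assumes "x \<in> U"
  shows "dim {v. D x v = 0} = m"
  using dim_range_plus_kernel[OF linear_D[OF assms]] rank[OF assms] m by simp

text \<open>The two summands of \<open>B p v\<close> are orthogonal, so both vanish. The first then
  gives \<open>D p v \<bullet> D p v = 0\<close>, hence \<open>v \<in> T\<close>, where
  \<open>B p\<close> is the identity.\<close>

lemma B_injective_at_p:
  assumes "B p v = 0"
  shows "v = 0"
proof -
  have "J (D p v) = - orth_proj T v" using assms by (simp add: B_def add_eq_0_iff)
  then have "J (D p v) \<in> T" using orth_proj(1)[OF subspace_T] subspace_neg[OF subspace_T] by metis
  then have "J (D p v) = 0" by (rule J_in_T)
  then have "D p v \<bullet> D p v = 0" using J_inner[of "D p v" v] by simp
  then have "v \<in> T" by (simp add: T_def)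
  then show ?thesis using B_on_T assms by simp
qed

lemma B_estimates:
  obtains r c C where "r > 0" "c > 0" "C \<ge> 0" "ball p r \<subseteq> U"
    "\<And>y v. y \<in> ball p r \<Longrightarrow> c * norm v \<le> norm (B y v)"
    "\<And>x y v. x \<in> ball p r \<Longrightarrow> y \<in> ball p r \<Longrightarrow> norm (B x v - B y v) \<le> C * norm (x - y) * norm v"
proof -
  obtain r C where r: "r > 0" "C \<ge> 0" "ball p r \<subseteq> U"
    "\<And>x y v. x \<in> ball p r \<Longrightarrow> y \<in> ball p r \<Longrightarrow> norm (D x v - D y v) \<le> C * norm (x - y) * norm v"
    by (rule smooth_on_derivative_lipschitz[OF smooth pU]) (rule that)
  have blJ: "bounded_linear J" using linear_J by (rule linear_conv_bounded_linear[THEN iffD1])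
  have "bounded_linear (B p)" using linear_B[OF pU] by (rule linear_conv_bounded_linear[THEN iffD1])
  then obtain c where c: "c > 0" "\<And>v. c * norm v \<le> norm (B p v)"
    using injective_imp_isometric[of UNIV "B p"] B_injective_at_p by auto
  define K where "K = onorm J * C"
  have K: "K \<ge> 0" unfolding K_def using onorm_pos_le[OF blJ] r(2) by simp
  have lip: "norm (B x v - B y v) \<le> K * norm (x - y) * norm v" if "x \<in> ball p r" "y \<in> ball p r" for x y v
  proof -
    have "norm (B x v - B y v) = norm (J (D x v - D y v))"
      by (simp add: B_def linear_diff[OF linear_J])
    also have "\<dots> \<le> onorm J * norm (D x v - D y v)" by (rule onorm[OF blJ])
    also have "\<dots> \<le> onorm J * (C * norm (x - y) * norm v)"
      using r(4)[OF that] onorm_pos_le[OF blJ] by (rule mult_left_mono)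
    finally show ?thesis by (simp add: K_def mult.assoc)
  qed
  have half: "k * (c / (2 * k)) = c / 2" if "k > 0" for k
    using that by simp
  \<comment> \<open>The radius makes the change of \<open>B\<close> at most half of its lower bound
    at \<open>p\<close>, so half of that bound survives on the ball.\<close>
  define r' where "r' = min r (c / (2 * (K + 1)))"
  have r': "r' > 0" "r' \<le> r" "K * r' \<le> c / 2"
  proof -
    show "r' > 0" "r' \<le> r" using r c K by (auto simp: r'_def)
    have "K * r' \<le> (K + 1) * (c / (2 * (K + 1)))"
      using K \<open>r' > 0\<close> by (intro mult_mono) (auto simp: r'_def)
    also have "\<dots> = c / 2" using half[of "K + 1"] K by linarith
    finally show "K * r' \<le> c / 2" .
  qed
  show thesis
  proof (rule that[of r' "c / 2" K])
    show "ball p r' \<subseteq> U" using r'(2) r(3) subset_ball by blast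
    show "norm (B x v - B y v) \<le> K * norm (x - y) * norm v" if "x \<in> ball p r'" "y \<in> ball p r'" for x y v
      using that r'(2) by (intro lip) auto
    fix y v assume y: "y \<in> ball p r'"
    have "norm (B y v - B p v) \<le> K * norm (y - p) * norm v"
      using y r' by (intro lip) auto
    also have "\<dots> \<le> K * r' * norm v"
      using y K by (intro mult_right_mono mult_left_mono) (auto simp: dist_norm norm_minus_commute)
    also have "\<dots> \<le> c / 2 * norm v" using r'(3) by (intro mult_right_mono) auto
    finally have "norm (B y v - B p v) \<le> c / 2 * norm v" .
    moreover have "norm (B p v) \<le> norm (B y v) + norm (B y v - B p v)"
      by (metis add.commute norm_minus_commute norm_triangle_sub)
    ultimately show "c / 2 * norm v \<le> norm (B y v)" using c(2)[of v] by (simp add: field_simps)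
  qed (use r' c K in auto)
qed

text \<open>Here constant rank enters. The kernel of \<open>D y\<close> lies in that of
  \<open>J\<close> after \<open>D y\<close>. Injectivity of \<open>B y\<close> makes the projection
  onto \<open>T\<close> injective on the larger kernel, whose dimension is thus at most m; the
  smaller one already has dimension m, so they coincide.\<close>

lemma kernel_of_B_tangential:
  assumes y: "y \<in> U" and inj: "\<And>v. B y v = 0 \<Longrightarrow> v = 0" and BX: "B y X \<in> T"
  shows "D y X = 0"
proof -
  let ?K1 = "{v. D y v = 0}" and ?K2 = "{v. J (D y v) = 0}"
  have lin: "linear (\<lambda>v. J (D y v))"
    by (rule linear_compose[OF linear_D[OF y] linear_J, unfolded o_def])
  have sub: "subspace ?K1" "subspace ?K2"
    using linear_subspace_kernel[OF linear_D[OF y]] linear_subspace_kernel[OF lin] by auto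
  have "v = 0" if "J (D y v) = 0" "orth_proj T v = 0" for v
    by (rule inj) (simp add: B_def that)
  then have "inj_on (orth_proj T) ?K2"
    unfolding linear_injective_on_subspace_0[OF linear_orth_proj[OF subspace_T] sub(2)]
    by blast
  then have "dim ?K2 = dim (orth_proj T ` ?K2)"
    by (intro dim_image_eq[symmetric] linear_orth_proj subspace_T) (simp add: span_eq_iff[THEN iffD2, OF sub(2)])
  also have "\<dots> \<le> dim T"
    by (intro dim_subset) (auto intro: orth_proj(1)[OF subspace_T])
  also have "dim T = dim ?K1" unfolding T_def by (simp add: dim_kernel pU y)
  finally have "?K1 = ?K2"
    by (intro subspace_dim_equal sub) (auto simp: linear_0[OF linear_J])
  moreover have "J (D y X) = 0"
  proof (rule J_in_T)
    have "J (D y X) = B y X - orth_proj T X" by (simp add: B_def)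
    then show "J (D y X) \<in> T" using BX orth_proj(1)[OF subspace_T] subspace_diff[OF subspace_T] by metis
  qed
  ultimately show ?thesis by blast
qed

text \<open>The curve is the preimage of a segment in \<open>T\<close> under the chart. It stays in
  M because its velocity is killed by the derivative of \<open>F\<close>, and it is smooth because
  the velocity solves an invertible linear system with coefficients depending smoothly on the
  curve.\<close>

lemma local_curve_exists:
  assumes w: "w \<in> T"
  obtains \<gamma> where "curve_in M p \<gamma>" "(\<gamma> has_vector_derivative w) (at 0)"
proof -
  obtain r c C where r: "r > 0" "c > 0" "C \<ge> 0" "ball p r \<subseteq> U"
    "\<And>y v. y \<in> ball p r \<Longrightarrow> c * norm v \<le> norm (B y v)"
    "\<And>x y v. x \<in> ball p r \<Longrightarrow> y \<in> ball p r \<Longrightarrow> norm (B x v - B y v) \<le> C * norm (x - y) * norm v"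
    using B_estimates by metis
  have inj: "v = 0" if "y \<in> ball p r" "B y v = 0" for y v
    using r(5)[OF that(1), of v] that(2) r(2) by (simp add: mult_le_0_iff)
  define \<Psi> where "\<Psi> = (\<lambda>x. J (F x) + orth_proj T (x - p))"
  have bl: "bounded_linear (B y)" if "y \<in> ball p r" for y
    using linear_B r(4) that by (intro linear_conv_bounded_linear[THEN iffD1]) blast
  have der\<Psi>: "(\<Psi> has_derivative B x) (at x)" if "x \<in> ball p r" for x
  proof -
    have "((\<lambda>x. J (F x)) has_derivative (\<lambda>v. J (D x v))) (at x)"
      using r(4) that
      by (intro bounded_linear.has_derivative[OF linear_conv_bounded_linear[THEN iffD1, OF linear_J] D]) blast
    moreover have "((\<lambda>x. orth_proj T (x - p)) has_derivative (\<lambda>v. orth_proj T v)) (at x)"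
      by (rule bounded_linear.has_derivative[OF linear_conv_bounded_linear[THEN iffD1, OF linear_orth_proj[OF subspace_T]]])
        (auto intro!: derivative_eq_intros)
    ultimately show ?thesis unfolding \<Psi>_def B_def by (rule has_derivative_add)
  qed
  define f' where "f' = (\<lambda>x. Blinfun (B x))"
  have f': "blinfun_apply (f' x) = B x" if "x \<in> ball p r" for x
    unfolding f'_def using bl[OF that] by (rule bounded_linear_Blinfun_apply)
  have Fp: "F p = 0" using zero pM pU by blast
  have \<Psi>p: "\<Psi> p = 0"
    by (simp add: \<Psi>_def Fp linear_0[OF linear_J] linear_0[OF linear_orth_proj[OF subspace_T]])
  have pr: "p \<in> ball p r" using r(1) by simp
  have contf: "continuous_on (ball p r) f'"
  proof (rule lipschitz_on_continuous_on[OF lipschitz_onI])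
    show "dist (f' x) (f' y) \<le> C * dist x y" if xy: "x \<in> ball p r" "y \<in> ball p r" for x y
      unfolding dist_norm
    proof (rule norm_blinfun_bound)
      show "norm (blinfun_apply (f' x - f' y) v) \<le> C * norm (x - y) * norm v" for v
        using r(6)[OF xy] by (simp only: blinfun.diff_left f'[OF xy(1)] f'[OF xy(2)])
    qed (use r in simp)
  qed (rule r(3))
  obtain gi where gi: "linear gi" "gi \<circ> B p = id"
    using linear_injective_left_inverse[OF linear_B[OF pU]] inj[OF pr]
    by (metis linear_B linear_injective_0 pU)
  have invf: "Blinfun gi o\<^sub>L f' p = id_blinfun"
  proof (rule blinfun_eqI)
    fix v
    have "blinfun_apply (Blinfun gi) = gi"
      using gi(1) by (intro bounded_linear_Blinfun_apply linear_conv_bounded_linear[THEN iffD1])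
    then show "(Blinfun gi o\<^sub>L f' p) v = id_blinfun v"
      using gi(2) by (simp add: f'[OF pr] fun_eq_iff)
  qed
  obtain U' V g g' where IFT: "open U'" "U' \<subseteq> ball p r" "p \<in> U'" "open V" "\<Psi> p \<in> V" "homeomorphism U' V \<Psi> g"
    "\<And>y. y \<in> V \<Longrightarrow> (g has_derivative (g' y)) (at y)"
    using inverse_function_theorem[OF open_ball _ contf pr invf, of \<Psi>] der\<Psi> f' by metis
  have hom: "g ` V = U'" "\<And>y. y \<in> V \<Longrightarrow> \<Psi> (g y) = y" "\<And>x. x \<in> U' \<Longrightarrow> g (\<Psi> x) = x"
    using IFT(6) unfolding homeomorphism_def by auto
  obtain e0 where e0: "e0 > 0" "ball 0 e0 \<subseteq> V"
    using IFT(4,5) \<Psi>p by (metis open_contains_ball)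
  \<comment> \<open>The amplitude \<open>e\<close> makes \<open>e * norm w\<close> less than
    \<open>e0\<close>, so the segment stays in the domain of the inverse chart.\<close>
  define e where "e = e0 / (2 * (norm w + 1))"
  have e: "e > 0" using e0 by (simp add: e_def add_nonneg_pos)
  have half: "e0 / (2 * k) * k = e0 / 2" if "k > 0" for k
    using that by simp
  have "e * norm w \<le> e * (norm w + 1)" using e by simp
  also have "\<dots> = e0 / 2" unfolding e_def by (rule half) (simp add: add_nonneg_pos)
  also have "\<dots> < e0" using e0 by simp
  finally have ew: "e * norm w < e0" .
  \<comment> \<open>A sine of amplitude \<open>e\<close> and period scale \<open>e\<close> has
    derivative 1 at 0, yet remains in the interval from \<open>-e\<close> to \<open>e\<close> for
    all times. So the curve is defined on the whole line, as \<open>curve_in\<close>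
    demands.\<close>
  define \<phi> where "\<phi> = (\<lambda>s. e * sin (s / e))"
  have d\<phi>: "(\<phi> has_real_derivative cos (s / e)) (at s)" for s
    unfolding \<phi>_def using e by (auto intro!: derivative_eq_intros)
  have inV: "\<phi> s *\<^sub>R w \<in> V" for s
  proof -
    have "\<bar>\<phi> s\<bar> \<le> e" unfolding \<phi>_def using e by (simp add: abs_mult)
    then have "norm (\<phi> s *\<^sub>R w) \<le> e * norm w" by (simp add: mult_right_mono)
    then show ?thesis using ew e0(2) by auto
  qed
  define \<gamma> where "\<gamma> = (\<lambda>s. g (\<phi> s *\<^sub>R w))"
  define \<gamma>' where "\<gamma>' = (\<lambda>s. g' (\<phi> s *\<^sub>R w) (cos (s / e) *\<^sub>R w))"
  have \<gamma>U': "\<gamma> s \<in> U'" for s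
    using hom(1) inV unfolding \<gamma>_def by blast
  have \<gamma>r: "\<gamma> s \<in> ball p r" for s using \<gamma>U' IFT(2) by blast
  have \<gamma>U: "\<gamma> s \<in> U" for s using \<gamma>r r(4) by blast
  have \<Psi>\<gamma>: "\<Psi> (\<gamma> s) = \<phi> s *\<^sub>R w" for s
    unfolding \<gamma>_def by (rule hom(2)[OF inV])
  have dw: "((\<lambda>s. \<phi> s *\<^sub>R w) has_vector_derivative cos (s / e) *\<^sub>R w) (at s)" for s
    using has_vector_derivative_scaleR[OF d\<phi> has_vector_derivative_const] by simp
  have d\<gamma>: "(\<gamma> has_vector_derivative \<gamma>' s) (at s)" for s
  proof -
    have "(\<gamma> has_derivative (\<lambda>h. g' (\<phi> s *\<^sub>R w) (h *\<^sub>R (cos (s / e) *\<^sub>R w)))) (at s)"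
      unfolding \<gamma>_def
      by (rule has_derivative_compose[where f = "\<lambda>s. \<phi> s *\<^sub>R w" and g = g])
        (use dw IFT(7)[OF inV] in \<open>simp_all add: has_vector_derivative_def\<close>)
    then show ?thesis
      unfolding has_vector_derivative_def \<gamma>'_def
      using linear_scale[OF has_derivative_linear[OF IFT(7)[OF inV]]] by simp
  qed
  have B\<gamma>': "B (\<gamma> s) (\<gamma>' s) = cos (s / e) *\<^sub>R w" for s
  proof -
    have "((\<lambda>s. \<Psi> (\<gamma> s)) has_derivative (\<lambda>h. B (\<gamma> s) (h *\<^sub>R \<gamma>' s))) (at s)"
      by (rule has_derivative_compose[where f = \<gamma> and g = \<Psi>])
        (use d\<gamma> der\<Psi>[OF \<gamma>r] in \<open>simp_all add: has_vector_derivative_def\<close>)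
    then have "((\<lambda>s. \<phi> s *\<^sub>R w) has_vector_derivative B (\<gamma> s) (\<gamma>' s)) (at s)"
      unfolding has_vector_derivative_def \<Psi>\<gamma> by (simp add: linear_scale[OF linear_B[OF \<gamma>U]])
    then show ?thesis using dw vector_derivative_unique_at by blast
  qed
  \<comment> \<open>The chart only shows that \<open>J (F (\<gamma> s))\<close> vanishes, and
    \<open>J\<close> may have a kernel. Vanishing of \<open>F\<close> itself is obtained by
    integration: its derivative along the curve is zero and it starts at
    \<open>F p = 0\<close>.\<close>
  have D\<gamma>': "D (\<gamma> s) (\<gamma>' s) = 0" for s
  proof (rule kernel_of_B_tangential[OF \<gamma>U])
    show "v = 0" if "B (\<gamma> s) v = 0" for v using inj[OF \<gamma>r that] .
    show "B (\<gamma> s) (\<gamma>' s) \<in> T" unfolding B\<gamma>' by (rule subspace_scale[OF subspace_T w])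
  qed
  have dF: "((\<lambda>s. F (\<gamma> s)) has_derivative (\<lambda>h. 0)) (at s)" for s
  proof -
    have "((\<lambda>s. F (\<gamma> s)) has_derivative (\<lambda>h. D (\<gamma> s) (h *\<^sub>R \<gamma>' s))) (at s)"
      by (rule has_derivative_compose[where f = \<gamma> and g = F])
        (use d\<gamma> D[OF \<gamma>U] in \<open>simp_all add: has_vector_derivative_def\<close>)
    then show ?thesis by (simp add: linear_scale[OF linear_D[OF \<gamma>U]] D\<gamma>')
  qed
  have \<gamma>0: "\<gamma> 0 = p"
    using hom(3)[OF IFT(3)] by (simp add: \<gamma>_def \<phi>_def \<Psi>p)
  have "\<exists>k. \<forall>s\<in>UNIV. F (\<gamma> s) = k"
    by (rule has_derivative_zero_constant) (use dF has_derivative_at_withinI in auto)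
  then have "F (\<gamma> s) = 0" for s using \<gamma>0 Fp by (metis UNIV_I)
  then have \<gamma>M: "\<gamma> s \<in> M" for s using \<gamma>U zero by blast
  have ndiff: "ndiff k \<gamma>" for k
  proof (induction k)
    case (Suc k)
    \<comment> \<open>Bootstrap: the matrix of \<open>B (\<gamma> s)\<close> involves
      \<open>\<gamma>\<close> but not its velocity, so \<open>k\<close> derivatives of
      \<open>\<gamma>\<close> give \<open>k\<close> derivatives of the velocity and hence one more
      of \<open>\<gamma>\<close>.\<close>
    have "ndiff k \<gamma>'"
    proof (rule ndiff_linear_system)
      let ?A = "\<lambda>s. matrix (B (\<gamma> s))"
      have A: "?A s *v v = B (\<gamma> s) v" for s v
        by (rule matrix_works) (simp add: linear_matrix_vector_mul_eq linear_B[OF \<gamma>U])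
      show "ndiff k (\<lambda>s. ?A s $ i $ j)" for i j
      proof -
        have "?A s $ i $ j = J (iter_dderiv F [axis j 1] (\<gamma> s)) $ i + orth_proj T (axis j 1) $ i" for s
          by (simp add: matrix_def B_def)
        moreover have "ndiff k (\<lambda>s. iter_dderiv F [axis j 1] (\<gamma> s))"
          by (rule ndiff_compose[OF smooth_on_iter_dderiv[OF smooth] Suc \<gamma>U])
        then have "ndiff k (\<lambda>s. J (iter_dderiv F [axis j 1] (\<gamma> s)) $ i)"
          by (intro ndiff_linear[OF bounded_linear_vec_nth]
              ndiff_linear[OF linear_conv_bounded_linear[THEN iffD1, OF linear_J]])
        ultimately show ?thesis using ndiff_add[OF _ ndiff_const] by simp
      qed
      have "ndiff k (\<lambda>s. 0 * sin (s / e) + 1 * cos (s / e))" using e by (intro ndiff_sin_cos) simp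
      then have "ndiff k (\<lambda>s. cos (s / e) * w $ i)" for i
        by (intro ndiff_mult ndiff_const) simp
      then show "ndiff k (\<lambda>s. (cos (s / e) *\<^sub>R w) $ i)" for i by simp
      show "det (?A s) \<noteq> 0" for s
      proof -
        have "inj (B (\<gamma> s))" using inj[OF \<gamma>r] linear_injective_0[OF linear_B[OF \<gamma>U]] by blast
        then show ?thesis using det_nz_iff_inj[OF linear_B[OF \<gamma>U]] by blast
      qed
      show "?A s *v \<gamma>' s = cos (s / e) *\<^sub>R w" for s by (simp only: A B\<gamma>')
    qed
    then show ?case using d\<gamma> by auto
  qed simp
  show thesis
  proof
    show "curve_in M p \<gamma>"
      unfolding curve_in_def using ndiff_imp_smooth_on[OF ndiff] \<gamma>0 \<gamma>M zero_less_one by blast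
    have "B p (\<gamma>' 0) = w" using B\<gamma>'[of 0] \<gamma>0 by simp
    then have "B p (\<gamma>' 0 - w) = 0" by (simp add: linear_diff[OF linear_B[OF pU]] B_on_T w)
    then have "\<gamma>' 0 = w" using B_injective_at_p by force
    then show "(\<gamma> has_vector_derivative w) (at 0)" using d\<gamma>[of 0] by simp
  qed
qed

text \<open>\<open>F\<close> vanishes along the curve. The conclusion covers an interval of times
  because \<open>hess_form_distance\<close> differentiates the tangency of the velocity once
  more.\<close>

lemma curve_derivative_in_kernel:
  assumes "curve_in M p \<gamma>"
  obtains e where "e > 0" "\<And>s. \<bar>s\<bar> < e \<Longrightarrow> \<gamma> s \<in> M \<inter> U \<and> D (\<gamma> s) (iter_dderiv \<gamma> [1] s) = 0"
proof -
  obtain e1 where e1: "e1 > 0" "\<And>s. \<bar>s\<bar> < e1 \<Longrightarrow> \<gamma> s \<in> M" and sm: "smooth_on UNIV \<gamma>" and \<gamma>0: "\<gamma> 0 = p"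
    using assms unfolding curve_in_def by auto
  have d\<gamma>: "(\<gamma> has_vector_derivative iter_dderiv \<gamma> [1] s) (at s)" for s
    using smooth_curve_vector_derivative[OF sm, of "[]"] by simp
  have "isCont \<gamma> 0" using d\<gamma> has_vector_derivative_continuous by blast
  then have "\<forall>\<^sub>F s in nhds 0. \<gamma> s \<in> U"
    using topological_tendstoD[of \<gamma> p "nhds 0" U] smooth_on_open[OF smooth] pU \<gamma>0
    by (simp add: continuous_at tendsto_nhds_iff)
  then obtain e2 where e2: "e2 > 0" "\<And>s. \<bar>s\<bar> < e2 \<Longrightarrow> \<gamma> s \<in> U"
    by (auto simp: eventually_nhds_metric dist_real_def)
  define e where "e = min e1 e2"
  have MU: "\<gamma> s \<in> M \<inter> U" if "\<bar>s\<bar> < e" for s using that e1 e2 by (auto simp: e_def)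
  show thesis
  proof (rule that[of e])
    show "e > 0" using e1 e2 by (simp add: e_def)
    fix s :: real assume s: "\<bar>s\<bar> < e"
    have "((\<lambda>s. F (\<gamma> s)) has_derivative (\<lambda>h. D (\<gamma> s) (h *\<^sub>R iter_dderiv \<gamma> [1] s))) (at s)"
      by (rule has_derivative_compose[where f = \<gamma> and g = F])
        (use d\<gamma> D MU[OF s] in \<open>auto simp: has_vector_derivative_def\<close>)
    moreover have "((\<lambda>s. F (\<gamma> s)) has_derivative (\<lambda>h. 0)) (at s)"
    proof (rule has_derivative_transform_within_open[of "\<lambda>_. 0" _ _ _ "{-e<..<e}"])
      show "0 = F (\<gamma> \<tau>)" if "\<tau> \<in> {-e<..<e}" for \<tau>
      proof -
        have "\<gamma> \<tau> \<in> M \<inter> U" using that by (intro MU) auto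
        then show ?thesis unfolding zero by simp
      qed
    qed (use s in auto)
    ultimately have "(\<lambda>h. D (\<gamma> s) (h *\<^sub>R iter_dderiv \<gamma> [1] s)) = (\<lambda>h. 0)"
      by (rule has_derivative_unique)
    then have "D (\<gamma> s) (1 *\<^sub>R iter_dderiv \<gamma> [1] s) = 0" by meson
    then show "\<gamma> s \<in> M \<inter> U \<and> D (\<gamma> s) (iter_dderiv \<gamma> [1] s) = 0" using MU[OF s] by simp
  qed
qed

text \<open>A set of curve velocities is not visibly closed under addition; identifying it with a
  kernel makes it a subspace and gives its dimension.\<close>

lemma tangent_space_eq: "tangent_space M p = T"
proof
  show "T \<subseteq> tangent_space M p"
    unfolding tangent_space_def using local_curve_exists by blast
  show "tangent_space M p \<subseteq> T"
  proof
    fix v assume "v \<in> tangent_space M p"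
    then obtain \<gamma> where \<gamma>: "curve_in M p \<gamma>" "(\<gamma> has_vector_derivative v) (at 0)"
      unfolding tangent_space_def by blast
    then have sm: "smooth_on UNIV \<gamma>" "\<gamma> 0 = p" unfolding curve_in_def by auto
    have "(\<gamma> has_vector_derivative iter_dderiv \<gamma> [1] 0) (at 0)"
      using smooth_curve_vector_derivative[OF sm(1), of "[]"] by simp
    then have "iter_dderiv \<gamma> [1] 0 = v" using \<gamma>(2) vector_derivative_unique_at by blast
    moreover have "D (\<gamma> 0) (iter_dderiv \<gamma> [1] 0) = 0"
      using curve_derivative_in_kernel[OF \<gamma>(1)] by (metis abs_zero)
    ultimately show "v \<in> T" by (simp add: T_def sm(2))
  qed
qed

lemma at_point: "q \<in> M \<inter> U \<Longrightarrow> local_equation M m q U F"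
  using smooth zero rank m by unfold_locales auto

lemma tangent_space_at:
  assumes "q \<in> M \<inter> U"
  shows "tangent_space M q = {v. D q v = 0}"
  using local_equation.tangent_space_eq[OF at_point[OF assms]] local_equation.T_def[OF at_point[OF assms]]
  by simp

text \<open>\<open>X y w\<close> is the preimage of the constant vector \<open>w\<close> under the
  chart derivative at \<open>y\<close>. By \<open>kernel_of_B_tangential\<close> it is tangent to M
  whenever \<open>y\<close> is in M.\<close>

lemma tangent_frame:
  obtains r C X where "r > 0" "C \<ge> 0" "ball p r \<subseteq> U"
    "\<And>y w. y \<in> M \<inter> ball p r \<Longrightarrow> w \<in> T \<Longrightarrow> X y w \<in> tangent_space M y"
    "\<And>y z w. y \<in> ball p r \<Longrightarrow> z \<in> ball p r \<Longrightarrow> norm (X y w - X z w) \<le> C * norm (y - z) * norm w"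
    "\<And>w. w \<in> T \<Longrightarrow> X p w = w"
proof -
  obtain r c C where r: "r > 0" "c > 0" "C \<ge> 0" "ball p r \<subseteq> U"
    "\<And>y v. y \<in> ball p r \<Longrightarrow> c * norm v \<le> norm (B y v)"
    "\<And>x y v. x \<in> ball p r \<Longrightarrow> y \<in> ball p r \<Longrightarrow> norm (B x v - B y v) \<le> C * norm (x - y) * norm v"
    using B_estimates by metis
  have inj: "v = 0" if "y \<in> ball p r" "B y v = 0" for y v
    using r(5)[OF that(1), of v] that(2) r(2) by (simp add: mult_le_0_iff)
  have lin: "linear (B y)" if "y \<in> ball p r" for y using linear_B r(4) that by blast
  define X where "X = (\<lambda>y. inv (B y))"
  have BX: "B y (X y w) = w" if "y \<in> ball p r" for y w
  proof -
    have "inj (B y)" using inj[OF that] linear_injective_0[OF lin[OF that]] by blast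
    then have "surj (B y)" using lin[OF that] linear_injective_imp_surjective by blast
    then show ?thesis unfolding X_def by (rule surj_f_inv_f)
  qed
  have pr: "p \<in> ball p r" using r(1) by simp
  show thesis
  proof (rule that[of r "C / (c * c)" X])
    show "C / (c * c) \<ge> 0" using r by simp
    show "X y w \<in> tangent_space M y" if "y \<in> M \<inter> ball p r" "w \<in> T" for y w
    proof -
      have y: "y \<in> ball p r" "y \<in> M \<inter> U" using that r(4) by auto
      have "D y (X y w) = 0"
        by (rule kernel_of_B_tangential) (use y inj BX that in auto)
      then show ?thesis by (simp add: tangent_space_at[OF y(2)])
    qed
    show "norm (X y w - X z w) \<le> C / (c * c) * norm (y - z) * norm w" if yz: "y \<in> ball p r" "z \<in> ball p r" for y z w
    proof -
      have "c * norm (X y w - X z w) \<le> norm (B y (X y w - X z w))" by (rule r(5)[OF yz(1)])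
      \<comment> \<open>Resolvent identity: a difference of inverses becomes a difference of the
        operators. Each of the two inverses contributes one factor \<open>1 / c\<close> to the
        Lipschitz constant.\<close>
      also have "B y (X y w - X z w) = B z (X z w) - B y (X z w)"
        by (simp only: linear_diff[OF lin[OF yz(1)]] BX[OF yz(1)] BX[OF yz(2)])
      also have "norm \<dots> \<le> C * norm (z - y) * norm (X z w)" by (rule r(6)[OF yz(2,1)])
      also have "\<dots> \<le> C * norm (z - y) * (norm w / c)"
        using r(5)[OF yz(2), of "X z w"] r(2,3) BX[OF yz(2)]
        by (intro mult_left_mono) (auto simp: field_simps)
      finally show ?thesis using r(2) by (simp add: field_simps norm_minus_commute)
    qed
    show "X p w = w" if "w \<in> T" for w
    proof -
      have "B p (X p w - w) = 0" by (simp add: linear_diff[OF lin[OF pr]] BX[OF pr] B_on_T that)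
      then show ?thesis using inj[OF pr] by force
    qed
  qed (use r in auto)
qed

end

section \<open>Normal fields, Weingarten map and Hessian\<close>

lemma smooth_curve_second_derivative:
  fixes \<gamma> :: "real \<Rightarrow> 'a::real_inner"
  assumes "smooth_on UNIV \<gamma>"
  shows "deriv (deriv (\<lambda>s. (norm (\<gamma> s - x))\<^sup>2)) 0
    = 2 * (iter_dderiv \<gamma> [1] 0 \<bullet> iter_dderiv \<gamma> [1] 0 + (\<gamma> 0 - x) \<bullet> iter_dderiv \<gamma> [1, 1] 0)"
proof -
  define \<gamma>1 where "\<gamma>1 = iter_dderiv \<gamma> [1]"
  define \<gamma>2 where "\<gamma>2 = iter_dderiv \<gamma> [1, 1]"
  have d1: "(\<gamma> has_vector_derivative \<gamma>1 s) (at s)" for s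
    using smooth_curve_vector_derivative[OF assms, of "[]"] by (simp add: \<gamma>1_def)
  have d2: "(\<gamma>1 has_vector_derivative \<gamma>2 s) (at s)" for s
    using smooth_curve_vector_derivative[OF assms, of "[1]"] by (simp add: \<gamma>1_def \<gamma>2_def)
  have "((\<lambda>s. (norm (\<gamma> s - x))\<^sup>2) has_real_derivative 2 * ((\<gamma> s - x) \<bullet> \<gamma>1 s)) (at s)" for s
    using d1[of s] unfolding power2_norm_eq_inner has_field_derivative_def has_vector_derivative_def
    by (auto intro!: derivative_eq_intros simp: inner_commute fun_eq_iff algebra_simps)
  then have eq: "deriv (\<lambda>s. (norm (\<gamma> s - x))\<^sup>2) = (\<lambda>s. 2 * ((\<gamma> s - x) \<bullet> \<gamma>1 s))"
    by (auto intro!: DERIV_imp_deriv)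
  have "((\<lambda>s. 2 * ((\<gamma> s - x) \<bullet> \<gamma>1 s)) has_real_derivative
      2 * (\<gamma>1 0 \<bullet> \<gamma>1 0 + (\<gamma> 0 - x) \<bullet> \<gamma>2 0)) (at 0)"
    using d1[of 0] d2[of 0] unfolding has_field_derivative_def has_vector_derivative_def
    by (auto intro!: derivative_eq_intros simp: inner_commute fun_eq_iff algebra_simps)
  then show ?thesis unfolding eq using DERIV_imp_deriv by (simp add: \<gamma>1_def \<gamma>2_def)
qed

context local_equation
begin

text \<open>The complement of a kernel is the range of the adjoint: the residual of \<open>v\<close>
  after projection onto \<open>range J\<close> is killed by \<open>D p\<close>, hence tangent, hence
  orthogonal to \<open>v\<close> and to itself.\<close>

lemma normal_space_in_range:
  assumes "v \<in> normal_space M p"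
  obtains c where "v = J c"
proof -
  have S: "subspace (range J)" by (rule linear_subspace_image[OF linear_J]) simp
  define z where "z = v - orth_proj (range J) v"
  have "D p z \<bullet> u = 0" for u
    using orth_proj(2)[OF S, of "J u" v] J_inner[of u z] by (simp add: z_def inner_commute)
  then have "D p z = 0" using vector_eq_rdot[of "D p z" 0] by simp
  then have "z \<in> T" by (simp add: T_def)
  then have "v \<bullet> z = 0" using assms by (simp add: normal_space_def tangent_space_eq)
  moreover have "z \<bullet> orth_proj (range J) v = 0"
    unfolding z_def by (intro orth_proj S)
  ultimately have "z \<bullet> z = 0" by (simp add: z_def inner_diff_right inner_diff_left inner_commute)
  then have "v = orth_proj (range J) v" by (simp add: z_def)
  then show thesis using orth_proj(1)[OF S, of v] that by auto
qed

text \<open>A normal vector has the form \<open>J c\<close>, so the gradient of \<open>y \<mapsto> c \<bullet> F y\<close> extends it to a normal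
  field, whose derivative is a Hessian and hence symmetric.\<close>

lemma symmetric_normal_field_exists:
  assumes "v \<in> normal_space M p"
  obtains \<nu> where "normal_field M p v \<nu>"
    "\<And>u w. frechet_derivative \<nu> (at p) u \<bullet> w = u \<bullet> frechet_derivative \<nu> (at p) w"
proof -
  obtain c where c: "v = J c" using normal_space_in_range[OF assms] .
  define g where "g = (\<lambda>x. c \<bullet> F x)"
  define \<nu> where "\<nu> = (\<lambda>x. \<Sum>b\<in>Basis. (c \<bullet> iter_dderiv F [b] x) *\<^sub>R b)"
  have g: "smooth_on U g"
    unfolding g_def by (rule smooth_on_linear[OF bounded_linear_inner_right smooth])
  have open_U: "open U" using smooth by (rule smooth_on_open)
  have sm\<nu>: "smooth_on U \<nu>"
    unfolding \<nu>_def
  proof (rule smooth_on_sum[OF open_U])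
    fix b :: "real^'n"
    have "bounded_linear (\<lambda>z. (c \<bullet> z) *\<^sub>R b)"
      by (rule bounded_linear_compose[OF bounded_linear_scaleR_left bounded_linear_inner_right])
    then show "smooth_on U (\<lambda>x. (c \<bullet> iter_dderiv F [b] x) *\<^sub>R b)"
      by (rule smooth_on_linear[OF _ smooth_on_iter_dderiv[OF smooth]])
  qed
  have \<nu>_inner: "\<nu> x \<bullet> w = c \<bullet> D x w" if "x \<in> U" for x w
  proof -
    have "D x (\<Sum>b\<in>Basis. (w \<bullet> b) *\<^sub>R b) = (\<Sum>b\<in>Basis. (w \<bullet> b) *\<^sub>R D x b)"
      by (simp only: linear_sum[OF linear_D[OF that]] linear_scale[OF linear_D[OF that]])
    then have "D x w = (\<Sum>b\<in>Basis. (w \<bullet> b) *\<^sub>R D x b)" by (simp only: euclidean_representation)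
    then show ?thesis
      by (simp add: \<nu>_def inner_sum_left inner_sum_right inner_commute mult.commute)
  qed
  show thesis
  proof
    have "\<nu> p \<bullet> w = v \<bullet> w" for w by (simp add: \<nu>_inner[OF pU] c J_inner)
    then have "\<nu> p = v" using vector_eq_rdot by blast
    moreover have "\<nu> x \<in> normal_space M x" if "x \<in> M \<inter> U" for x
      using that \<nu>_inner[of x] by (simp add: normal_space_def tangent_space_at[OF that])
    ultimately show "normal_field M p v \<nu>"
      unfolding normal_field_def using pU sm\<nu> by blast
    have D\<nu>: "frechet_derivative \<nu> (at p) u \<bullet> w = iter_dderiv g [u, w] p" for u w
    proof -
      have eq: "iter_dderiv g [w] x = \<nu> x \<bullet> w" if "x \<in> U" for x
        using iter_dderiv_linear[OF bounded_linear_inner_right smooth that, of c "[w]"]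
        by (simp add: g_def \<nu>_inner[OF that])
      have "((\<lambda>x. \<nu> x \<bullet> w) has_derivative (\<lambda>u. frechet_derivative \<nu> (at p) u \<bullet> w)) (at p)"
        by (rule bounded_linear.has_derivative[OF bounded_linear_inner_left smooth_on_has_derivative[OF sm\<nu> pU]])
      then have "frechet_derivative (\<lambda>x. \<nu> x \<bullet> w) (at p) = (\<lambda>u. frechet_derivative \<nu> (at p) u \<bullet> w)"
        by (rule frechet_derivative_at[symmetric])
      moreover have "frechet_derivative (iter_dderiv g [w]) (at p) = frechet_derivative (\<lambda>x. \<nu> x \<bullet> w) (at p)"
        by (rule frechet_derivative_cong_open[OF open_U pU eq])
      ultimately show ?thesis by (metis iter_dderiv.simps(2))
    qed
    show "frechet_derivative \<nu> (at p) u \<bullet> w = u \<bullet> frechet_derivative \<nu> (at p) w" for u w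
      using D\<nu>[of u w] D\<nu>[of w u] iter_dderiv_swap[OF g pU, of u w] by (simp add: inner_commute)
  qed
qed

lemma normal_field_derivative:
  assumes "normal_field M p v \<nu>"
  shows "(\<nu> has_derivative frechet_derivative \<nu> (at p)) (at p)"
  using assms smooth_on_has_derivative unfolding normal_field_def by blast

text \<open>This frees \<open>weingarten\<close> from its choice of field. Along a curve with
  velocity \<open>u\<close> the difference of the two fields is orthogonal to the tangent frame and
  is zero at time 0. Its difference quotients are therefore orthogonal to the frame, and in the
  limit the derivative of the difference is orthogonal to \<open>w\<close>.\<close>

lemma normal_field_derivative_unique:
  assumes \<nu>: "normal_field M p v \<nu>" and \<nu>': "normal_field M p v \<nu>'" and u: "u \<in> T" and w: "w \<in> T"
  shows "frechet_derivative \<nu> (at p) u \<bullet> w = frechet_derivative \<nu>' (at p) u \<bullet> w"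
proof -
  obtain r C X where r: "r > 0" "C \<ge> 0" "ball p r \<subseteq> U"
    "\<And>y w. y \<in> M \<inter> ball p r \<Longrightarrow> w \<in> T \<Longrightarrow> X y w \<in> tangent_space M y"
    "\<And>y z w. y \<in> ball p r \<Longrightarrow> z \<in> ball p r \<Longrightarrow> norm (X y w - X z w) \<le> C * norm (y - z) * norm w"
    "\<And>w. w \<in> T \<Longrightarrow> X p w = w"
    using tangent_frame by metis
  obtain W W' where W: "p \<in> W" "smooth_on W \<nu>" "\<And>x. x \<in> M \<inter> W \<Longrightarrow> \<nu> x \<in> normal_space M x"
    "p \<in> W'" "smooth_on W' \<nu>'" "\<And>x. x \<in> M \<inter> W' \<Longrightarrow> \<nu>' x \<in> normal_space M x"
    and \<nu>p: "\<nu> p = v" "\<nu>' p = v"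
    using \<nu> \<nu>' unfolding normal_field_def by blast
  obtain \<gamma> where \<gamma>: "curve_in M p \<gamma>" "(\<gamma> has_vector_derivative u) (at 0)"
    using local_curve_exists[OF u] by blast
  have \<gamma>0: "\<gamma> 0 = p" using \<gamma>(1) by (simp add: curve_in_def)
  obtain e1 where e1: "e1 > 0" "\<And>s. \<bar>s\<bar> < e1 \<Longrightarrow> \<gamma> s \<in> M"
    using \<gamma>(1) unfolding curve_in_def by blast
  define k where "k = (\<lambda>s. \<nu> (\<gamma> s) - \<nu>' (\<gamma> s))"
  define d where "d = frechet_derivative \<nu> (at p) u - frechet_derivative \<nu>' (at p) u"
  have comp: "((\<lambda>s. f (\<gamma> s)) has_vector_derivative frechet_derivative f (at p) u) (at 0)"
    if "normal_field M p v f" for f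
  proof -
    note D = normal_field_derivative[OF that]
    have "((\<lambda>s. f (\<gamma> s)) has_derivative (\<lambda>h. frechet_derivative f (at p) (h *\<^sub>R u))) (at 0)"
      by (rule has_derivative_compose[where f = \<gamma> and g = f])
        (use \<gamma>(2) D in \<open>simp_all add: has_vector_derivative_def \<gamma>0\<close>)
    then show ?thesis
      by (simp add: has_vector_derivative_def linear_scale[OF has_derivative_linear[OF D]])
  qed
  have dk: "(k has_vector_derivative d) (at 0)"
    unfolding k_def d_def by (rule has_vector_derivative_diff[OF comp[OF \<nu>] comp[OF \<nu>']])
  have k0: "k 0 = 0" by (simp add: k_def \<gamma>0 \<nu>p)
  have lim: "((\<lambda>s. k s /\<^sub>R s) \<longlongrightarrow> d) (at 0)"
  proof -
    have "((\<lambda>s. norm (k (0 + s) - k 0 - s *\<^sub>R d) / norm s) \<longlongrightarrow> 0) (at 0)"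
      using dk unfolding has_vector_derivative_def has_derivative_at by blast
    moreover have "\<forall>\<^sub>F s in at 0. norm (k (0 + s) - k 0 - s *\<^sub>R d) / norm s = norm (k s /\<^sub>R s - d)"
      unfolding eventually_at_filter
    proof (rule always_eventually, intro allI impI)
      fix s :: real assume "s \<noteq> 0"
      then have "k s /\<^sub>R s - d = (k s - s *\<^sub>R d) /\<^sub>R s" by (simp add: scaleR_diff_right)
      then show "norm (k (0 + s) - k 0 - s *\<^sub>R d) / norm s = norm (k s /\<^sub>R s - d)"
        by (simp add: k0 divide_inverse mult.commute)
    qed
    ultimately have "((\<lambda>s. norm (k s /\<^sub>R s - d)) \<longlongrightarrow> 0) (at 0)"
      by (rule Lim_transform_eventually)
    then show ?thesis by (rule LIM_zero_cancel[OF tendsto_norm_zero_cancel])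
  qed
  have cont: "(\<gamma> \<longlongrightarrow> p) (at 0)"
    using has_vector_derivative_continuous[OF \<gamma>(2)] \<gamma>0 by (simp add: continuous_at isCont_def)
  have ev: "\<forall>\<^sub>F s in at 0. \<gamma> s \<in> M \<and> \<gamma> s \<in> ball p r \<and> \<gamma> s \<in> W \<and> \<gamma> s \<in> W'"
  proof (intro eventually_conj)
    show "\<forall>\<^sub>F s in at 0. \<gamma> s \<in> M"
      unfolding eventually_at using e1 by (auto simp: dist_real_def)
    show "\<forall>\<^sub>F s in at 0. \<gamma> s \<in> ball p r"
      using r(1) by (intro topological_tendstoD[OF cont]) auto
    show "\<forall>\<^sub>F s in at 0. \<gamma> s \<in> W" "\<forall>\<^sub>F s in at 0. \<gamma> s \<in> W'"
      using topological_tendstoD[OF cont smooth_on_open[OF W(2)] W(1)]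
        topological_tendstoD[OF cont smooth_on_open[OF W(5)] W(4)] by blast+
  qed
  have "((\<lambda>s. C * norm (\<gamma> s - p) * norm w) \<longlongrightarrow> C * norm (p - p) * norm w) (at 0)"
    by (intro tendsto_intros cont)
  then have "((\<lambda>s. C * norm (\<gamma> s - p) * norm w) \<longlongrightarrow> 0) (at 0)" by simp
  moreover have "\<forall>\<^sub>F s in at 0. norm (X (\<gamma> s) w - w) \<le> C * norm (\<gamma> s - p) * norm w"
    using ev
  proof eventually_elim
    case (elim s)
    then show ?case using r(5)[of "\<gamma> s" p w] r(1,6) w by simp
  qed
  ultimately have "((\<lambda>s. X (\<gamma> s) w - w) \<longlongrightarrow> 0) (at 0)"
    by (rule Lim_null_comparison[rotated])
  then have "((\<lambda>s. X (\<gamma> s) w) \<longlongrightarrow> w) (at 0)" by (rule LIM_zero_cancel)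
  then have lim_dw: "((\<lambda>s. (k s /\<^sub>R s) \<bullet> X (\<gamma> s) w) \<longlongrightarrow> d \<bullet> w) (at 0)"
    by (intro tendsto_inner lim)
  have "\<forall>\<^sub>F s in at 0. (k s /\<^sub>R s) \<bullet> X (\<gamma> s) w = 0"
    using ev
  proof eventually_elim
    case (elim s)
    have "X (\<gamma> s) w \<in> tangent_space M (\<gamma> s)" using r(4) elim w by blast
    moreover have "\<nu> (\<gamma> s) \<in> normal_space M (\<gamma> s)" "\<nu>' (\<gamma> s) \<in> normal_space M (\<gamma> s)" using W elim by auto
    ultimately show ?case by (simp add: k_def normal_space_def inner_diff_left)
  qed
  then have lim_0: "((\<lambda>s. (k s /\<^sub>R s) \<bullet> X (\<gamma> s) w) \<longlongrightarrow> 0) (at 0)" by (rule tendsto_eventually)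
  have "d \<bullet> w = 0" by (rule tendsto_unique[OF _ lim_dw lim_0]) simp
  then show ?thesis by (simp add: d_def inner_diff_left)
qed

text \<open>Symmetry is known for the gradient field of
  \<open>symmetric_normal_field_exists\<close>; uniqueness on tangent vectors transfers it to any
  field, in particular to the one picked in \<open>weingarten\<close>.\<close>

lemma normal_field_derivative_symmetric:
  assumes \<nu>: "normal_field M p v \<nu>" and u: "u \<in> T" and w: "w \<in> T"
  shows "frechet_derivative \<nu> (at p) u \<bullet> w = u \<bullet> frechet_derivative \<nu> (at p) w"
proof -
  have "\<nu> p \<in> normal_space M p" using \<nu> pM unfolding normal_field_def by blast
  then have "v \<in> normal_space M p" using \<nu> by (simp add: normal_field_def)
  then obtain \<nu>' where \<nu>': "normal_field M p v \<nu>'"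
    "\<And>u w. frechet_derivative \<nu>' (at p) u \<bullet> w = u \<bullet> frechet_derivative \<nu>' (at p) w"
    using symmetric_normal_field_exists by metis
  show ?thesis
    using normal_field_derivative_unique[OF \<nu> \<nu>'(1) u w] normal_field_derivative_unique[OF \<nu> \<nu>'(1) w u] \<nu>'(2)[of u w]
    by (simp add: inner_commute)
qed

text \<open>The second derivative along a curve contains the acceleration. Differentiating the
  relation that \<open>\<nu>\<close> along the curve is orthogonal to the velocity expresses the
  normal part of the acceleration through the derivative of \<open>\<nu>\<close>, so the choice of
  curve in \<open>hess_form\<close> drops out.\<close>

lemma hess_form_distance:
  assumes \<nu>: "normal_field M p (x - p) \<nu>" and w: "w \<in> T"
  shows "hess_form M (\<lambda>y. (norm (y - x))\<^sup>2) p w = 2 * (w \<bullet> w + frechet_derivative \<nu> (at p) w \<bullet> w)"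
proof -
  define \<gamma> where "\<gamma> = (SOME \<gamma>. curve_in M p \<gamma> \<and> (\<gamma> has_vector_derivative w) (at 0))"
  have "\<exists>\<gamma>. curve_in M p \<gamma> \<and> (\<gamma> has_vector_derivative w) (at 0)"
    using local_curve_exists[OF w] by blast
  from someI_ex[OF this] have \<gamma>: "curve_in M p \<gamma>" "(\<gamma> has_vector_derivative w) (at 0)"
    unfolding \<gamma>_def by blast+
  have sm: "smooth_on UNIV \<gamma>" and \<gamma>0: "\<gamma> 0 = p" using \<gamma>(1) by (auto simp: curve_in_def)
  define \<gamma>1 where "\<gamma>1 = iter_dderiv \<gamma> [1]"
  define \<gamma>2 where "\<gamma>2 = iter_dderiv \<gamma> [1, 1]"
  have d1: "(\<gamma> has_vector_derivative \<gamma>1 s) (at s)" for s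
    using smooth_curve_vector_derivative[OF sm, of "[]"] by (simp add: \<gamma>1_def)
  have d2: "(\<gamma>1 has_vector_derivative \<gamma>2 s) (at s)" for s
    using smooth_curve_vector_derivative[OF sm, of "[1]"] by (simp add: \<gamma>1_def \<gamma>2_def)
  have \<gamma>10: "\<gamma>1 0 = w" using d1[of 0] \<gamma>(2) vector_derivative_unique_at by blast
  obtain e where e: "e > 0" "\<And>s. \<bar>s\<bar> < e \<Longrightarrow> \<gamma> s \<in> M \<inter> U \<and> D (\<gamma> s) (\<gamma>1 s) = 0"
    using curve_derivative_in_kernel[OF \<gamma>(1)] unfolding \<gamma>1_def by metis
  obtain W where W: "p \<in> W" "smooth_on W \<nu>" "\<And>x. x \<in> M \<inter> W \<Longrightarrow> \<nu> x \<in> normal_space M x"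
    and \<nu>p: "\<nu> p = x - p"
    using \<nu> unfolding normal_field_def by blast
  have "(\<gamma> \<longlongrightarrow> p) (nhds 0)"
    using has_vector_derivative_continuous[OF \<gamma>(2)] \<gamma>0 by (simp add: continuous_at tendsto_nhds_iff)
  then have "\<forall>\<^sub>F s in nhds 0. \<gamma> s \<in> W"
    using topological_tendstoD[OF _ smooth_on_open[OF W(2)] W(1)] by blast
  then obtain e' where e': "e' > 0" "\<And>s. \<bar>s\<bar> < e' \<Longrightarrow> \<gamma> s \<in> W"
    by (auto simp: eventually_nhds_metric dist_real_def)
  define N where "N = frechet_derivative \<nu> (at p)"
  have N: "(\<nu> has_derivative N) (at p)" unfolding N_def by (rule normal_field_derivative[OF \<nu>])
  have d\<nu>: "((\<lambda>s. \<nu> (\<gamma> s)) has_derivative (\<lambda>h. h *\<^sub>R N w)) (at 0)"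
  proof -
    have "((\<lambda>s. \<nu> (\<gamma> s)) has_derivative (\<lambda>h. N (h *\<^sub>R w))) (at 0)"
      by (rule has_derivative_compose[where f = \<gamma> and g = \<nu>])
        (use \<gamma>(2) N in \<open>simp_all add: has_vector_derivative_def \<gamma>0\<close>)
    then show ?thesis by (simp add: linear_scale[OF has_derivative_linear[OF N]])
  qed
  have "((\<lambda>s. \<nu> (\<gamma> s) \<bullet> \<gamma>1 s) has_derivative (\<lambda>h. \<nu> (\<gamma> 0) \<bullet> (h *\<^sub>R \<gamma>2 0) + (h *\<^sub>R N w) \<bullet> \<gamma>1 0)) (at 0)"
    using d2[of 0] unfolding has_vector_derivative_def by (rule has_derivative_inner[OF d\<nu>])
  moreover have "((\<lambda>s. \<nu> (\<gamma> s) \<bullet> \<gamma>1 s) has_derivative (\<lambda>h. 0)) (at 0)"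
  proof (rule has_derivative_transform_within_open[of "\<lambda>_. 0" _ _ _ "{-min e e'<..<min e e'}"])
    show "0 = \<nu> (\<gamma> s) \<bullet> \<gamma>1 s" if "s \<in> {-min e e'<..<min e e'}" for s
    proof -
      have s: "\<bar>s\<bar> < e" "\<bar>s\<bar> < e'" using that by auto
      have "\<gamma>1 s \<in> tangent_space M (\<gamma> s)"
        using e(2)[OF s(1)] by (simp add: tangent_space_at)
      then show ?thesis using W(3)[of "\<gamma> s"] e(2)[OF s(1)] e'(2)[OF s(2)]
        by (simp add: normal_space_def)
    qed
  qed (use e e' in auto)
  ultimately have "(\<lambda>h. \<nu> (\<gamma> 0) \<bullet> (h *\<^sub>R \<gamma>2 0) + (h *\<^sub>R N w) \<bullet> \<gamma>1 0) = (\<lambda>h. 0)"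
    by (rule has_derivative_unique)
  from fun_cong[OF this, of 1] have "(x - p) \<bullet> \<gamma>2 0 + N w \<bullet> w = 0"
    by (simp add: \<gamma>0 \<nu>p \<gamma>10)
  then have "(p - x) \<bullet> \<gamma>2 0 = N w \<bullet> w"
    by (simp add: inner_diff_left)
  moreover have "hess_form M (\<lambda>y. (norm (y - x))\<^sup>2) p w = 2 * (\<gamma>1 0 \<bullet> \<gamma>1 0 + (\<gamma> 0 - x) \<bullet> \<gamma>2 0)"
    unfolding hess_form_def Let_def \<gamma>_def[symmetric] \<gamma>1_def \<gamma>2_def by (rule smooth_curve_second_derivative[OF sm])
  ultimately show ?thesis by (simp add: \<gamma>10 \<gamma>0 N_def)
qed

text \<open>A kernel vector \<open>h\<close> lies in \<open>T\<close>. By symmetry of the derivative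
  on \<open>T\<close>, the polarised Hessian at \<open>h\<close> and \<open>w\<close> is
  \<open>8 * (h \<bullet> w + N h \<bullet> w)\<close>, and this is zero for all tangent
  \<open>w\<close>; so \<open>h\<close> would witness degeneracy.\<close>

lemma nondegenerate_imp_injective:
  assumes \<nu>: "normal_field M p (x - p) \<nu>"
    and nondeg: "\<not> degenerate_hessian M (\<lambda>y. (norm (y - x))\<^sup>2) p"
    and h: "h + orth_proj T (frechet_derivative \<nu> (at p) (orth_proj T h)) = 0"
  shows "h = 0"
proof (rule ccontr)
  assume "h \<noteq> 0"
  define N where "N = frechet_derivative \<nu> (at p)"
  have N: "linear N" unfolding N_def using normal_field_derivative[OF \<nu>] has_derivative_linear by blast
  have "h = - orth_proj T (N (orth_proj T h))" using h by (simp add: N_def add_eq_0_iff2)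
  then have hT: "h \<in> T" using orth_proj(1)[OF subspace_T] subspace_neg[OF subspace_T] by metis
  then have h': "h + orth_proj T (N h) = 0" using h by (simp add: N_def orth_proj_id[OF subspace_T])
  have "hess_form M (\<lambda>y. (norm (y - x))\<^sup>2) p (h + w) - hess_form M (\<lambda>y. (norm (y - x))\<^sup>2) p (h - w) = 0"
    if w: "w \<in> T" for w
  proof -
    have "N w \<bullet> h = N h \<bullet> w"
      using normal_field_derivative_symmetric[OF \<nu> w hT] by (simp add: N_def inner_commute)
    moreover have "h \<bullet> w + N h \<bullet> w = 0"
    proof -
      have "(h + orth_proj T (N h)) \<bullet> w = 0" by (simp add: h')
      then show ?thesis
        by (simp add: inner_add_left orth_proj_inner[OF subspace_T] orth_proj_id[OF subspace_T w])
    qed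
    moreover have "h + w \<in> T" "h - w \<in> T" using hT w subspace_add subspace_diff subspace_T by auto
    ultimately show ?thesis
      by (simp add: hess_form_distance[OF \<nu>] N_def[symmetric] linear_add[OF N] linear_diff[OF N]
          inner_add_left inner_add_right inner_diff_left inner_diff_right inner_commute)
  qed
  then have "degenerate_hessian M (\<lambda>y. (norm (y - x))\<^sup>2) p"
    unfolding degenerate_hessian_def tangent_space_eq using hT \<open>h \<noteq> 0\<close> by blast
  with nondeg show False by contradiction
qed

end

section \<open>Comparison of two critical points of the distance\<close>

context local_equation
begin

text \<open>With \<open>x1 = x2\<close> this gives the uniqueness of nearest points, with \<open>(x2, y2) = (x0, p)\<close> their
  first-order expansion.\<close>

lemma strict_estimate:
  assumes \<nu>: "normal_field M p (x0 - p) \<nu>" and e: "e > 0"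
  defines "N \<equiv> frechet_derivative \<nu> (at p)"
  obtains r where "r > 0"
    "\<And>x1 x2 y1 y2. x1 \<in> ball x0 r \<Longrightarrow> x2 \<in> ball x0 r \<Longrightarrow> y1 \<in> M \<inter> ball p r \<Longrightarrow> y2 \<in> M \<inter> ball p r \<Longrightarrow>
       x1 - y1 \<in> normal_space M y1 \<Longrightarrow> x2 - y2 \<in> normal_space M y2 \<Longrightarrow>
       norm (y1 - y2 + orth_proj T (N (orth_proj T (y1 - y2))) - orth_proj T (x1 - x2))
         \<le> e * (norm (x1 - x2) + norm (y1 - y2))"
proof -
  let ?P = "orth_proj T"
  note P_le = norm_orth_proj_le_norm[OF subspace_T]
  note linP = linear_orth_proj[OF subspace_T]
  have N: "(\<nu> has_derivative N) (at p)" unfolding N_def by (rule normal_field_derivative[OF \<nu>])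
  have blN: "bounded_linear N" using N has_derivative_bounded_linear by blast
  note linN = bounded_linear.linear[OF blN]
  define K where "K = onorm N"
  have K: "K \<ge> 0" "\<And>v. norm (N v) \<le> K * norm v"
    unfolding K_def using onorm_pos_le[OF blN] onorm[OF blN] by auto
  obtain W where W: "p \<in> W" "smooth_on W \<nu>" "\<And>x. x \<in> M \<inter> W \<Longrightarrow> \<nu> x \<in> normal_space M x"
    and \<nu>p: "\<nu> p = x0 - p"
    using \<nu> unfolding normal_field_def by blast
  obtain r0 C X where r0: "r0 > 0" "C \<ge> 0" "ball p r0 \<subseteq> U"
    "\<And>y w. y \<in> M \<inter> ball p r0 \<Longrightarrow> w \<in> T \<Longrightarrow> X y w \<in> tangent_space M y"
    "\<And>y z w. y \<in> ball p r0 \<Longrightarrow> z \<in> ball p r0 \<Longrightarrow> norm (X y w - X z w) \<le> C * norm (y - z) * norm w"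
    "\<And>w. w \<in> T \<Longrightarrow> X p w = w"
    using tangent_frame by metis
  let ?C = "{y. \<forall>w\<in>T. y \<bullet> w = 0}"
  have subC: "subspace ?C" by (auto simp: subspace_def inner_add_left)
  have "\<forall>v\<in>?C. D p v = 0 \<longrightarrow> v = 0" by (auto simp: T_def)
  \<comment> \<open>On the complement of its kernel \<open>D p\<close> is bounded below; this will
    control the part of \<open>y1 - y2\<close> orthogonal to \<open>T\<close>.\<close>
  then obtain c where c: "c > 0" "\<And>v. v \<in> ?C \<Longrightarrow> c * norm v \<le> norm (D p v)"
    using injective_imp_isometric[OF closed_subspace[OF subC] subC
        linear_conv_bounded_linear[THEN iffD1, OF linear_D[OF pU]]] by blast
  have norm_diff4: "norm (u - v - w - z) \<le> norm u + norm v + norm w + norm z" for u v w z :: "real^'n"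
    by norm
  \<comment> \<open>\<open>A\<close> collects the coefficients of \<open>norm h\<close> in the final
    sum, with the factor \<open>1 + K + \<eta>\<close> replaced by \<open>2 + K\<close> because
    \<open>\<eta> \<le> 1\<close>.\<close>
  define A where "A = 1 / c + (2 + K) + C + 1 + K / c"
  have A: "A \<ge> 0" using c K r0(2) by (simp add: A_def)
  define \<eta> where "\<eta> = min 1 (e / (A + 1))"
  have \<eta>: "\<eta> > 0" "\<eta> \<le> 1" "\<eta> * A \<le> e" "\<eta> \<le> e"
  proof -
    show "\<eta> > 0" "\<eta> \<le> 1" using e A by (auto simp: \<eta>_def)
    have "\<eta> \<le> e / (A + 1)" by (simp add: \<eta>_def)
    then have "\<eta> * A + \<eta> \<le> e" using A by (simp add: pos_le_divide_eq distrib_left)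
    moreover have "\<eta> * A \<ge> 0" using \<open>\<eta> > 0\<close> A by simp
    ultimately show "\<eta> * A \<le> e" "\<eta> \<le> e" using \<open>\<eta> > 0\<close> by linarith+
  qed
  obtain r1 where r1: "r1 > 0" "ball p r1 \<subseteq> W"
    "\<And>x y. x \<in> ball p r1 \<Longrightarrow> y \<in> ball p r1 \<Longrightarrow> norm (\<nu> x - \<nu> y - N (x - y)) \<le> \<eta> * norm (x - y)"
    by (rule smooth_on_strict_derivative[OF W(2,1) \<eta>(1), folded N_def]) (rule that)
  obtain r2 where r2: "r2 > 0" "ball p r2 \<subseteq> U"
    "\<And>x y. x \<in> ball p r2 \<Longrightarrow> y \<in> ball p r2 \<Longrightarrow> norm (F x - F y - D p (x - y)) \<le> \<eta> * norm (x - y)"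
    by (rule smooth_on_strict_derivative[OF smooth pU \<eta>(1)]) (rule that)
  \<comment> \<open>The last two bounds limit the variation of the tangent frame
    (\<open>C * r \<le> \<eta>\<close>) and the size of \<open>q2\<close>
    (\<open>(3 + K) * r \<le> \<eta>\<close>).\<close>
  define r where "r = min (min r0 (min r1 r2)) (min (\<eta> / (C + 1)) (\<eta> / (3 + K)))"
  have r: "r > 0" "r \<le> r0" "r \<le> r1" "r \<le> r2" using r0 r1 r2 \<eta> K by (auto simp: r_def)
  have Cr: "C * r \<le> \<eta>"
  proof -
    have "C * r \<le> (C + 1) * (\<eta> / (C + 1))"
      using r0(2) r(1) by (intro mult_mono) (auto simp: r_def)
    then show ?thesis using r0(2) by simp
  qed
  have Kr: "(3 + K) * r \<le> \<eta>"
  proof -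
    have "(3 + K) * r \<le> (3 + K) * (\<eta> / (3 + K))"
      using K by (intro mult_left_mono) (auto simp: r_def)
    then show ?thesis using K by simp
  qed
  show thesis
  proof (rule that[OF r(1)])
    fix x1 x2 y1 y2
    assume x: "x1 \<in> ball x0 r" "x2 \<in> ball x0 r" and y: "y1 \<in> M \<inter> ball p r" "y2 \<in> M \<inter> ball p r"
      and nrm: "x1 - y1 \<in> normal_space M y1" "x2 - y2 \<in> normal_space M y2"
    define h where "h = y1 - y2"
    define d where "d = x1 - x2"
    define q1 where "q1 = x1 - y1 - \<nu> y1"
    define q2 where "q2 = x2 - y2 - \<nu> y2"
    define s where "s = \<nu> y1 - \<nu> y2 - N h"
    have yU: "y1 \<in> U" "y2 \<in> U" and yW: "y1 \<in> W" "y2 \<in> W"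
      and y0: "y1 \<in> ball p r0" "y2 \<in> ball p r0" and y1: "y1 \<in> ball p r1" "y2 \<in> ball p r1"
      and y2: "y1 \<in> ball p r2" "y2 \<in> ball p r2"
      using y r r1(2) r2(2) by auto
    have pb: "p \<in> ball p r0" "p \<in> ball p r1" using r0 r1 by auto
    have s: "norm s \<le> \<eta> * norm h" unfolding s_def h_def by (rule r1(3)[OF y1])
    have F0: "F y1 = 0" "F y2 = 0" using y yU zero by auto
    \<comment> \<open>Both points solve \<open>F y = 0\<close>, so \<open>D p h\<close> is only the
      linearisation error: a short chord of M is tangent up to smaller order.\<close>
    have hP: "c * norm (h - ?P h) \<le> \<eta> * norm h"
    proof -
      have "?P h \<in> T" by (rule orth_proj(1)[OF subspace_T])
      then have eq: "D p (h - ?P h) = D p h" by (simp add: linear_diff[OF linear_D[OF pU]] T_def)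
      have le: "norm (D p h) \<le> \<eta> * norm h"
        using r2(3)[OF y2] by (simp add: F0 h_def)
      have "h - ?P h \<in> ?C" using orth_proj(2)[OF subspace_T] by blast
      from c(2)[OF this] le show ?thesis unfolding eq by linarith
    qed
    then have hP': "norm (h - ?P h) \<le> \<eta> / c * norm h" using c(1) by (simp add: field_simps)
    \<comment> \<open>The quantity \<open>x - y - \<nu> y\<close> is zero at \<open>(x0, p)\<close>
      by the choice of \<open>\<nu> p\<close>, hence small nearby.\<close>
    have q2: "norm q2 \<le> \<eta>"
    proof -
      have eq: "q2 = (x2 - x0) - (y2 - p) - (\<nu> y2 - \<nu> p - N (y2 - p)) - N (y2 - p)"
        by (simp add: q2_def \<nu>p)
      have "norm q2 \<le> norm (x2 - x0) + norm (y2 - p) + norm (\<nu> y2 - \<nu> p - N (y2 - p)) + norm (N (y2 - p))"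
        unfolding eq by (rule norm_diff4)
      also have "\<dots> \<le> r + r + r + K * r"
      proof (intro add_mono)
        show "norm (x2 - x0) \<le> r" "norm (y2 - p) \<le> r"
          using x y by (auto simp: dist_norm norm_minus_commute)
        then show "norm (N (y2 - p)) \<le> K * r"
          using K(2)[of "y2 - p"] mult_left_mono[OF _ K(1)] order_trans by blast
        have "norm (\<nu> y2 - \<nu> p - N (y2 - p)) \<le> \<eta> * norm (y2 - p)" by (rule r1(3)[OF y1(2) pb(2)])
        also have "\<dots> \<le> 1 * r" using \<eta> \<open>norm (y2 - p) \<le> r\<close> by (intro mult_mono) auto
        finally show "norm (\<nu> y2 - \<nu> p - N (y2 - p)) \<le> r" by simp
      qed
      also have "\<dots> = (3 + K) * r" by (simp add: algebra_simps)
      finally show ?thesis using Kr by linarith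
    qed
    have q12: "q1 - q2 = d - h - N h - s"
      by (simp add: q1_def q2_def d_def h_def s_def)
    have nq: "norm (q1 - q2) \<le> norm d + (1 + K + \<eta>) * norm h"
    proof -
      have "norm (q1 - q2) \<le> norm d + norm h + norm (N h) + norm s" unfolding q12 by (rule norm_diff4)
      then show ?thesis using s K(2)[of h] by (simp add: algebra_simps)
    qed
    have Pq: "norm (?P (q1 - q2)) \<le> \<eta> * norm d + \<eta> * (1 + K + \<eta>) * norm h + \<eta> * C * norm h"
    proof (rule norm_orth_proj_le[OF subspace_T])
      show "\<eta> * norm d + \<eta> * (1 + K + \<eta>) * norm h + \<eta> * C * norm h \<ge> 0"
        using \<eta> K r0(2) by simp
      fix w assume w: "w \<in> T"
      have tX: "X y1 w \<in> tangent_space M y1" "X y2 w \<in> tangent_space M y2"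
        using r0(4) y y0 w by auto
      have "q1 \<bullet> X y1 w = 0" "q2 \<bullet> X y2 w = 0"
        using nrm W(3)[of y1] W(3)[of y2] y yW tX
        by (auto simp: q1_def q2_def normal_space_def inner_diff_left)
      \<comment> \<open>The two orthogonality relations involve different tangent vectors. The
        regrouping leaves only products of two small factors or of a small factor with a difference,
        so no term of first order survives.\<close>
      then have "(q1 - q2) \<bullet> w = (q1 - q2) \<bullet> (w - X y1 w) - q2 \<bullet> (X y1 w - X y2 w)"
        by (simp add: inner_diff_left inner_diff_right)
      also have "\<bar>\<dots>\<bar> \<le> norm (q1 - q2) * norm (w - X y1 w) + norm q2 * norm (X y1 w - X y2 w)"
        using Cauchy_Schwarz_ineq2[of "q1 - q2" "w - X y1 w"] Cauchy_Schwarz_ineq2[of q2 "X y1 w - X y2 w"]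
        by linarith
      also have "\<dots> \<le> (norm d + (1 + K + \<eta>) * norm h) * (\<eta> * norm w) + \<eta> * (C * norm h * norm w)"
      proof (intro add_mono mult_mono nq q2)
        have "norm (w - X y1 w) \<le> C * norm (p - y1) * norm w"
          using r0(5)[OF pb(1) y0(1), of w] r0(6)[OF w] by simp
        also have "\<dots> \<le> C * r * norm w"
          using y r0(2) by (intro mult_right_mono mult_left_mono) (auto simp: dist_norm)
        also have "\<dots> \<le> \<eta> * norm w" using Cr by (rule mult_right_mono) simp
        finally show "norm (w - X y1 w) \<le> \<eta> * norm w" .
        show "norm (X y1 w - X y2 w) \<le> C * norm h * norm w"
          unfolding h_def by (rule r0(5)[OF y0])
      qed (use \<eta> K in auto)
      also have "\<dots> = (\<eta> * norm d + \<eta> * (1 + K + \<eta>) * norm h + \<eta> * C * norm h) * norm w"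
        by (simp add: algebra_simps)
      finally show "\<bar>(q1 - q2) \<bullet> w\<bar> \<le> (\<eta> * norm d + \<eta> * (1 + K + \<eta>) * norm h + \<eta> * C * norm h) * norm w" .
    qed
    have NP: "norm (?P (N (h - ?P h))) \<le> K * (\<eta> / c * norm h)"
    proof -
      have "norm (?P (N (h - ?P h))) \<le> norm (N (h - ?P h))" by (rule P_le)
      also have "\<dots> \<le> K * norm (h - ?P h)" by (rule K(2))
      also have "\<dots> \<le> K * (\<eta> / c * norm h)" using hP' K(1) by (rule mult_left_mono)
      finally show ?thesis .
    qed
    have eq: "h + ?P (N (?P h)) - ?P d = (h - ?P h) - ?P (q1 - q2) - ?P s - ?P (N (h - ?P h))"
      unfolding q12 by (simp add: linear_diff[OF linP] linear_diff[OF linN])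
    have "norm (h + ?P (N (?P h)) - ?P d)
        \<le> norm (h - ?P h) + norm (?P (q1 - q2)) + norm (?P s) + norm (?P (N (h - ?P h)))"
      unfolding eq by (rule norm_diff4)
    also have "\<dots> \<le> \<eta> / c * norm h + (\<eta> * norm d + \<eta> * (1 + K + \<eta>) * norm h + \<eta> * C * norm h)
        + \<eta> * norm h + K * (\<eta> / c * norm h)"
      using hP' Pq order_trans[OF P_le s] NP by (intro add_mono)
    also have "\<dots> = \<eta> * norm d + \<eta> * (1 / c + (1 + K + \<eta>) + C + 1 + K / c) * norm h"
      by (simp add: algebra_simps)
    also have "\<dots> \<le> \<eta> * norm d + \<eta> * A * norm h"
      using \<eta> by (intro add_left_mono mult_right_mono mult_left_mono) (auto simp: A_def)
    also have "\<dots> \<le> e * norm d + e * norm h"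
      using \<eta> by (intro add_mono mult_right_mono) auto
    finally show "norm (y1 - y2 + ?P (N (?P (y1 - y2))) - ?P (x1 - x2)) \<le> e * (norm (x1 - x2) + norm (y1 - y2))"
      by (simp add: h_def d_def distrib_left)
  qed
qed

end

section \<open>Nearest points and their first-order expansion\<close>

lemma nearest_exists:
  assumes "compact M" "M \<noteq> {}"
  obtains y where "is_nearest M x y"
proof -
  have "continuous_on M (\<lambda>y. norm (y - x))" by (intro continuous_intros)
  then obtain y where "y \<in> M" "\<And>z. z \<in> M \<Longrightarrow> norm (y - x) \<le> norm (z - x)"
    using continuous_attains_inf[OF assms] by metis
  then show thesis using that unfolding is_nearest_def by blast
qed

lemma nearest_point_eq:
  assumes "is_nearest M x y" "\<And>z. is_nearest M x z \<Longrightarrow> z = y"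
  shows "nearest_point M x = y"
  unfolding nearest_point_def using assms by (rule the_equality)

lemma nearest_normal:
  assumes "is_nearest M x y"
  shows "x - y \<in> normal_space M y"
  unfolding normal_space_def
proof safe
  fix w assume "w \<in> tangent_space M y"
  then obtain \<gamma> where \<gamma>: "curve_in M y \<gamma>" "(\<gamma> has_vector_derivative w) (at 0)"
    unfolding tangent_space_def by blast
  then obtain e where e: "e > 0" "\<And>s. \<bar>s\<bar> < e \<Longrightarrow> \<gamma> s \<in> M" and \<gamma>0: "\<gamma> 0 = y"
    unfolding curve_in_def by blast
  have "((\<lambda>s. (norm (\<gamma> s - x))\<^sup>2) has_real_derivative 2 * ((y - x) \<bullet> w)) (at 0)"
    using \<gamma>(2) unfolding power2_norm_eq_inner has_field_derivative_def has_vector_derivative_def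
    by (auto intro!: derivative_eq_intros simp: inner_commute fun_eq_iff algebra_simps \<gamma>0)
  moreover have "\<forall>s. \<bar>0 - s\<bar> < e \<longrightarrow> (norm (\<gamma> 0 - x))\<^sup>2 \<le> (norm (\<gamma> s - x))\<^sup>2"
    using e assms unfolding is_nearest_def \<gamma>0 by (auto intro!: power_mono)
  ultimately have "2 * ((y - x) \<bullet> w) = 0"
    using e(1) by (intro DERIV_local_min)
  then show "(x - y) \<bullet> w = 0" by (simp add: inner_diff_left)
qed

text \<open>Off the ball around \<open>\<mu>\<close> the distance to \<open>t\<close> exceeds its
  minimum by a fixed gap, by compactness. Moving \<open>t\<close> to \<open>x\<close> changes every
  distance by at most \<open>norm (x - t)\<close>, so a small move cannot bridge the gap.\<close>

lemma nearest_points_close: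
  fixes M :: "'a::euclidean_space set"
  assumes M: "compact M" and near: "is_nearest M t \<mu>" and uniq: "\<And>y. is_nearest M t y \<Longrightarrow> y = \<mu>" and e: "e > 0"
  obtains \<delta> where "\<delta> > 0" "\<And>x y. x \<in> ball t \<delta> \<Longrightarrow> is_nearest M x y \<Longrightarrow> y \<in> ball \<mu> e"
proof (cases "M - ball \<mu> e = {}")
  case True
  then show thesis by (intro that[of 1]) (auto simp: is_nearest_def)
next
  case False
  have "compact (M - ball \<mu> e)" using M by (intro compact_diff) auto
  moreover have "continuous_on (M - ball \<mu> e) (\<lambda>y. norm (y - t))" by (intro continuous_intros)
  ultimately obtain z where z: "z \<in> M - ball \<mu> e" "\<And>y. y \<in> M - ball \<mu> e \<Longrightarrow> norm (z - t) \<le> norm (y - t)"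
    using continuous_attains_inf[of "M - ball \<mu> e"] False by metis
  have "\<not> is_nearest M t z" using uniq z(1) e by auto
  then obtain u where "u \<in> M" "norm (u - t) < norm (z - t)"
    using z(1) unfolding is_nearest_def by auto
  then have gap: "norm (\<mu> - t) < norm (z - t)"
    using near unfolding is_nearest_def by (meson le_less_trans)
  \<comment> \<open>Half the gap, since the move enters twice: in the distance to \<open>y\<close>
    and in the distance to \<open>\<mu>\<close>.\<close>
  define \<delta> where "\<delta> = (norm (z - t) - norm (\<mu> - t)) / 2"
  show thesis
  proof (rule that[of \<delta>])
    show "\<delta> > 0" using gap by (simp add: \<delta>_def)
    fix x y assume x: "x \<in> ball t \<delta>" and y: "is_nearest M x y"
    have xt: "norm (x - t) < \<delta>" using x by (simp add: dist_norm norm_minus_commute)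
    show "y \<in> ball \<mu> e"
    proof (rule ccontr)
      assume "y \<notin> ball \<mu> e"
      then have "norm (z - t) \<le> norm (y - t)" using z(2) y unfolding is_nearest_def by blast
      moreover have "norm (y - t) \<le> norm (y - x) + norm (x - t)" by norm
      moreover have "norm (y - x) \<le> norm (\<mu> - x)" using y near unfolding is_nearest_def by blast
      moreover have "norm (\<mu> - x) \<le> norm (\<mu> - t) + norm (x - t)" by norm
      ultimately show False using xt by (simp add: \<delta>_def)
    qed
  qed
qed

text \<open>All the geometry that the probabilistic part uses. The last two conclusions are a
  Lipschitz bound at \<open>t\<close> and differentiability of the nearest-point map there, in the
  implicit form before inverting \<open>G\<close>.\<close>

lemma nearest_point_expansion:
  fixes M :: "(real^'n) set"
  assumes M: "smooth_submanifold M m" "compact M" "M \<noteq> {}" and t: "t \<notin> cutlocus M"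
  defines "\<mu> \<equiv> nearest_point M t"
  defines "T \<equiv> tangent_space M \<mu>"
  obtains N K where "subspace T" "dim T = m" "linear N"
    "\<And>u w. u \<in> T \<Longrightarrow> w \<in> T \<Longrightarrow> N u \<bullet> w = u \<bullet> N w"
    "\<And>w. weingarten M \<mu> (t - \<mu>) w = - orth_proj T (N w)" "m \<le> CARD('n)"
    "K \<ge> 0" "\<exists>\<delta>>0. \<forall>x\<in>ball t \<delta>. norm (nearest_point M x - \<mu>) \<le> K * norm (x - t)"
    "\<And>e. e > 0 \<Longrightarrow> \<exists>\<delta>>0. \<forall>x\<in>ball t \<delta>.
       norm (nearest_point M x - \<mu> + orth_proj T (N (orth_proj T (nearest_point M x - \<mu>))) - orth_proj T (x - t))
         \<le> e * norm (x - t)"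
proof -
  obtain y0 where "is_nearest M t y0" using nearest_exists[OF M(2,3)] by blast
  moreover have uniq0: "z = y" if "is_nearest M t y" "is_nearest M t z" for y z
    using t that unfolding cutlocus_def by blast
  ultimately have near: "is_nearest M t \<mu>" and uniq: "\<And>y. is_nearest M t y \<Longrightarrow> y = \<mu>"
    unfolding \<mu>_def using nearest_point_eq[of M t y0] by blast+
  have nondeg: "\<not> degenerate_hessian M (\<lambda>y. norm (y - t) ^ 2) \<mu>"
    using t near unfolding cutlocus_def by blast
  have \<mu>M: "\<mu> \<in> M" using near by (simp add: is_nearest_def)
  obtain U and F :: "real^'n \<Rightarrow> real^'n" where UF: "\<mu> \<in> U" "smooth_on U F" "M \<inter> U = {x\<in>U. F x = 0}"
    "\<forall>x\<in>U. dim (range (frechet_derivative F (at x))) = DIM(real^'n) - m" and mle: "m \<le> CARD('n)"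
    using M(1) \<mu>M unfolding smooth_submanifold_def by auto
  interpret L: local_equation M m \<mu> U F
    using UF mle \<mu>M by unfold_locales auto
  have T_eq: "T = L.T" unfolding T_def by (rule L.tangent_space_eq)
  \<comment> \<open>The same \<open>SOME\<close> term as in \<open>weingarten\<close>, so that
    \<open>N\<close> is the very derivative occurring there.\<close>
  define \<nu> where "\<nu> = (SOME \<nu>. normal_field M \<mu> (t - \<mu>) \<nu>)"
  have "\<exists>\<nu>. normal_field M \<mu> (t - \<mu>) \<nu>"
    using L.symmetric_normal_field_exists[OF nearest_normal[OF near]] by metis
  then have \<nu>: "normal_field M \<mu> (t - \<mu>) \<nu>" unfolding \<nu>_def by (rule someI_ex)
  define N where "N = frechet_derivative \<nu> (at \<mu>)"
  have linN: "linear N"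
    unfolding N_def using L.normal_field_derivative[OF \<nu>] has_derivative_linear by blast
  have T: "subspace T" unfolding T_eq by (rule L.subspace_T)
  let ?P = "orth_proj T"
  note linP = linear_orth_proj[OF T]
  let ?G = "\<lambda>h. h + ?P (N (?P h))"
  have linG: "linear ?G"
    by (intro linear_compose_add linear_id[unfolded id_def] linear_compose[OF linear_compose[OF linP linN] linP, unfolded o_def])
  have "\<forall>h\<in>UNIV. ?G h = 0 \<longrightarrow> h = 0"
    using L.nondegenerate_imp_injective[OF \<nu> nondeg] unfolding T_eq N_def by blast
  then obtain c where c: "c > 0" "\<And>h. c * norm h \<le> norm (?G h)"
    using injective_imp_isometric[OF closed_UNIV subspace_UNIV linear_conv_bounded_linear[THEN iffD1, OF linG]] by blast
  have close: "\<exists>\<delta>>0. (\<forall>x\<in>ball t \<delta>. norm (?G (nearest_point M x - \<mu>) - ?P (x - t))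
        \<le> e * (norm (x - t) + norm (nearest_point M x - \<mu>)))" if e: "e > 0" "e \<le> c / 2" for e
  proof -
    obtain r where r: "r > 0"
      "\<And>x1 x2 y1 y2. x1 \<in> ball t r \<Longrightarrow> x2 \<in> ball t r \<Longrightarrow> y1 \<in> M \<inter> ball \<mu> r \<Longrightarrow> y2 \<in> M \<inter> ball \<mu> r \<Longrightarrow>
       x1 - y1 \<in> normal_space M y1 \<Longrightarrow> x2 - y2 \<in> normal_space M y2 \<Longrightarrow>
       norm (?G (y1 - y2) - ?P (x1 - x2)) \<le> e * (norm (x1 - x2) + norm (y1 - y2))"
      by (rule L.strict_estimate[OF \<nu> e(1), folded N_def T_eq]) (rule that)
    obtain \<delta> where \<delta>: "\<delta> > 0" "\<And>x y. x \<in> ball t \<delta> \<Longrightarrow> is_nearest M x y \<Longrightarrow> y \<in> ball \<mu> r"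
      by (rule nearest_points_close[OF M(2) near _ r(1)]) (rule uniq, assumption, rule that)
    have "norm (?G (nearest_point M x - \<mu>) - ?P (x - t)) \<le> e * (norm (x - t) + norm (nearest_point M x - \<mu>))"
      if x: "x \<in> ball t (min \<delta> r)" for x
    proof -
      obtain y where y: "is_nearest M x y" using nearest_exists[OF M(2,3)] by blast
      have est: "norm (?G (y1 - y2) - ?P (x1 - x2)) \<le> e * (norm (x1 - x2) + norm (y1 - y2))"
        if "x1 \<in> ball t (min \<delta> r)" "x2 \<in> ball t (min \<delta> r)" "is_nearest M x1 y1" "is_nearest M x2 y2" for x1 x2 y1 y2
        using that \<delta>(2)[of x1 y1] \<delta>(2)[of x2 y2] nearest_normal
        by (intro r(2)) (auto simp: is_nearest_def)
      \<comment> \<open>With equal base points the estimate reads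
        \<open>c * norm (z - y) \<le> e * norm (z - y)\<close>, and \<open>e \<le> c / 2\<close>
        forces equality.\<close>
      have "z = y" if z: "is_nearest M x z" for z
      proof -
        have "c * norm (z - y) \<le> norm (?G (z - y))" by (rule c(2))
        also have "\<dots> \<le> e * norm (z - y)"
          using est[OF x x z y] by (simp add: linear_0[OF linP])
        also have "\<dots> \<le> c / 2 * norm (z - y)" using e(2) by (rule mult_right_mono) simp
        finally show ?thesis using c(1) by (simp add: mult_le_0_iff)
      qed
      then have "nearest_point M x = y" by (rule nearest_point_eq[OF y])
      then show ?thesis using est[OF x _ y near] \<delta>(1) r(1) by simp
    qed
    then show ?thesis using \<delta>(1) r(1) by (intro exI[of _ "min \<delta> r"]) auto
  qed
  \<comment> \<open>For \<open>e \<le> c / 2\<close> the term in the displacement is absorbed on the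
    left, leaving \<open>c / 2\<close> times its norm at most \<open>1 + c / 2\<close> times
    \<open>norm (x - t)\<close>.\<close>
  define K where "K = (1 + c / 2) / (c / 2)"
  have K: "K \<ge> 0" using c(1) by (simp add: K_def)
  have bound: "norm (nearest_point M x - \<mu>) \<le> K * norm (x - t)"
    if e: "e > 0" "e \<le> c / 2" and est: "norm (?G (nearest_point M x - \<mu>) - ?P (x - t))
        \<le> e * (norm (x - t) + norm (nearest_point M x - \<mu>))" for e x
  proof -
    let ?h = "nearest_point M x - \<mu>"
    have "c * norm ?h \<le> norm (?G ?h)" by (rule c(2))
    also have "\<dots> \<le> norm (?G ?h - ?P (x - t)) + norm (?P (x - t))" by norm
    also have "\<dots> \<le> e * (norm (x - t) + norm ?h) + norm (x - t)"
      using est norm_orth_proj_le_norm[OF T] by (rule add_mono)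
    also have "\<dots> \<le> c / 2 * (norm (x - t) + norm ?h) + norm (x - t)"
      using e by (intro add_right_mono mult_right_mono) auto
    finally have "c / 2 * norm ?h \<le> (1 + c / 2) * norm (x - t)" by (simp add: algebra_simps)
    then show ?thesis using c(1) by (simp add: K_def field_simps)
  qed
  show thesis
  proof (rule that[of N K])
    show "dim T = m" using L.dim_kernel[OF L.pU] by (simp add: T_eq L.T_def)
    show "N u \<bullet> w = u \<bullet> N w" if "u \<in> T" "w \<in> T" for u w
      unfolding N_def using that L.normal_field_derivative_symmetric[OF \<nu>] by (simp add: T_eq)
    show "weingarten M \<mu> (t - \<mu>) w = - orth_proj T (N w)" for w
    proof -
      have "tan_mat M \<mu> *v v = ?P v" for v
        unfolding tan_mat_def T_def[symmetric]
        by (rule matrix_works) (simp add: linear_matrix_vector_mul_eq linP)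
      then show ?thesis unfolding weingarten_def Let_def \<nu>_def[symmetric] N_def by simp
    qed
    show "\<exists>\<delta>>0. \<forall>x\<in>ball t \<delta>. norm (nearest_point M x - \<mu>) \<le> K * norm (x - t)"
      using close[of "c / 2"] bound[of "c / 2"] c(1) by (metis half_gt_zero order_refl)
    show "\<exists>\<delta>>0. \<forall>x\<in>ball t \<delta>. norm (?G (nearest_point M x - \<mu>) - ?P (x - t)) \<le> e * norm (x - t)" if "e > 0" for e
    proof -
      \<comment> \<open>The first bound permits absorption; the second pays for replacing the
        displacement by \<open>K * norm (x - t)\<close>.\<close>
      define e' where "e' = min (c / 2) (e / (1 + K))"
      have e': "e' > 0" "e' \<le> c / 2" "e' * (1 + K) \<le> e"
      proof -
        show "e' > 0" using that c(1) K by (simp add: e'_def)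
        show "e' \<le> c / 2" unfolding e'_def by (rule min.cobounded1)
        have "e' * (1 + K) \<le> e / (1 + K) * (1 + K)" using K by (intro mult_right_mono) (auto simp: e'_def)
        then show "e' * (1 + K) \<le> e" using K by simp
      qed
      obtain \<delta> where \<delta>: "\<delta> > 0" "\<And>x. x \<in> ball t \<delta> \<Longrightarrow> norm (?G (nearest_point M x - \<mu>) - ?P (x - t))
        \<le> e' * (norm (x - t) + norm (nearest_point M x - \<mu>))"
        using close[OF e'(1,2)] by blast
      have "norm (?G (nearest_point M x - \<mu>) - ?P (x - t)) \<le> e * norm (x - t)" if x: "x \<in> ball t \<delta>" for x
      proof -
        have "norm (?G (nearest_point M x - \<mu>) - ?P (x - t)) \<le> e' * (norm (x - t) + norm (nearest_point M x - \<mu>))"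
          by (rule \<delta>(2)[OF x])
        also have "\<dots> \<le> e' * (norm (x - t) + K * norm (x - t))"
          using bound[OF e'(1,2) \<delta>(2)[OF x]] e'(1) by (intro mult_left_mono add_left_mono) auto
        also have "\<dots> = e' * (1 + K) * norm (x - t)" by (simp add: algebra_simps)
        also have "\<dots> \<le> e * norm (x - t)" using e'(3) by (rule mult_right_mono) simp
        finally show ?thesis .
      qed
      then show ?thesis using \<delta>(1) by blast
    qed
  qed (use T linN mle K in auto)
qed

section \<open>Asymptotics of the nearest point\<close>

lemma measurable_matrix_vector_mul:
  fixes A :: "real^'n^'m"
  assumes "X \<in> borel_measurable P"
  shows "(\<lambda>\<omega>. A *v X \<omega>) \<in> borel_measurable P"
proof -
  have "(*v) A \<in> borel_measurable borel"
    by (intro borel_measurable_continuous_onI linear_continuous_on matrix_vector_mul_bounded_linear)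
  then show ?thesis using assms by measurable
qed

text \<open>Tightness of \<open>Zn\<close> and growth of \<open>a\<close> confine
  \<open>tt n\<close> to a ball around \<open>t\<close> shrinking like \<open>1 / a n\<close>,
  outside events of small probability. On the remaining event the deterministic expansion holds
  pointwise, and its error stays small after multiplication by \<open>a n\<close>.\<close>

theorem theorem2p3:
  fixes M :: "(real, 's::{finite,linorder}) vec set" and m :: nat
    and t :: "(real, 's) vec" and P :: "'w measure" and tt :: "nat \<Rightarrow> 'w \<Rightarrow> (real, 's) vec"
    and a :: "nat \<Rightarrow> real" and V :: "((real, 's) vec, 's) vec"
    and Q :: "'v measure" and Z :: "'v \<Rightarrow> (real, 's) vec"
  defines "\<mu> \<equiv> nearest_point M t"
    and "G \<equiv> mat 1 - matrix (weingarten M (nearest_point M t) (t - nearest_point M t))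
                 ** tan_mat M (nearest_point M t)"
    and "W \<equiv> nor_mat M (nearest_point M t)
             + tan_mat M (nearest_point M t) ** V ** tan_mat M (nearest_point M t)"
    and "Zn \<equiv> (\<lambda>n \<omega>. a n *\<^sub>R (matrix_inv (msqrt V) *v (tt n \<omega> - t)))"
    and "mu_t \<equiv> (\<lambda>n \<omega>. nearest_point M (tt n \<omega>))"
  assumes M: "smooth_submanifold M m" "compact M" "M \<noteq> {}"
    and t: "t \<notin> cutlocus M"
    and P: "prob_space P" and tt_meas: "\<And>n. tt n \<in> borel_measurable P"
    and mu_meas: "\<And>n. mu_t n \<in> borel_measurable P"
    and a: "\<And>n. a n > 0" "filterlim a at_top sequentially"
    and V: "pos_def V"
    and Q: "prob_space Q" and Z_meas: "Z \<in> borel_measurable Q"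
    and conv: "conv_distr P Zn Q Z"
  shows "conv_prob_zero P (\<lambda>n \<omega>. mu_t n \<omega> - \<mu>)
         \<and> (spherical Q Z \<longrightarrow>
           conv_prob_zero P (\<lambda>n \<omega>. a n *\<^sub>R (matrix_inv (msqrt W) *v (G *v (mu_t n \<omega> - \<mu>)))
              - ((matrix_inv (msqrt W) ** tan_mat M \<mu> ** msqrt V) *v Zn n \<omega>))
         \<and> conv_distr P (\<lambda>n \<omega>. a n *\<^sub>R (matrix_inv (msqrt W) *v (G *v (mu_t n \<omega> - \<mu>))))
              Q (\<lambda>\<omega>. tan_mat M \<mu> *v Z \<omega>)
         \<and> conv_distr P (\<lambda>n \<omega>. (a n) ^ 2 * ((mu_t n \<omega> - \<mu>) \<bullet> ((G ** matrix_inv W ** G) *v (mu_t n \<omega> - \<mu>))))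
              Q (\<lambda>\<omega>. \<Sum>i\<in>first_coords m. (Z \<omega> $ i) ^ 2))"
proof -
  interpret prob_space P by fact
  obtain N K where T: "subspace (tangent_space M \<mu>)" and dimT: "dim (tangent_space M \<mu>) = m" and linN: "linear N"
    and symN: "\<And>u w. u \<in> tangent_space M \<mu> \<Longrightarrow> w \<in> tangent_space M \<mu> \<Longrightarrow> N u \<bullet> w = u \<bullet> N w"
    and wein: "\<And>w. weingarten M \<mu> (t - \<mu>) w = - orth_proj (tangent_space M \<mu>) (N w)"
    and m: "m \<le> CARD('s)" and K: "K \<ge> 0"
    and near_bound: "\<exists>\<delta>>0. \<forall>x\<in>ball t \<delta>. norm (nearest_point M x - \<mu>) \<le> K * norm (x - t)"
    and near_exp: "\<And>e. e > 0 \<Longrightarrow> \<exists>\<delta>>0. \<forall>x\<in>ball t \<delta>.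
       norm (nearest_point M x - \<mu> + orth_proj (tangent_space M \<mu>) (N (orth_proj (tangent_space M \<mu>) (nearest_point M x - \<mu>)))
         - orth_proj (tangent_space M \<mu>) (x - t)) \<le> e * norm (x - t)"
    by (rule nearest_point_expansion[OF M t, folded \<mu>_def]) (rule that)
  let ?P = "orth_proj (tangent_space M \<mu>)"
  note linP = linear_orth_proj[OF T]
  define Pm where "Pm = tan_mat M \<mu>"
  have Pv: "Pm *v x = ?P x" for x
    unfolding Pm_def tan_mat_def by (rule matrix_works) (simp add: linear_matrix_vector_mul_eq linP)
  have P_idem: "?P (?P x) = ?P x" for x
    by (rule orth_proj_id[OF T orth_proj(1)[OF T]])
  have Psym: "transpose Pm = Pm"
    unfolding matrix_eq
  proof
    fix x
    have "(transpose Pm *v x) \<bullet> y = (Pm *v x) \<bullet> y" for y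
      by (simp only: inner_transpose Pv orth_proj_inner[OF T])
    then show "transpose Pm *v x = Pm *v x" using vector_eq_rdot by blast
  qed
  have Pidem: "Pm ** Pm = Pm"
    by (simp add: matrix_eq matrix_vector_mul_assoc[symmetric] Pv P_idem)
  \<comment> \<open>The minus sign in the Weingarten map cancels the one in
    \<open>G\<close>.\<close>
  have Gv: "G *v x = x + ?P (N (?P x))" for x
  proof -
    have "linear (\<lambda>w. - ?P (N w))"
      by (intro linear_compose_neg linear_compose[OF linN linP, unfolded o_def])
    then have "matrix (weingarten M \<mu> (t - \<mu>)) *v w = - ?P (N w)" for w
      using wein matrix_works[of "weingarten M \<mu> (t - \<mu>)" w]
      by (simp add: linear_matrix_vector_mul_eq wein[abs_def])
    then show ?thesis
      unfolding G_def \<mu>_def[symmetric] Pm_def[symmetric]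
      by (simp add: matrix_vector_mult_diff_rdistrib matrix_vector_mul_assoc[symmetric] Pv)
  qed
  have G_inner: "(G *v x) \<bullet> y = x \<bullet> (G *v y)" for x y
  proof -
    have "?P (N (?P x)) \<bullet> y = x \<bullet> ?P (N (?P y))"
      using symN[OF orth_proj(1)[OF T] orth_proj(1)[OF T], of x y]
      by (simp add: orth_proj_inner[OF T])
    then show ?thesis by (simp add: Gv inner_add_left inner_add_right)
  qed
  have W: "W = mat 1 - Pm + Pm ** V ** Pm"
    by (simp add: W_def nor_mat_def Pm_def \<mu>_def)
  define S where "S = matrix_inv (msqrt W)"
  define B where "B = S ** Pm ** msqrt V"
  have BB: "B ** transpose B = Pm" and WS: "matrix_inv W = S ** S" and Ssym: "transpose S = S"
    using compress_whitening[OF Psym Pidem V] unfolding B_def S_def W by auto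
  define L where "L = onorm ((*v) (msqrt V))"
  define s where "s = onorm ((*v) S)"
  have L: "L \<ge> 0" "norm (msqrt V *v x) \<le> L * norm x" for x
    unfolding L_def by (intro onorm_pos_le onorm matrix_vector_mul_bounded_linear)+
  have s: "s \<ge> 0" "norm (S *v x) \<le> s * norm x" for x
    unfolding s_def by (intro onorm_pos_le onorm matrix_vector_mul_bounded_linear)+
  have sqrtV: "msqrt V ** matrix_inv (msqrt V) = mat 1"
    using matrix_inv_mult(1)[OF pos_def_invertible[OF msqrt_pos_def(1)[OF V]]] .
  have VZ: "msqrt V *v Zn n \<omega> = a n *\<^sub>R (tt n \<omega> - t)" for n \<omega>
    unfolding Zn_def by (simp add: matrix_vector_mult_scaleR matrix_vector_mul_assoc sqrtV)
  have dist_le: "a n * norm (tt n \<omega> - t) \<le> L * norm (Zn n \<omega>)" for n \<omega>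
    using L(2)[of "Zn n \<omega>"] a(1)[of n] unfolding VZ by simp
  have Zn_meas: "Zn n \<in> borel_measurable P" for n
    unfolding Zn_def using tt_meas
    by (intro borel_measurable_scaleR measurable_matrix_vector_mul borel_measurable_diff) auto
  have tight: "\<exists>R A. R > 0 \<and> (\<forall>\<^sub>F n in sequentially. A n \<in> sets P \<and> measure P (A n) < \<eta> \<and>
      (\<forall>\<omega>\<in>space P. \<omega> \<notin> A n \<longrightarrow> norm (Zn n \<omega>) \<le> R))" if \<eta>: "\<eta> > 0" for \<eta>
  proof -
    obtain R where R: "R > 0" "\<forall>\<^sub>F n in sequentially. measure P {\<omega>\<in>space P. norm (Zn n \<omega>) > R} < \<eta>"
      by (rule conv_distr_tight[OF P Zn_meas Q Z_meas conv \<eta>]) (rule that)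
    have "{\<omega>\<in>space P. norm (Zn n \<omega>) > R} \<in> sets P" for n
      using Zn_meas[of n] by measurable
    with R show ?thesis
      by (intro exI[of _ R] exI[of _ "\<lambda>n. {\<omega>\<in>space P. norm (Zn n \<omega>) > R}"])
        (auto elim!: eventually_mono)
  qed
  have a_large: "\<forall>\<^sub>F n in sequentially. C / a n < d" if "d > 0" for C d
  proof -
    have "((\<lambda>n. C / a n) \<longlongrightarrow> 0) sequentially"
      by (rule tendsto_divide_0[OF tendsto_const filterlim_at_top_imp_at_infinity[OF a(2)]])
    then show ?thesis using that by (rule order_tendstoD(2))
  qed
  have tt_le: "norm (tt n \<omega> - t) \<le> L * R / a n" if "norm (Zn n \<omega>) \<le> R" for n \<omega> R
  proof -
    have "a n * norm (tt n \<omega> - t) \<le> L * R"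
      using dist_le[of n \<omega>] mult_left_mono[OF that L(1)] by linarith
    then show ?thesis using a(1)[of n] by (simp add: pos_le_divide_eq mult.commute)
  qed
  have part1: "conv_prob_zero P (\<lambda>n \<omega>. mu_t n \<omega> - \<mu>)"
  proof (rule conv_prob_zeroI[OF P])
    show "(\<lambda>\<omega>. mu_t n \<omega> - \<mu>) \<in> borel_measurable P" for n using mu_meas[of n] by measurable
    fix e \<eta> :: real assume e: "e > 0" and "\<eta> > 0"
    then obtain R A where R: "R > 0" and A: "\<forall>\<^sub>F n in sequentially. A n \<in> sets P \<and> measure P (A n) < \<eta> \<and>
      (\<forall>\<omega>\<in>space P. \<omega> \<notin> A n \<longrightarrow> norm (Zn n \<omega>) \<le> R)" using tight by blast
    obtain \<delta> where \<delta>: "\<delta> > 0" "\<And>x. x \<in> ball t \<delta> \<Longrightarrow> norm (nearest_point M x - \<mu>) \<le> K * norm (x - t)"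
      using near_bound by blast
    have "\<forall>\<^sub>F n in sequentially. A n \<in> sets P \<and> measure P (A n) < \<eta>
        \<and> (\<forall>\<omega>\<in>space P. norm (mu_t n \<omega> - \<mu>) > e \<longrightarrow> \<omega> \<in> A n)"
      using A a_large[OF \<delta>(1), of "L * R"] a_large[OF e, of "K * (L * R)"]
    proof eventually_elim
      case (elim n)
      have "norm (mu_t n \<omega> - \<mu>) \<le> e" if "\<omega> \<in> space P" "\<omega> \<notin> A n" for \<omega>
      proof -
        have le: "norm (tt n \<omega> - t) \<le> L * R / a n" using elim that by (intro tt_le) blast
        then have "tt n \<omega> \<in> ball t \<delta>" using elim by (simp add: dist_norm norm_minus_commute)
        then have "norm (mu_t n \<omega> - \<mu>) \<le> K * norm (tt n \<omega> - t)" unfolding mu_t_def by (rule \<delta>(2))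
        also have "\<dots> \<le> K * (L * R / a n)" using le K by (rule mult_left_mono)
        finally show ?thesis using elim by simp
      qed
      then show ?case using elim by fastforce
    qed
    then show "\<exists>A. \<forall>\<^sub>F n in sequentially. A n \<in> sets P \<and> measure P (A n) < \<eta>
        \<and> (\<forall>\<omega>\<in>space P. norm (mu_t n \<omega> - \<mu>) > e \<longrightarrow> \<omega> \<in> A n)" by blast
  qed
  define Y where "Y = (\<lambda>n \<omega>. a n *\<^sub>R (S *v (G *v (mu_t n \<omega> - \<mu>))))"
  have Y_meas: "Y n \<in> borel_measurable P" for n
    unfolding Y_def using mu_meas[of n]
    by (intro borel_measurable_scaleR measurable_matrix_vector_mul borel_measurable_diff) auto
  have BZ_meas: "(\<lambda>\<omega>. B *v Zn n \<omega>) \<in> borel_measurable P" for n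
    by (rule measurable_matrix_vector_mul[OF Zn_meas])
  have part2: "conv_prob_zero P (\<lambda>n \<omega>. Y n \<omega> - B *v Zn n \<omega>)"
  proof (rule conv_prob_zeroI[OF P])
    show "(\<lambda>\<omega>. Y n \<omega> - B *v Zn n \<omega>) \<in> borel_measurable P" for n
      by (intro borel_measurable_diff Y_meas BZ_meas)
    fix e \<eta> :: real assume e: "e > 0" and "\<eta> > 0"
    then obtain R A where R: "R > 0" and A: "\<forall>\<^sub>F n in sequentially. A n \<in> sets P \<and> measure P (A n) < \<eta> \<and>
      (\<forall>\<omega>\<in>space P. \<omega> \<notin> A n \<longrightarrow> norm (Zn n \<omega>) \<le> R)" using tight by blast
    \<comment> \<open>The scaled error will be at most \<open>e' * (s * (L * R))\<close>; adding 1
      in the denominator covers a vanishing product.\<close>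
    define e' where "e' = e / (s * (L * R) + 1)"
    have sLR: "s * (L * R) \<ge> 0" using s(1) L(1) R by simp
    have e': "e' > 0" using e sLR by (simp add: e'_def)
    have e'_le: "e' * (s * (L * R)) \<le> e"
    proof -
      have "e' * (s * (L * R)) \<le> e' * (s * (L * R) + 1)" using e' by simp
      also have "\<dots> = e" using sLR unfolding e'_def by (intro nonzero_eq_divide_eq[THEN iffD1]) auto
      finally show ?thesis .
    qed
    obtain \<delta> where \<delta>: "\<delta> > 0" "\<And>x. x \<in> ball t \<delta> \<Longrightarrow>
       norm (nearest_point M x - \<mu> + ?P (N (?P (nearest_point M x - \<mu>))) - ?P (x - t)) \<le> e' * norm (x - t)"
      using near_exp[OF e'] by blast
    have "\<forall>\<^sub>F n in sequentially. A n \<in> sets P \<and> measure P (A n) < \<eta>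
        \<and> (\<forall>\<omega>\<in>space P. norm (Y n \<omega> - B *v Zn n \<omega>) > e \<longrightarrow> \<omega> \<in> A n)"
      using A a_large[OF \<delta>(1), of "L * R"]
    proof eventually_elim
      case (elim n)
      have "norm (Y n \<omega> - B *v Zn n \<omega>) \<le> e" if "\<omega> \<in> space P" "\<omega> \<notin> A n" for \<omega>
      proof -
        have ZR: "norm (Zn n \<omega>) \<le> R" using elim that by blast
        let ?r = "G *v (mu_t n \<omega> - \<mu>) - ?P (tt n \<omega> - t)"
        have "tt n \<omega> \<in> ball t \<delta>" using elim tt_le[OF ZR] by (simp add: dist_norm norm_minus_commute)
        then have r: "norm ?r \<le> e' * norm (tt n \<omega> - t)" unfolding Gv mu_t_def by (rule \<delta>(2))
        \<comment> \<open>The root of V in \<open>B\<close> undoes the normalisation in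
          \<open>Zn\<close>, so both sides of the difference are images under \<open>S\<close> of
          vectors scaled by \<open>a n\<close>.\<close>
        have "B *v Zn n \<omega> = a n *\<^sub>R (S *v ?P (tt n \<omega> - t))"
          unfolding B_def
          by (simp add: matrix_vector_mul_assoc[symmetric] VZ Pv linear_scale[OF linP] matrix_vector_mult_scaleR)
        then have "Y n \<omega> - B *v Zn n \<omega> = a n *\<^sub>R (S *v ?r)"
          by (simp add: Y_def matrix_vector_mult_diff_distrib scaleR_diff_right)
        then have "norm (Y n \<omega> - B *v Zn n \<omega>) = a n * norm (S *v ?r)" using a(1)[of n] by simp
        also have "\<dots> \<le> a n * (s * (e' * norm (tt n \<omega> - t)))"
          using order_trans[OF s(2)[of ?r] mult_left_mono[OF r s(1)]] a(1)[of n] by (intro mult_left_mono) auto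
        also have "\<dots> = e' * (s * (a n * norm (tt n \<omega> - t)))" by (simp add: algebra_simps)
        also have "\<dots> \<le> e' * (s * (L * R))"
          using order_trans[OF dist_le[of n \<omega>] mult_left_mono[OF ZR L(1)]] s(1) e'
          by (intro mult_left_mono) auto
        finally show ?thesis using e'_le by linarith
      qed
      then show ?case using elim by fastforce
    qed
    then show "\<exists>A. \<forall>\<^sub>F n in sequentially. A n \<in> sets P \<and> measure P (A n) < \<eta>
        \<and> (\<forall>\<omega>\<in>space P. norm (Y n \<omega> - B *v Zn n \<omega>) > e \<longrightarrow> \<omega> \<in> A n)" by blast
  qed
  have part3: "conv_distr P Y Q (\<lambda>\<omega>. Pm *v Z \<omega>)" if sph: "spherical Q Z"
  proof -
    have cont: "continuous_on UNIV ((*v) A)" for A :: "((real, 's) vec, 's) vec"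
      by (intro linear_continuous_on matrix_vector_mul_bounded_linear)
    have "conv_distr P Y Q (\<lambda>\<omega>. B *v Z \<omega>)"
      by (rule conv_distr_slutsky[OF P BZ_meas Y_meas Q measurable_matrix_vector_mul[OF Z_meas]
            conv_distr_continuous_map[OF conv cont] part2])
    moreover obtain H where H: "orthogonal_matrix H" "B = Pm ** H"
      by (rule partial_isometry_factor[OF Psym Pidem BB])
    ultimately have "conv_distr P Y Q (\<lambda>\<omega>. Pm *v (H *v Z \<omega>))"
      by (simp add: matrix_vector_mul_assoc)
    then show ?thesis by (rule conv_distr_spherical_rotate[OF sph Z_meas H(1) cont])
  qed
  have part4: "conv_distr P (\<lambda>n \<omega>. (norm (Y n \<omega>))\<^sup>2) Q (\<lambda>\<omega>. \<Sum>i\<in>first_coords m. (Z \<omega> $ i)\<^sup>2)"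
    if sph: "spherical Q Z"
  proof -
    have "range ((*v) Pm) = tangent_space M \<mu>"
    proof
      show "range ((*v) Pm) \<subseteq> tangent_space M \<mu>" using orth_proj(1)[OF T] by (auto simp: Pv)
      show "tangent_space M \<mu> \<subseteq> range ((*v) Pm)"
      proof
        fix w assume "w \<in> tangent_space M \<mu>"
        then have "w = Pm *v w" using orth_proj_id[OF T] by (simp add: Pv)
        then show "w \<in> range ((*v) Pm)" by (rule range_eqI)
      qed
    qed
    then have "dim (range ((*v) Pm)) = card (first_coords m :: 's set)"
      by (simp add: dimT card_first_coords[OF m])
    then obtain H where H: "orthogonal_matrix H"
      "\<And>z. (norm (Pm *v z))\<^sup>2 = (\<Sum>i\<in>first_coords m. ((H *v z) $ i)\<^sup>2)"
      by (rule projection_norm_coords[OF Psym Pidem]) (rule that)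
    have "conv_distr P (\<lambda>n \<omega>. (norm (Y n \<omega>))\<^sup>2) Q (\<lambda>\<omega>. (norm (Pm *v Z \<omega>))\<^sup>2)"
      by (rule conv_distr_continuous_map[OF part3[OF sph]]) (intro continuous_intros)
    then show ?thesis
      unfolding H(2) by (rule conv_distr_spherical_rotate[OF sph Z_meas H(1), rotated]) (intro continuous_intros)
  qed
  \<comment> \<open>Symmetry of \<open>G\<close> and of \<open>S\<close>, with \<open>S ** S\<close>
    equal to the inverse of W, makes the quadratic form the squared norm of
    \<open>Y n\<close>.\<close>
  have quad: "(a n)\<^sup>2 * (h \<bullet> ((G ** matrix_inv W ** G) *v h)) = (norm (a n *\<^sub>R (S *v (G *v h))))\<^sup>2" for n h
  proof -
    have "h \<bullet> ((G ** matrix_inv W ** G) *v h) = (G *v h) \<bullet> (S *v (S *v (G *v h)))"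
      by (simp add: WS G_inner matrix_vector_mul_assoc[symmetric])
    also have "\<dots> = (norm (S *v (G *v h)))\<^sup>2"
      using inner_transpose[of S "G *v h" "S *v (G *v h)"] unfolding Ssym by (simp add: power2_norm_eq_inner)
    finally show ?thesis by (simp add: power_mult_distrib)
  qed
  show ?thesis
    using part1 part2 part3 part4
    unfolding quad Y_def B_def S_def Pm_def by blast
qed

end
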